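(* Suppose that $\mathbb{P}\big(\sum_{i=0}^{b-1}W_i\neq 1\big)>0$ and that there exists $p>1$ such that $\varphi_W(p)>0$. Suppose, moreover, that either $p\in(1,2]$ or $\varphi_W(2)>0$. Then: (1) $(F_n)_{n\ge 1}$ converges uniformly on $[0,1]$, almost surely and in $L^p$ norm (i.e. $\mathbb{E}(\|F_n-F\|_\infty^p)\to 0$), as $n\to\infty$, to a function $F=F_W$, which is nondecreasing if $W\ge 0$ (i.e. if all components of $W$ are nonnegative). Moreover, almost surely, $F$ is $\gamma$-Hölder continuous for all $\gamma\in\big(0,\max_{q\in(1,p]}\varphi_W(q)/q\big)$. (2) $F$ satisfies the following statistical scaling invariance property: with $S_i(t)=(t+i)/b$, there are random functions $F_0,\dots,F_{b-1}$, each distributed like $F$, such that $W=W(\varnothing),F_0,\dots,F_{b-1}$ are independent and, almost surely, for every $0\le i\le b-1$ and every $t\in[i/b,(i+1)/b]$, $$F(t)=F(i/b)+W_i\,F_i\big(S_i^{-1}(t)\big).$$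
   Context: Fix an integer $b\ge 2$, let $\mathscr{A}=\{0,\dots,b-1\}$ and let $\mathscr{A}^*=\bigcup_{n\ge 0}\mathscr{A}^n$ be the set of finite words ($\mathscr{A}^0=\{\varnothing\}$). Let $W=(W_0,\dots,W_{b-1})$ be a $\mathbb{C}^b$-valued random vector with integrable components satisfying $\mathbb{E}\big(\sum_{i=0}^{b-1}W_i\big)=1$, and let $(W(w))_{w\in\mathscr{A}^*}$ be a family of independent copies of $W$ (with $W$ identified with $W(\varnothing)$). For $n\ge1$ and $t\in[0,1]$ define $$F_n(t)=F_{W,n}(t)=\int_0^t b^n\prod_{k=1}^n W_{u_k}(u|k-1)\,\mathrm{d}u,$$ where a non $b$-adic point $u=\sum_{k\ge1}u_kb^{-k}$ is identified with the infinite word $u_1u_2\cdots$ of its $b$-adic digits, $u|k=u_1\cdots u_k$ and $u|0=\varnothing$. For $p\in\mathbb{R}_+$ let $\varphi_W(p)=-\log_b\mathbb{E}\big(\sum_{i=0}^{b-1}|W_i|^p\big)$ (possibly $-\infty$). $\|f\|_\infty=\sup_{t\in[0,1]}|f(t)|$. *)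

theory Defs
  imports "HOL-Probability.Probability"
begin

text \<open>The alphabet is \<open>{..<b}\<close>, words are lists over it, and \<open>\<complex>\<^sup>b\<close> (with \<open>b\<close> a term, not a type)
  is represented by the extensional functions on \<open>{..<b}\<close> with the product Borel
  \<open>\<sigma>\<close>-algebra.\<close>

abbreviation complex_vectors :: "nat \<Rightarrow> (nat \<Rightarrow> complex) measure" where
  "complex_vectors b \<equiv> \<Pi>\<^sub>M i\<in>{..<b}. borel"

text \<open>The \<open>k\<close>-th digit (\<open>k \<ge> 1\<close>) of \<open>u \<in> [0,1)\<close> in base \<open>b\<close>; at \<open>b\<close>-adic points this picks the
  terminating expansion, which is irrelevant under the integral below.\<close>

definition digit :: "nat \<Rightarrow> real \<Rightarrow> nat \<Rightarrow> nat" where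
  "digit b u k = nat (\<lfloor>u * real b ^ k\<rfloor> mod int b)"

definition digit_prefix :: "nat \<Rightarrow> real \<Rightarrow> nat \<Rightarrow> nat list" where
  "digit_prefix b u k = map (digit b u) [1..<Suc k]"

definition cascade ::
  "nat \<Rightarrow> (nat list \<Rightarrow> 'a \<Rightarrow> nat \<Rightarrow> complex) \<Rightarrow> nat \<Rightarrow> 'a \<Rightarrow> real \<Rightarrow> complex" where
  "cascade b W n \<omega> t =
     (LBINT u=0..t. of_nat b ^ n * (\<Prod>k=1..n. W (digit_prefix b u (k - 1)) \<omega> (digit b u k)))"

text \<open>The function \<open>\<phi>\<^sub>V(p) = - log\<^sub>b E (\<Sum>i<b. |V\<^sub>i|\<^sup>p)\<close>, with values in the extended reals.\<close>

definition phi :: "'a measure \<Rightarrow> nat \<Rightarrow> ('a \<Rightarrow> nat \<Rightarrow> complex) \<Rightarrow> real \<Rightarrow> ereal" where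
  "phi M b V p =
     (let m = (\<integral>\<^sup>+\<omega>. ennreal (\<Sum>i<b. cmod (V \<omega> i) powr p) \<partial>M)
      in if m = \<infinity> then - \<infinity> else if m = 0 then \<infinity> else ereal (- log (real b) (enn2real m)))"

definition sup_norm :: "(real \<Rightarrow> complex) \<Rightarrow> real" where
  "sup_norm f = (SUP t\<in>{0..1}. cmod (f t))"

definition holder_continuous_on :: "real \<Rightarrow> real set \<Rightarrow> (real \<Rightarrow> complex) \<Rightarrow> bool" where
  "holder_continuous_on \<gamma> S f \<longleftrightarrow>
     (\<exists>C. \<forall>s\<in>S. \<forall>t\<in>S. cmod (f s - f t) \<le> C * \<bar>s - t\<bar> powr \<gamma>)"

text \<open>The space \<open>C([0,1], \<complex>)\<close> of continuous paths. Its \<open>\<sigma>\<close>-algebra is generated by the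
  evaluations \<open>f \<mapsto> f t\<close>; as \<open>C([0,1], \<complex>)\<close> is separable for the supremum norm, this is the
  Borel \<open>\<sigma>\<close>-algebra of that norm. A random continuous function is a measurable map into it.\<close>

definition continuous_paths :: "(real \<Rightarrow> complex) measure" where
  "continuous_paths =
     restrict_space (\<Pi>\<^sub>M t\<in>{0..1::real}. borel) {f. continuous_on {0..1} f}"

definition similarity :: "nat \<Rightarrow> nat \<Rightarrow> real \<Rightarrow> real" where
  "similarity b i t = (t + real i) / real b"

end

theory Submission
  imports Defs
begin

text \<open>A cascade is a function of the tree \<open>x\<close> of its weight vectors. Cutting \<open>[0,1]\<close> into its \<open>b\<close>
first-level intervals expresses \<open>F\<^sub>n\<^sub>+\<^sub>1(t)\<close> as the sum over \<open>j\<close> of \<open>W\<^sub>j F\<^sub>n\<^sup>j(c(b t - j))\<close>, where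
\<open>F\<^sup>j\<close> is the cascade of the subtree at \<open>j\<close> and \<open>c\<close> is the projection of the line onto \<open>[0,1]\<close>: an
interval to the left of \<open>t\<close> contributes its total mass, one to the right contributes nothing. The
recursive function \<open>cascade_path\<close> has this identity as its definition; it agrees with the integral
by \<open>cascade_eq_cascade_path\<close>. Everything else is an induction along this single branching step.

The probabilistic content of the step is \<open>distr_graft\<close>: the root vector and the \<open>b\<close> subtrees are
independent, and each subtree has the law of the whole tree. Consequently the expectation of the sum
over \<open>j\<close> of \<open>\<bar>W\<^sub>j\<bar>\<^sup>q f(subtree j)\<close> is \<open>m(q)\<close> times the expectation of \<open>f\<close>, where \<open>m(q) = b powr (- \<phi>(q))\<close> is
the expectation of the sum of the \<open>\<bar>W\<^sub>j\<bar>\<^sup>q\<close> (\<open>nn_integral_branching\<close>). The condition \<open>\<phi>(q) > 0\<close>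
says that this operation contracts.

The increments \<open>D\<^sub>n = F\<^sub>n\<^sub>+\<^sub>1 - F\<^sub>n\<close> are controlled in two stages. The first concerns the total mass
\<open>D\<^sub>n(1)\<close>, a centred variable. For \<open>p \<le> 2\<close> a bound of the form
\<open>E \<bar>c + z D\<^sub>n(1)\<bar>\<^sup>p \<le> \<bar>c\<bar>\<^sup>p + K \<bar>z\<bar>\<^sup>p\<close> for all \<open>c\<close>, \<open>z\<close> passes to \<open>D\<^sub>n\<^sub>+\<^sub>1(1)\<close> with \<open>m(p) K\<close> in place of
\<open>K\<close> (\<open>powr_type_branching\<close>), so \<open>E \<bar>D\<^sub>n(1)\<bar>\<^sup>p\<close> decays like \<open>m(p)\<^sup>n\<close>. For \<open>p > 2\<close> the \<open>p\<close>-th power of a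
sum of \<open>b\<close> terms is at most the sum of the \<open>p\<close>-th powers plus cross terms, and by independence the
cross terms carry a factor \<open>E \<bar>D\<^sub>n(1)\<bar>\<close>, which decays geometrically by the case of the exponent
\<open>2\<close>. The second stage concerns the supremum norm: on the \<open>i\<close>-th interval \<open>D\<^sub>n\<^sub>+\<^sub>1\<close> is a sum of total
masses plus \<open>W\<^sub>i\<close> times a copy of \<open>D\<^sub>n\<close>, so \<open>E \<parallel>D\<^sub>n\<parallel>\<^sup>p\<close> satisfies a recursion with a factor as close
to \<open>m(p)\<close> as desired and a geometrically small perturbation (\<open>sup_norm_increment_geometric\<close>).
This yields uniform convergence, both almost surely and in \<open>L\<^sup>p\<close>.

For the regularity, the oscillation of \<open>F\<close> on a \<open>b\<close>-adic interval of level \<open>n\<close> is at most twice the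
weight of the interval times \<open>\<parallel>F\<^sup>w\<parallel>\<close>, and the sum of the \<open>q\<close>-th powers of these bounds over all intervals
of level \<open>n\<close> has expectation \<open>m(q)\<^sup>n E \<parallel>F\<parallel>\<^sup>q\<close>. After multiplication by \<open>b powr (n \<gamma> q)\<close> this is summable
exactly when \<open>\<gamma> < \<phi>(q)/q\<close>. The quotient \<open>\<phi>(q)/q\<close> is continuous on \<open>[1,p]\<close>, positive at \<open>p\<close>, and not
positive at \<open>1\<close> because the mean of the sum of the \<open>W\<^sub>j\<close> is \<open>1\<close>; hence its maximum lies in \<open>(1,p]\<close>.
The scaling invariance is the branching step in the limit, with the \<open>F\<^sub>i\<close> the limits built from the
\<open>b\<close> subtrees.\<close>

section \<open>Inequalities for powers\<close>

text \<open>Bernoulli's inequality for exponents in \<open>[0,1]\<close>: the weighted inequality of the arithmetic and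
geometric means applied to \<open>1 + x\<close> and \<open>1\<close>.\<close>

lemma powr_le_one_plus_mult:
  fixes x a :: real
  assumes x: "-1 \<le> x" and a: "0 \<le> a" "a \<le> 1"
  shows "(1 + x) powr a \<le> 1 + a * x"
proof (cases "x = -1")
  case True
  then show ?thesis using a by simp
next
  case False
  have "(1 + x) powr a * 1 powr (1 - a) \<le> a * (1 + x) + (1 - a) * 1"
    using Youngs_inequality_0[of a "1 - a" "1 + x" 1] False x a by simp
  then show ?thesis by (simp add: algebra_simps)
qed

text \<open>A first-order expansion of \<open>\<bar>a\<bar>\<^sup>p\<close> whose remainder is of order \<open>\<bar>z\<bar>\<^sup>p\<close>, uniformly in \<open>a\<close>; this is where
\<open>p \<le> 2\<close> is used. The linear term disappears after integration of a centred \<open>z\<close>.\<close>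

lemma cmod_add_powr_le_lin:
  fixes a z :: complex and p :: real
  assumes p: "1 < p" "p \<le> 2"
  shows "cmod (a + z) powr p \<le> cmod a powr p + p * cmod a powr (p - 2) * Re (cnj a * z) + 6 * cmod z powr p"
proof (cases "a = 0")
  case True
  then show ?thesis using p by simp
next
  case False
  \<comment> \<open>By homogeneity it suffices to treat \<open>a = 1\<close>. Inside the unit disc this is Bernoulli for the exponent \<open>p / 2 \<le> 1\<close>; outside it every term is dominated by \<open>\<bar>y\<bar>\<^sup>p\<close>.\<close>
  have base: "cmod (1 + y) powr p \<le> 1 + p * Re y + 6 * cmod y powr p" for y :: complex
  proof (cases "cmod y \<le> 1")
    case True
    have sq: "(cmod (1 + y))\<^sup>2 = 1 + (2 * Re y + (cmod y)\<^sup>2)"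
      unfolding cmod_power2 by (simp add: power2_eq_square algebra_simps)
    have "cmod (1 + y) powr p = ((cmod (1 + y))\<^sup>2) powr (p / 2)"
    proof (cases "1 + y = 0")
      case True
      then show ?thesis by simp
    next
      case False
      then have "0 < cmod (1 + y)" by simp
      then show ?thesis by (simp add: powr_powr flip: powr_numeral)
    qed
    also have "\<dots> \<le> 1 + (p / 2) * (2 * Re y + (cmod y)\<^sup>2)"
    proof -
      have ge: "-1 \<le> 2 * Re y + (cmod y)\<^sup>2"
        using sq zero_le_power2[of "cmod (1 + y)"] by linarith
      show ?thesis
        unfolding sq
        using powr_le_one_plus_mult[OF ge, of "p / 2"] p by simp
    qed
    also have "\<dots> = 1 + p * Re y + (p / 2) * (cmod y)\<^sup>2"
      by (simp add: algebra_simps)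
    also have "(p / 2) * (cmod y)\<^sup>2 \<le> 6 * cmod y powr p"
    proof -
      have "(cmod y)\<^sup>2 \<le> cmod y powr p"
      proof (cases "y = 0")
        case False
        then have "(cmod y)\<^sup>2 = cmod y powr 2" by simp
        also have "\<dots> \<le> cmod y powr p"
          using False True p by (intro powr_mono') auto
        finally show ?thesis .
      qed (use p in auto)
      moreover have "(p / 2) * (cmod y)\<^sup>2 \<le> 6 * (cmod y)\<^sup>2"
        using p by (intro mult_right_mono) auto
      ultimately show ?thesis by linarith
    qed
    finally show ?thesis by simp
  next
    case False
    have "cmod (1 + y) \<le> 2 * cmod y"
      using norm_triangle_ineq[of 1 y] False by simp
    then have "cmod (1 + y) powr p \<le> (2 * cmod y) powr p"
      using p by (intro powr_mono2) auto
    also have "\<dots> = 2 powr p * cmod y powr p"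
      by (simp add: powr_mult)
    also have "\<dots> \<le> 4 * cmod y powr p"
      using p powr_mono[of p 2 "2::real"] by (intro mult_right_mono) auto
    finally have 1: "cmod (1 + y) powr p \<le> 4 * cmod y powr p" .
    have "p * \<bar>Re y\<bar> \<le> 2 * cmod y"
      using p abs_Re_le_cmod[of y] by (intro mult_mono) auto
    also have "cmod y \<le> cmod y powr p"
      using powr_mono[of 1 p "cmod y"] p False by auto
    finally have "- (p * Re y) \<le> 2 * cmod y powr p"
      using p by (smt (verit) mult_minus_right mult_left_mono)
    with 1 show ?thesis by linarith
  qed
  have "cmod (a + z) = cmod a * cmod (1 + z / a)"
    using False by (simp add: norm_mult[symmetric] algebra_simps)
  then have "cmod (a + z) powr p = cmod a powr p * cmod (1 + z / a) powr p"
    by (simp add: powr_mult)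
  also have "\<dots> \<le> cmod a powr p * (1 + p * Re (z / a) + 6 * cmod (z / a) powr p)"
    by (intro mult_left_mono base) auto
  also have "\<dots> = cmod a powr p + p * (cmod a powr p * Re (z / a)) + 6 * (cmod a powr p * cmod (z / a) powr p)"
    by (simp add: algebra_simps)
  also have "cmod a powr p * cmod (z / a) powr p = cmod z powr p"
    using False by (simp add: norm_divide powr_mult[symmetric])
  also have "cmod a powr p * Re (z / a) = cmod a powr (p - 2) * Re (cnj a * z)"
  proof -
    have "Re (z / a) = Re (cnj a * z) / (cmod a)\<^sup>2"
      by (simp add: Re_divide cmod_power2 algebra_simps)
    moreover have "cmod a powr (p - 2) = cmod a powr p / (cmod a)\<^sup>2"
      using False by (simp add: powr_diff)
    ultimately show ?thesis by simp
  qed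
  finally show ?thesis by (simp add: mult.assoc)
qed


text \<open>Convexity of \<open>u \<mapsto> u\<^sup>p\<close>: the graph at \<open>u\<close> lies above the tangent at \<open>s\<close>.\<close>

lemma powr_tangent_le:
  fixes s u p :: real
  assumes "1 \<le> p" "0 \<le> u" "u \<le> s"
  shows "s powr p \<le> u powr p + p * s powr (p - 1) * (s - u)"
proof (cases "s = 0")
  case True
  then show ?thesis using assms by simp
next
  case False
  then have s: "0 < s" using assms by simp
  define x where "x = (u / s) powr p - 1"
  have "(1 + x) powr (1 / p) \<le> 1 + (1 / p) * x"
    using assms by (intro powr_le_one_plus_mult) (auto simp: x_def)
  moreover have "(1 + x) powr (1 / p) = u / s"
    using assms s by (simp add: x_def powr_powr)
  ultimately have "p * (u / s) \<le> p * (1 + (1 / p) * x)"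
    using assms by (intro mult_left_mono) auto
  then have "1 \<le> (u / s) powr p + p * (1 - u / s)"
    using assms by (simp add: x_def algebra_simps)
  then have "s powr p * 1 \<le> s powr p * ((u / s) powr p + p * (1 - u / s))"
    by (intro mult_left_mono) auto
  also have "\<dots> = s powr p * (u / s) powr p + p * (s powr p / s) * (s - u)"
    using s by (simp add: field_simps)
  also have "s powr p * (u / s) powr p = u powr p"
    using s assms by (simp add: powr_divide)
  also have "s powr p / s = s powr (p - 1)"
    using s by (simp add: powr_diff)
  finally show ?thesis by simp
qed

lemma sum_powr_le_card_powr:
  fixes u :: "'i \<Rightarrow> real"
  assumes J: "finite J" and u: "\<And>j. j \<in> J \<Longrightarrow> 0 \<le> u j" and p: "0 \<le> p"
  shows "(\<Sum>j\<in>J. u j) powr p \<le> real (card J) powr p * (\<Sum>j\<in>J. u j powr p)"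
proof (cases "J = {}")
  case False
  then have "Max (u ` J) \<in> u ` J" using J by (intro Max_in) auto
  then obtain k where k: "k \<in> J" "u k = Max (u ` J)" by auto
  have "(\<Sum>j\<in>J. u j) \<le> real (card J) * u k"
    using J k by (intro sum_bounded_above) auto
  then have "(\<Sum>j\<in>J. u j) powr p \<le> (real (card J) * u k) powr p"
    using p u by (intro powr_mono2 sum_nonneg) auto
  also have "\<dots> = real (card J) powr p * u k powr p"
    using u k by (simp add: powr_mult)
  also have "\<dots> \<le> real (card J) powr p * (\<Sum>j\<in>J. u j powr p)"
    using J k by (intro mult_left_mono member_le_sum[where f = "\<lambda>j. u j powr p"]) auto
  finally show ?thesis .
qed simp

text \<open>The coefficient of the diagonal terms is \<open>1\<close>. This matters because the inequality is applied once in
each generation, so that a larger coefficient would compound.\<close>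

lemma sum_powr_le_cross_terms:
  fixes u :: "'i \<Rightarrow> real"
  assumes J: "finite J" and u: "\<And>j. j \<in> J \<Longrightarrow> 0 \<le> u j" and p: "1 \<le> p"
  shows "(\<Sum>j\<in>J. u j) powr p \<le> (\<Sum>j\<in>J. u j powr p)
    + p * real (card J) powr (p - 1) * (\<Sum>i\<in>J. \<Sum>j\<in>J - {i}. u i powr (p - 1) * u j)"
proof (cases "J = {}")
  case False
  then have "Max (u ` J) \<in> u ` J" using J by (intro Max_in) auto
  then obtain k where k: "k \<in> J" "u k = Max (u ` J)" by auto
  define s where "s = (\<Sum>j\<in>J. u j)"
  have s: "s = u k + (\<Sum>j\<in>J - {k}. u j)"
    unfolding s_def using J k by (simp add: sum.remove)
  have r: "0 \<le> (\<Sum>j\<in>J - {k}. u j)" using u by (intro sum_nonneg) auto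
  have "s \<le> real (card J) * u k"
    unfolding s_def using J k by (intro sum_bounded_above) auto
  then have "s powr (p - 1) \<le> (real (card J) * u k) powr (p - 1)"
    using p s r u[OF k(1)] by (intro powr_mono2) auto
  also have "\<dots> = real (card J) powr (p - 1) * u k powr (p - 1)"
    using u k by (simp add: powr_mult)
  finally have le: "s powr (p - 1) \<le> real (card J) powr (p - 1) * u k powr (p - 1)" .
  \<comment> \<open>The tangent inequality at the largest term: \<open>s - u k\<close> is the sum of the others, and \<open>s \<le> card J * u k\<close>.\<close>
  have "s powr p \<le> u k powr p + p * s powr (p - 1) * (s - u k)"
    using p s r u[OF k(1)] by (intro powr_tangent_le) auto
  also have "\<dots> \<le> u k powr p + p * (real (card J) powr (p - 1) * u k powr (p - 1)) * (\<Sum>j\<in>J - {k}. u j)"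
    using le p s r by (intro add_left_mono mult_mono mult_left_mono) auto
  also have "\<dots> = u k powr p + p * real (card J) powr (p - 1) * (\<Sum>j\<in>J - {k}. u k powr (p - 1) * u j)"
    by (subst sum_distrib_left[symmetric]) (simp add: mult_ac)
  also have "\<dots> \<le> (\<Sum>j\<in>J. u j powr p)
    + p * real (card J) powr (p - 1) * (\<Sum>i\<in>J. \<Sum>j\<in>J - {i}. u i powr (p - 1) * u j)"
    using J k u p
    by (intro add_mono mult_left_mono member_le_sum[where f = "\<lambda>j. u j powr p"]
        member_le_sum[where f = "\<lambda>i. \<Sum>j\<in>J - {i}. u i powr (p - 1) * u j"])
      (auto intro!: sum_nonneg mult_nonneg_nonneg)
  finally show ?thesis by (simp add: s_def)
qed simp

text \<open>The second summand may keep a coefficient arbitrarily close to \<open>1\<close>, at the price of a large one for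
the first.\<close>

lemma powr_add_split:
  fixes p \<theta> :: real
  assumes p: "0 < p" and \<theta>: "1 < \<theta>"
  obtains \<kappa> where "0 \<le> \<kappa>"
    "\<And>a b. 0 \<le> a \<Longrightarrow> 0 \<le> b \<Longrightarrow> (a + b) powr p \<le> \<kappa> * a powr p + \<theta> * b powr p"
proof -
  define \<delta> where "\<delta> = \<theta> powr (1 / p) - 1"
  have \<delta>: "0 < \<delta>" using p \<theta> by (simp add: \<delta>_def)
  have \<theta>': "(1 + \<delta>) powr p = \<theta>" using p \<theta> by (simp add: \<delta>_def powr_powr)
  show thesis
  proof
    show "0 \<le> (1 + 1 / \<delta>) powr p" by simp
    fix a b :: real assume ab: "0 \<le> a" "0 \<le> b"
    show "(a + b) powr p \<le> (1 + 1 / \<delta>) powr p * a powr p + \<theta> * b powr p"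
    proof (cases "a \<le> \<delta> * b")
      case True
      then have "(a + b) powr p \<le> ((1 + \<delta>) * b) powr p"
        using ab p by (intro powr_mono2) (auto simp: algebra_simps)
      also have "\<dots> = \<theta> * b powr p"
        using ab \<delta> by (simp add: powr_mult \<theta>')
      finally show ?thesis by (smt (verit) mult_nonneg_nonneg powr_ge_zero)
    next
      case False
      then have "b \<le> a / \<delta>" using \<delta> by (simp add: field_simps)
      then have "(a + b) powr p \<le> ((1 + 1 / \<delta>) * a) powr p"
        using ab p by (intro powr_mono2) (auto simp: algebra_simps)
      also have "\<dots> = (1 + 1 / \<delta>) powr p * a powr p"
        using ab \<delta> by (simp add: powr_mult)
      finally show ?thesis using \<theta> by (smt (verit) mult_nonneg_nonneg powr_ge_zero)
    qed
  qed
qed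

text \<open>The two recursions of the proof, for the total mass and for the supremum norm, are contractions up
to a geometrically small error; such a sequence decays geometrically.\<close>

lemma perturbed_contraction_geometric:
  fixes a :: "nat \<Rightarrow> ennreal" and m c s :: real
  assumes m: "0 \<le> m" "m < 1" and s: "0 \<le> s" "s < 1" and c: "0 \<le> c"
    and a0: "a 0 < \<infinity>"
    and step: "\<And>n. a (Suc n) \<le> ennreal (m + c * s ^ n) * a n + ennreal (c * s ^ n)"
  obtains K r where "0 \<le> K" "0 < r" "r < 1" "\<And>n. a n \<le> ennreal (K * r ^ n)"
proof -
  have fin: "a n < \<infinity>" for n
  proof (induction n)
    case (Suc n)
    then have "ennreal (m + c * s ^ n) * a n + ennreal (c * s ^ n) < \<infinity>"
      by (simp add: ennreal_mult_eq_top_iff less_top[symmetric])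
    with step[of n] show ?case by (rule le_less_trans)
  qed (rule a0)
  define f where "f n = enn2real (a n)" for n
  have af: "a n = ennreal (f n)" for n
    using fin[of n] by (simp add: f_def)
  have f0: "0 \<le> f n" for n by (simp add: f_def)
  have fstep: "f (Suc n) \<le> (m + c * s ^ n) * f n + c * s ^ n" for n
  proof -
    have "ennreal (f (Suc n)) \<le> ennreal ((m + c * s ^ n) * f n + c * s ^ n)"
      using step[of n] m s c f0 unfolding af
      by (subst ennreal_plus) (simp_all add: ennreal_mult del: ennreal_plus)
    then show ?thesis
      using m s c f0 by (subst (asm) ennreal_le_iff) auto
  qed
  \<comment> \<open>Two rates with \<open>max m s < r' < r < 1\<close>: eventually the perturbed factor is below \<open>r'\<close>, and the gap \<open>r - r'\<close> absorbs the additive error.\<close>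
  define r where "r = (1 + max m s) / 2"
  define r' where "r' = (max m s + r) / 2"
  have r: "0 < r" "r < 1" "m < r'" "r' < r" "s < r" "s \<le> r"
    using m s by (auto simp: r_def r'_def max_def field_simps)
  have "(\<lambda>n. m + c * s ^ n) \<longlonglongrightarrow> m + c * 0"
    using s by (intro tendsto_intros LIMSEQ_realpow_zero) auto
  then have "\<forall>\<^sub>F n in sequentially. m + c * s ^ n < r'"
    using r by (intro order_tendstoD(2)) auto
  then obtain N where N: "\<And>n. N \<le> n \<Longrightarrow> m + c * s ^ n < r'"
    by (auto simp: eventually_sequentially)
  define K where "K = (\<Sum>n\<le>N. f n / r ^ n) + c / (r - r')"
  have K0: "0 \<le> K"
    unfolding K_def using f0 c r by (intro add_nonneg_nonneg sum_nonneg divide_nonneg_nonneg) auto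
  have bound: "f n \<le> K * r ^ n" for n
  proof (induction n rule: less_induct)
    case (less n)
    show ?case
    proof (cases "n \<le> N")
      case True
      then have "f n / r ^ n \<le> (\<Sum>n\<le>N. f n / r ^ n)"
        using f0 r by (intro member_le_sum) auto
      also have "\<dots> \<le> K" using c r by (simp add: K_def)
      finally show ?thesis using r by (simp add: field_simps)
    next
      case False
      then obtain k where k: "n = Suc k" "N \<le> k" by (cases n) auto
      have IH: "f k \<le> K * r ^ k" using less[of k] k by simp
      have "f n \<le> (m + c * s ^ k) * f k + c * s ^ k" using fstep[of k] k by simp
      also have "\<dots> \<le> r' * (K * r ^ k) + c * r ^ k"
        using N[OF k(2)] IH f0[of k] m s c r K0
        by (intro add_mono mult_mono mult_left_mono power_mono) auto
      also have "\<dots> = (r' * K + c) * r ^ k" by (simp add: algebra_simps)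
      also have "\<dots> \<le> (r * K) * r ^ k"
      proof (intro mult_right_mono)
        have "c / (r - r') \<le> K"
          unfolding K_def using f0 r by (intro order_trans[OF _ add_increasing[OF sum_nonneg order_refl]]) auto
        then have "c \<le> K * (r - r')" using r by (simp add: field_simps)
        then show "r' * K + c \<le> r * K" by (simp add: algebra_simps)
      qed (use r in auto)
      finally show ?thesis using k by (simp add: mult_ac)
    qed
  qed
  show thesis
    using that[OF K0 r(1,2)] bound by (simp add: af ennreal_leI)
qed

section \<open>The cascade as a branching recursion\<close>

definition subtree :: "nat list \<Rightarrow> (nat list \<Rightarrow> 'a) \<Rightarrow> nat list \<Rightarrow> 'a" where
  "subtree w x = (\<lambda>v. x (w @ v))"

lemma subtree_Nil [simp]: "subtree [] x = x"
  by (simp add: subtree_def)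

lemma subtree_apply [simp]: "subtree w x v = x (w @ v)"
  by (simp add: subtree_def)

lemma subtree_subtree [simp]: "subtree v (subtree w x) = subtree (w @ v) x"
  by (simp add: subtree_def)

definition unit_clamp :: "real \<Rightarrow> real" where
  "unit_clamp y = max 0 (min 1 y)"

lemma unit_clamp_mem [simp]: "0 \<le> unit_clamp y" "unit_clamp y \<le> 1"
  by (auto simp: unit_clamp_def)

lemma unit_clamp_mono: "y \<le> z \<Longrightarrow> unit_clamp y \<le> unit_clamp z"
  by (auto simp: unit_clamp_def)

lemma unit_clamp_simps [simp]:
  "y \<le> 0 \<Longrightarrow> unit_clamp y = 0" "1 \<le> y \<Longrightarrow> unit_clamp y = 1"
  "0 \<le> y \<Longrightarrow> y \<le> 1 \<Longrightarrow> unit_clamp y = y"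
  by (auto simp: unit_clamp_def)

lemma less_unit_clamp_iff: "0 \<le> v \<Longrightarrow> v < 1 \<Longrightarrow> v < unit_clamp y \<longleftrightarrow> v < y"
  by (auto simp: unit_clamp_def)

lemma continuous_on_unit_clamp [continuous_intros]:
  "continuous_on S f \<Longrightarrow> continuous_on S (\<lambda>t. unit_clamp (f t))"
  unfolding unit_clamp_def by (intro continuous_intros)

text \<open>The projection \<open>unit_clamp\<close> makes the summand of an interval to the left of \<open>t\<close> equal to its
total mass and that of an interval to the right vanish, so that one formula serves all \<open>t\<close> and continuity
and monotonicity are inherited without gluing.\<close>

primrec cascade_path :: "nat \<Rightarrow> nat \<Rightarrow> (nat list \<Rightarrow> nat \<Rightarrow> complex) \<Rightarrow> real \<Rightarrow> complex" where
  "cascade_path b 0 x t = of_real t"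
| "cascade_path b (Suc n) x t =
     (\<Sum>j<b. x [] j * cascade_path b n (subtree [j] x) (unit_clamp (real b * t - real j)))"

lemma cascade_path_0 [simp]: "cascade_path b n x 0 = 0"
  by (induction n arbitrary: x) auto

lemma continuous_on_cascade_path: "continuous_on {0..1} (cascade_path b n x)"
proof (induction n arbitrary: x)
  case 0
  then show ?case by (auto intro!: continuous_intros)
next
  case (Suc n)
  have "continuous_on {0..1} (\<lambda>t. cascade_path b n (subtree [j] x) (unit_clamp (real b * t - real j)))" for j
    by (rule continuous_on_compose2[OF Suc]) (auto intro!: continuous_intros)
  then show ?case
    by (simp, intro continuous_intros)
qed

definition cascade_density :: "nat \<Rightarrow> nat \<Rightarrow> (nat list \<Rightarrow> nat \<Rightarrow> complex) \<Rightarrow> real \<Rightarrow> complex" where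
  "cascade_density b n x u =
     of_nat b ^ n * (\<Prod>k=1..n. x (digit_prefix b u (k - 1)) (digit b u k))"

lemma digit_first:
  assumes "0 < b" "j < b" "0 \<le> real b * u - real j" "real b * u - real j < 1"
  shows "digit b u (Suc 0) = j"
proof -
  have "\<lfloor>u * real b\<rfloor> = int j"
    using assms by (intro floor_unique) (auto simp: mult.commute)
  then show ?thesis using assms by (simp add: digit_def)
qed

text \<open>Zooming into a first-level interval shifts the digit expansion: \<open>b u\<close> and \<open>b u - j\<close> have the same
fractional part.\<close>

lemma digit_Suc:
  assumes "1 \<le> k"
  shows "digit b u (Suc k) = digit b (real b * u - real j) k"
proof -
  have "u * real b ^ Suc k = (real b * u - real j) * real b ^ k + of_int (int j * int b ^ k)"
    by (simp add: algebra_simps)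
  then have "\<lfloor>u * real b ^ Suc k\<rfloor> = \<lfloor>(real b * u - real j) * real b ^ k + of_int (int j * int b ^ k)\<rfloor>"
    by (rule arg_cong)
  also have "\<dots> = \<lfloor>(real b * u - real j) * real b ^ k\<rfloor> + int j * int b ^ k"
    by (rule floor_add_int[symmetric])
  finally have "\<lfloor>u * real b ^ Suc k\<rfloor> = \<lfloor>(real b * u - real j) * real b ^ k\<rfloor> + int j * int b ^ k" .
  moreover obtain c where "int j * int b ^ k = int b * c"
    using assms by (cases k) auto
  ultimately show ?thesis by (simp add: digit_def)
qed

lemma digit_prefix_Suc:
  assumes "0 < b" "j < b" "0 \<le> real b * u - real j" "real b * u - real j < 1"
  shows "digit_prefix b u (Suc k) = j # digit_prefix b (real b * u - real j) k"
proof -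
  have "[1..<Suc (Suc k)] = Suc 0 # map Suc [1..<Suc k]"
    by (simp add: map_Suc_upt upt_conv_Cons del: upt_Suc)
  then show ?thesis
    unfolding digit_prefix_def using digit_first[OF assms]
    by (simp add: digit_Suc[where j = j] del: upt_Suc)
qed

lemma cascade_density_Suc:
  assumes "0 < b" "j < b" "0 \<le> real b * u - real j" "real b * u - real j < 1"
  shows "cascade_density b (Suc n) x u
    = of_nat b * x [] j * cascade_density b n (subtree [j] x) (real b * u - real j)"
proof -
  let ?v = "real b * u - real j"
  have "(\<Prod>k=1..Suc n. x (digit_prefix b u (k - 1)) (digit b u k))
      = x (digit_prefix b u 0) (digit b u (Suc 0)) * (\<Prod>k=1..n. x (digit_prefix b u k) (digit b u (Suc k)))"
    by (simp add: prod.atLeast_Suc_atMost_Suc_shift prod.atLeast_Suc_atMost[of 0] del: prod.cl_ivl_Suc)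
  also have "x (digit_prefix b u 0) (digit b u (Suc 0)) = x [] j"
    using digit_first[OF assms] by (simp add: digit_prefix_def)
  also have "(\<Prod>k=1..n. x (digit_prefix b u k) (digit b u (Suc k)))
      = (\<Prod>k=1..n. subtree [j] x (digit_prefix b ?v (k - 1)) (digit b ?v k))"
  proof (intro prod.cong refl)
    fix k assume "k \<in> {1..n}"
    then obtain l where l: "k = Suc l" by (cases k) auto
    then show "x (digit_prefix b u k) (digit b u (Suc k))
        = subtree [j] x (digit_prefix b ?v (k - 1)) (digit b ?v k)"
      using digit_prefix_Suc[OF assms, of l] digit_Suc[of k b u j] by simp
  qed
  finally show ?thesis by (simp add: cascade_density_def)
qed

text \<open>Induction on \<open>n\<close>: over each first-level interval the density is \<open>b W\<^sub>j\<close> times the density of the subtree at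
the rescaled point, and the substitution \<open>v = b u - j\<close> cancels the factor \<open>b\<close>. The formulation with
\<open>has_bochner_integral\<close> carries integrability along.\<close>

lemma has_bochner_integral_cascade_density:
  assumes b: "0 < b" and t: "0 \<le> t" "t \<le> 1"
  shows "has_bochner_integral lborel (\<lambda>u. indicator {0..<t} u *\<^sub>R cascade_density b n x u)
           (cascade_path b n x t)"
  using t
proof (induction n arbitrary: x t)
  case 0
  have "has_bochner_integral lborel (\<lambda>u. indicator {0..<t} u *\<^sub>R (1::complex)) (measure lborel {0..<t} *\<^sub>R 1)"
    using 0 by (intro has_bochner_integral_scaleR_left has_bochner_integral_real_indicator) auto
  then show ?case using 0 by (simp add: cascade_density_def scaleR_conv_of_real)
next
  case (Suc n)
  let ?c = "\<lambda>j. unit_clamp (real b * t - real j)"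
  define h where "h j v = indicator {0..<?c j} v *\<^sub>R cascade_density b n (subtree [j] x) v" for j v
  \<comment> \<open>With half-open intervals the decomposition is valid at every \<open>u\<close>, including the \<open>b\<close>-adic points.\<close>
  have "indicator {0..<t} u *\<^sub>R cascade_density b (Suc n) x u
      = (\<Sum>j<b. (of_nat b * x [] j) * h j (- real j + real b * u))" for u
  proof (cases "0 \<le> u \<and> u < 1")
    case True
    define j0 where "j0 = nat \<lfloor>real b * u\<rfloor>"
    have "real b * u < real b" using True b by simp
    then have j0: "j0 < b" "0 \<le> real b * u - real j0" "real b * u - real j0 < 1"
      using True b unfolding j0_def by (auto simp: nat_less_iff floor_less_iff) linarith+
    have zero: "h j (real b * u - real j) = 0" if "j \<noteq> j0" for j
    proof -
      have "real j + 1 \<le> real j0 \<or> real j0 + 1 \<le> real j" using that by linarith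
      then have "real b * u - real j \<notin> {0..<?c j}"
        using j0 unit_clamp_mem(2)[of "real b * t - real j"] by (auto simp del: unit_clamp_mem)
      then show ?thesis by (simp add: h_def)
    qed
    have "real b * u - real j0 < ?c j0 \<longleftrightarrow> real b * u - real j0 < real b * t - real j0"
      using j0 by (intro less_unit_clamp_iff)
    also have "\<dots> \<longleftrightarrow> u < t" using b by simp
    finally have ind: "indicator {0..<t} u = (indicator {0..<?c j0} (real b * u - real j0) :: real)"
      using True j0 by (auto simp: indicator_def)
    have "(\<Sum>j<b. (of_nat b * x [] j) * h j (- real j + real b * u))
        = (\<Sum>j<b. if j = j0 then (of_nat b * x [] j) * h j (- real j + real b * u) else 0)"
      by (intro sum.cong refl) (simp add: zero)
    also have "\<dots> = (of_nat b * x [] j0) * h j0 (- real j0 + real b * u)"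
      using j0 by (subst sum.delta) auto
    finally show ?thesis
      unfolding ind using cascade_density_Suc[OF b j0, of n x] by (simp add: h_def algebra_simps)
  next
    case False
    have "h j (- real j + real b * u) = 0" if "j < b" for j
    proof -
      have "- real j + real b * u \<notin> {0..<?c j}"
      proof
        assume "- real j + real b * u \<in> {0..<?c j}"
        then have "real j \<le> real b * u" "real b * u < real j + 1"
          using unit_clamp_mem(2)[of "real b * t - real j"] by (auto simp del: unit_clamp_mem)
        then have "0 \<le> real b * u" "real b * u < real b * 1" using that by linarith+
        then show False using False b by (simp add: zero_le_mult_iff)
      qed
      then show ?thesis by (simp add: h_def)
    qed
    moreover have "u \<notin> {0..<t}" using False Suc.prems by auto
    ultimately show ?thesis by simp
  qed
  moreover have "has_bochner_integral lborel
      (\<lambda>u. \<Sum>j<b. (of_nat b * x [] j) * h j (- real j + real b * u))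
      (\<Sum>j<b. (of_nat b * x [] j) * (cascade_path b n (subtree [j] x) (?c j) /\<^sub>R \<bar>real b\<bar>))"
    using b unfolding h_def
    by (intro has_bochner_integral_sum has_bochner_integral_mult_right
        lborel_has_bochner_integral_real_affine_iff[THEN iffD1] Suc.IH) auto
  moreover have "(\<Sum>j<b. (of_nat b * x [] j) * (cascade_path b n (subtree [j] x) (?c j) /\<^sub>R \<bar>real b\<bar>))
      = cascade_path b (Suc n) x t"
    using b by (auto simp: scaleR_conv_of_real intro!: sum.cong)
  ultimately show ?case by simp
qed

lemma digit_prefix_in_lists: "0 < b \<Longrightarrow> digit_prefix b u k \<in> lists {..<b}"
  by (auto simp: digit_prefix_def digit_def nat_less_iff)

lemma cascade_eq_cascade_path:
  assumes b: "0 < b" and t: "t \<in> {0..1}"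
  shows "cascade b W n \<omega> t = cascade_path b n (\<lambda>w\<in>lists {..<b}. W w \<omega>) t"
proof -
  let ?x = "\<lambda>w\<in>lists {..<b}. W w \<omega>"
  have "cascade b W n \<omega> t = (LBINT u=0..t. cascade_density b n ?x u)"
    unfolding cascade_def cascade_density_def using digit_prefix_in_lists[OF b] by simp
  also have "\<dots> = (LBINT u:{0<..<t}. cascade_density b n ?x u)"
    using t by (subst interval_integral_Ioo) (auto simp: zero_ereal_def)
  also have "\<dots> = (LBINT u:{0..<t}. cascade_density b n ?x u)"
  proof (rule set_integral_cong_set)
    show meas: "set_borel_measurable lborel {0..<t} (cascade_density b n ?x)"
      using has_bochner_integral_cascade_density[OF b, of t n ?x] t
      by (auto simp: set_borel_measurable_def has_bochner_integral_iff)
    show "set_borel_measurable lborel {0<..<t} (cascade_density b n ?x)"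
      using meas by (rule set_borel_measurable_subset) auto
    show "AE u in lborel. u \<in> {0..<t} \<longleftrightarrow> u \<in> {0<..<t}"
      using AE_lborel_singleton[of "0::real"] by eventually_elim auto
  qed
  also have "\<dots> = cascade_path b n ?x t"
    using has_bochner_integral_cascade_density[OF b, of t n ?x] t
    by (simp add: set_lebesgue_integral_def has_bochner_integral_iff)
  finally show ?thesis .
qed

section \<open>The supremum norm of continuous paths\<close>

lemma bdd_above_cmod_unit_interval:
  assumes "continuous_on {0..1} f"
  shows "bdd_above ((\<lambda>t. cmod (f t)) ` {0..1::real})"
  using assms by (intro bounded_imp_bdd_above compact_imp_bounded compact_continuous_image continuous_intros) auto

lemma cmod_le_sup_norm:
  assumes "continuous_on {0..1} f" "t \<in> {0..1}"
  shows "cmod (f t) \<le> sup_norm f"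
  unfolding sup_norm_def using assms by (intro cSUP_upper bdd_above_cmod_unit_interval)

lemma sup_norm_le:
  assumes "\<And>t. t \<in> {0..1} \<Longrightarrow> cmod (f t) \<le> C"
  shows "sup_norm f \<le> C"
  unfolding sup_norm_def using assms by (intro cSUP_least) auto

lemma sup_norm_nonneg:
  assumes "continuous_on {0..1} f"
  shows "0 \<le> sup_norm f"
  using cmod_le_sup_norm[OF assms, of 0] norm_ge_zero[of "f 0"] by (simp del: norm_ge_zero)

lemma sup_norm_cong:
  assumes "\<And>t. t \<in> {0..1} \<Longrightarrow> f t = g t"
  shows "sup_norm f = sup_norm g"
  unfolding sup_norm_def using assms by (intro SUP_cong) auto

text \<open>For a continuous path the supremum is determined by countably many points; this is what makes it a
random variable.\<close>

lemma sup_norm_le_iff_rational: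
  assumes f: "continuous_on {0..1} f"
  shows "sup_norm f \<le> a \<longleftrightarrow> (\<forall>t\<in>{0<..<1} \<inter> \<rat>. cmod (f t) \<le> a)"
proof
  assume "sup_norm f \<le> a"
  then show "\<forall>t\<in>{0<..<1} \<inter> \<rat>. cmod (f t) \<le> a"
    by (auto intro!: order_trans[OF cmod_le_sup_norm[OF f]])
next
  assume le: "\<forall>t\<in>{0<..<1} \<inter> \<rat>. cmod (f t) \<le> a"
  have cl: "closure ({0<..<1} \<inter> \<rat>) = {0..1::real}"
    by (subst closure_open_Int_superset) (auto simp: Rats_closure_real)
  have cont: "continuous_on (closure ({0<..<1} \<inter> \<rat>)) (\<lambda>t. cmod (f t))"
    unfolding cl using f by (intro continuous_on_norm)
  show "sup_norm f \<le> a"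
    using continuous_le_on_closure[OF cont] le unfolding cl by (intro sup_norm_le) blast
qed

lemma borel_measurable_sup_norm:
  assumes meas: "\<And>t. t \<in> {0..1} \<Longrightarrow> (\<lambda>x. f x t) \<in> borel_measurable N"
    and cont: "\<And>x. x \<in> space N \<Longrightarrow> continuous_on {0..1} (f x)"
  shows "(\<lambda>x. sup_norm (f x)) \<in> borel_measurable N"
proof (subst borel_measurable_iff_le, intro allI)
  fix a
  have "countable ({0<..<1} \<inter> \<rat> :: real set)"
    using countable_rat by (rule countable_subset[rotated]) auto
  moreover have "{x \<in> space N. cmod (f x t) \<le> a} \<in> sets N" if "t \<in> {0<..<1} \<inter> \<rat>" for t
  proof -
    have [measurable]: "(\<lambda>x. f x t) \<in> borel_measurable N" using that by (intro meas) auto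
    show ?thesis by measurable
  qed
  ultimately have "{x \<in> space N. \<forall>t\<in>{0<..<1} \<inter> \<rat>. cmod (f x t) \<le> a} \<in> sets N"
    by (intro sets.sets_Collect_countable_All')
  also have "{x \<in> space N. \<forall>t\<in>{0<..<1} \<inter> \<rat>. cmod (f x t) \<le> a} = {x \<in> space N. sup_norm (f x) \<le> a}"
    using sup_norm_le_iff_rational[OF cont] by auto
  finally show "{x \<in> space N. sup_norm (f x) \<le> a} \<in> sets N" .
qed

section \<open>Increments and the limit path of a tree\<close>

definition increment :: "nat \<Rightarrow> nat \<Rightarrow> (nat list \<Rightarrow> nat \<Rightarrow> complex) \<Rightarrow> real \<Rightarrow> complex" where
  "increment b n x t = cascade_path b (Suc n) x t - cascade_path b n x t"

lemma increment_Suc: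
  "increment b (Suc n) x t
    = (\<Sum>j<b. x [] j * increment b n (subtree [j] x) (unit_clamp (real b * t - real j)))"
  by (simp add: increment_def sum_subtractf[symmetric] algebra_simps)

lemma increment_at_0 [simp]: "increment b n x 0 = 0"
  by (simp add: increment_def del: cascade_path.simps)

lemma increment_Suc_at_1:
  "increment b (Suc n) x 1 = (\<Sum>j<b. x [] j * increment b n (subtree [j] x) 1)"
  unfolding increment_Suc by (intro sum.cong refl) auto

lemma increment_0_at_1: "increment b 0 x 1 = (\<Sum>j<b. x [] j) - 1"
  unfolding increment_def by (auto intro!: sum.cong)

lemma continuous_on_increment: "continuous_on {0..1} (increment b n x)"
  unfolding increment_def[abs_def]
  by (intro continuous_intros continuous_on_cascade_path)

lemma sup_norm_increment_0_le:
  "sup_norm (increment b 0 x) \<le> (\<Sum>j<b. cmod (x [] j)) + 1"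
proof (rule sup_norm_le)
  fix t :: real assume t: "t \<in> {0..1}"
  have "cmod (increment b 0 x t)
      \<le> cmod (\<Sum>j<b. x [] j * of_real (unit_clamp (real b * t - real j))) + cmod (of_real t)"
    unfolding increment_def by (simp only: cascade_path.simps norm_triangle_ineq4)
  also have "cmod (\<Sum>j<b. x [] j * of_real (unit_clamp (real b * t - real j)))
      \<le> (\<Sum>j<b. cmod (x [] j) * 1)"
    by (rule sum_norm_le) (auto simp: norm_mult intro!: mult_left_le)
  finally show "cmod (increment b 0 x t) \<le> (\<Sum>j<b. cmod (x [] j)) + 1"
    using t by simp
qed

text \<open>At a point \<open>t\<close> of the \<open>i\<close>-th interval the increment is the sum of the mass increments of the intervals
on its left and of \<open>x [] i\<close> times the increment of the \<open>i\<close>-th subtree. The maximum over \<open>i\<close> of the last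
part is replaced by an \<open>l\<^sup>p\<close> sum, which costs nothing in the moment estimate since
\<open>moment p\<close> is itself such a sum.\<close>

lemma sup_norm_increment_Suc_le:
  assumes b: "0 < b" and p: "0 < p" and \<kappa>: "0 \<le> \<kappa>"
    and split: "\<And>u v. 0 \<le> u \<Longrightarrow> 0 \<le> v \<Longrightarrow> (u + v) powr p \<le> \<kappa> * u powr p + \<theta> * v powr p"
  shows "sup_norm (increment b (Suc n) x) powr p
    \<le> \<kappa> * real b powr p * (\<Sum>j<b. cmod (x [] j) powr p * cmod (increment b n (subtree [j] x) 1) powr p)
      + \<theta> * (\<Sum>j<b. cmod (x [] j) powr p * sup_norm (increment b n (subtree [j] x)) powr p)"
proof -
  define A where "A = (\<Sum>j<b. cmod (x [] j) * cmod (increment b n (subtree [j] x) 1))"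
  define R where "R = (\<Sum>j<b. cmod (x [] j) powr p * sup_norm (increment b n (subtree [j] x)) powr p)"
  note nonneg = sup_norm_nonneg[OF continuous_on_increment]
  have A: "0 \<le> A" unfolding A_def by (intro sum_nonneg) auto
  have R: "0 \<le> R" unfolding R_def by (intro sum_nonneg) auto
  have "sup_norm (increment b (Suc n) x) \<le> A + R powr (1 / p)"
  proof (rule sup_norm_le)
    fix t :: real assume t: "t \<in> {0..1}"
    \<comment> \<open>The minimum with \<open>b - 1\<close> only matters at \<open>t = 1\<close>, which belongs to the last interval.\<close>
    define i where "i = min (b - 1) (nat \<lfloor>real b * t\<rfloor>)"
    let ?g = "\<lambda>j. x [] j * increment b n (subtree [j] x) (unit_clamp (real b * t - real j))"
    have i: "i < b" using b by (auto simp: i_def)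
    have bt: "0 \<le> real b * t" using t by simp
    have below: "1 \<le> real b * t - real j" if "j < i" for j
    proof -
      have "int j + 1 \<le> \<lfloor>real b * t\<rfloor>" using that bt by (auto simp: i_def)
      then show ?thesis by (simp add: le_floor_iff)
    qed
    have above: "real b * t - real j \<le> 0" if "i < j" "j < b" for j
    proof -
      have "\<lfloor>real b * t\<rfloor> < int j" using that bt by (auto simp: i_def min_def split: if_splits)
      then show ?thesis by (simp add: floor_less_iff)
    qed
    have eq: "increment b (Suc n) x t = ?g i + (\<Sum>j\<in>{..<b} - {i}. ?g j)"
      unfolding increment_Suc using i by (intro sum.remove) auto
    have "cmod (increment b (Suc n) x t) \<le> cmod (?g i) + (\<Sum>j\<in>{..<b} - {i}. cmod (?g j))"
      unfolding eq by (rule order_trans[OF norm_triangle_ineq add_left_mono[OF norm_sum]])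
    moreover have "(\<Sum>j\<in>{..<b} - {i}. cmod (?g j)) \<le> A"
    proof -
      have "cmod (?g j) \<le> cmod (x [] j) * cmod (increment b n (subtree [j] x) 1)"
        if j: "j \<in> {..<b} - {i}" for j
      proof -
        from j consider "j < i" | "i < j" "j < b" by fastforce
        then show ?thesis
          using below above by cases (simp_all add: norm_mult)
      qed
      then have "(\<Sum>j\<in>{..<b} - {i}. cmod (?g j))
          \<le> (\<Sum>j\<in>{..<b} - {i}. cmod (x [] j) * cmod (increment b n (subtree [j] x) 1))"
        by (rule sum_mono)
      also have "\<dots> \<le> A"
        unfolding A_def by (intro sum_mono2) auto
      finally show ?thesis .
    qed
    moreover have "cmod (?g i) \<le> R powr (1 / p)"
    proof -
      let ?m = "cmod (x [] i) * sup_norm (increment b n (subtree [i] x))"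
      have "?m powr p = cmod (x [] i) powr p * sup_norm (increment b n (subtree [i] x)) powr p"
        using nonneg by (simp add: powr_mult)
      also have "\<dots> \<le> R"
        unfolding R_def using i
        by (intro member_le_sum[where f = "\<lambda>j. cmod (x [] j) powr p * sup_norm (increment b n (subtree [j] x)) powr p"]) auto
      finally have "(?m powr p) powr (1 / p) \<le> R powr (1 / p)"
        using p by (intro powr_mono2) auto
      moreover have "(?m powr p) powr (1 / p) = ?m"
        using p nonneg by (simp add: powr_powr)
      moreover have "cmod (?g i) \<le> ?m"
        unfolding norm_mult by (intro mult_left_mono cmod_le_sup_norm continuous_on_increment) auto
      ultimately show ?thesis by simp
    qed
    ultimately show "cmod (increment b (Suc n) x t) \<le> A + R powr (1 / p)" by linarith
  qed
  then have "sup_norm (increment b (Suc n) x) powr p \<le> (A + R powr (1 / p)) powr p"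
    using p nonneg by (intro powr_mono2) auto
  also have "\<dots> \<le> \<kappa> * A powr p + \<theta> * (R powr (1 / p)) powr p"
    using A by (intro split) auto
  also have "(R powr (1 / p)) powr p = R" using R p by (simp add: powr_powr)
  also have "A powr p \<le> real b powr p * (\<Sum>j<b. (cmod (x [] j) * cmod (increment b n (subtree [j] x) 1)) powr p)"
    unfolding A_def using sum_powr_le_card_powr[of "{..<b}" "\<lambda>j. cmod (x [] j) * cmod (increment b n (subtree [j] x) 1)" p] p
    by simp
  finally show ?thesis using \<kappa> by (simp add: R_def powr_mult mult.assoc mult_left_mono)
qed

text \<open>Summability of the supremum norms is a measurable condition on the tree and forces uniform
convergence. Where it fails the path is \<open>0\<close>, so that every tree has a continuous limit path; the
restriction to \<open>[0,1]\<close> makes it an element of \<open>continuous_paths\<close>.\<close>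

definition tree_limit :: "nat \<Rightarrow> (nat list \<Rightarrow> nat \<Rightarrow> complex) \<Rightarrow> real \<Rightarrow> complex" where
  "tree_limit b x = (\<lambda>t\<in>{0..1}.
     if summable (\<lambda>n. sup_norm (increment b n x)) then lim (\<lambda>n. cascade_path b n x t) else 0)"

lemma cascade_path_eq_sum_increment:
  "cascade_path b (n + m) x t = cascade_path b n x t + (\<Sum>k<m. increment b (k + n) x t)"
  by (induction m) (simp_all add: increment_def add.commute del: cascade_path.simps)

lemma tree_limit_tail:
  assumes S: "summable (\<lambda>n. sup_norm (increment b n x))" and t: "t \<in> {0..1}"
  shows tendsto_tree_limit: "(\<lambda>n. cascade_path b n x t) \<longlonglongrightarrow> tree_limit b x t"
    and cmod_tree_limit_diff_le: "cmod (tree_limit b x t - cascade_path b n x t)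
      \<le> (\<Sum>k. sup_norm (increment b (k + n) x))"
proof -
  have sum_n: "summable (\<lambda>k. sup_norm (increment b (k + n) x))" for n
    using S by (rule summable_ignore_initial_segment)
  have le: "cmod (increment b k x t) \<le> sup_norm (increment b k x)" for k
    using t by (intro cmod_le_sup_norm continuous_on_increment)
  have sum_t: "summable (\<lambda>k. cmod (increment b (k + n) x t))" for n
    using sum_n[of n] by (rule summable_comparison_test') (use le in simp)
  have lim: "(\<lambda>m. cascade_path b m x t) \<longlonglongrightarrow> cascade_path b n x t + (\<Sum>k. increment b (k + n) x t)" for n
  proof -
    have "(\<lambda>m. cascade_path b n x t + (\<Sum>k<m. increment b (k + n) x t))
        \<longlonglongrightarrow> cascade_path b n x t + (\<Sum>k. increment b (k + n) x t)"
      by (rule tendsto_add[OF tendsto_const summable_LIMSEQ[OF summable_norm_cancel[OF sum_t]]])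
    moreover have "cascade_path b (m + n) x t = cascade_path b n x t + (\<Sum>k<m. increment b (k + n) x t)" for m
      using cascade_path_eq_sum_increment[of b n m x t] by (simp only: add.commute[of n m])
    ultimately have "(\<lambda>m. cascade_path b (m + n) x t)
        \<longlonglongrightarrow> cascade_path b n x t + (\<Sum>k. increment b (k + n) x t)"
      by simp
    then show ?thesis by (rule LIMSEQ_offset)
  qed
  have eq: "tree_limit b x t = cascade_path b n x t + (\<Sum>k. increment b (k + n) x t)" for n
    using S t limI[OF lim[of n]] by (simp add: tree_limit_def)
  show "(\<lambda>n. cascade_path b n x t) \<longlonglongrightarrow> tree_limit b x t"
    using lim[of 0] eq[of 0] by simp
  have "cmod (\<Sum>k. increment b (k + n) x t) \<le> (\<Sum>k. cmod (increment b (k + n) x t))"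
    by (rule summable_norm[OF sum_t])
  also have "\<dots> \<le> (\<Sum>k. sup_norm (increment b (k + n) x))"
    by (intro suminf_le le sum_t sum_n)
  finally show "cmod (tree_limit b x t - cascade_path b n x t)
      \<le> (\<Sum>k. sup_norm (increment b (k + n) x))"
    by (simp add: eq[of n])
qed

lemma uniform_limit_tree_limit:
  assumes S: "summable (\<lambda>n. sup_norm (increment b n x))"
  shows "uniform_limit {0..1} (\<lambda>n. cascade_path b n x) (tree_limit b x) sequentially"
proof (rule uniform_limitI)
  fix e :: real assume "0 < e"
  then obtain N where N: "\<And>n. N \<le> n \<Longrightarrow> norm (\<Sum>k. sup_norm (increment b (k + n) x)) < e"
    using suminf_exist_split[OF _ S] by blast
  show "\<forall>\<^sub>F n in sequentially. \<forall>t\<in>{0..1}. dist (cascade_path b n x t) (tree_limit b x t) < e"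
    unfolding eventually_sequentially
  proof (intro exI[of _ N] allI impI ballI)
    fix n t assume "N \<le> n" "t \<in> {0..1::real}"
    then show "dist (cascade_path b n x t) (tree_limit b x t) < e"
      using cmod_tree_limit_diff_le[OF S, of t n] N[of n]
      by (simp add: dist_norm norm_minus_commute)
  qed
qed

lemma continuous_on_tree_limit: "continuous_on {0..1} (tree_limit b x)"
proof (cases "summable (\<lambda>n. sup_norm (increment b n x))")
  case True
  show ?thesis
    by (rule uniform_limit_theorem[OF _ uniform_limit_tree_limit[OF True]])
      (auto intro!: always_eventually continuous_on_cascade_path)
next
  case False
  then have "tree_limit b x t = 0" if "t \<in> {0..1}" for t
    using that by (simp add: tree_limit_def)
  then show ?thesis
    using continuous_on_cong[OF refl, of "{0..1}" "tree_limit b x" "\<lambda>_. 0"] by simp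
qed

lemma tree_limit_0 [simp]: "tree_limit b x 0 = 0"
  by (simp add: tree_limit_def)

lemma tree_limit_branching:
  assumes S: "summable (\<lambda>n. sup_norm (increment b n x))"
    and S': "\<And>j. j < b \<Longrightarrow> summable (\<lambda>n. sup_norm (increment b n (subtree [j] x)))"
    and t: "t \<in> {0..1}"
  shows "tree_limit b x t
    = (\<Sum>j<b. x [] j * tree_limit b (subtree [j] x) (unit_clamp (real b * t - real j)))"
proof (rule LIMSEQ_unique)
  show "(\<lambda>n. cascade_path b (Suc n) x t) \<longlonglongrightarrow> tree_limit b x t"
    using tendsto_tree_limit[OF S t] by (rule LIMSEQ_Suc)
  show "(\<lambda>n. cascade_path b (Suc n) x t)
      \<longlonglongrightarrow> (\<Sum>j<b. x [] j * tree_limit b (subtree [j] x) (unit_clamp (real b * t - real j)))"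
    unfolding cascade_path.simps
    by (intro tendsto_intros tendsto_tree_limit S') auto
qed

text \<open>In the difference of the branching identities at \<open>t\<close> and at the left end \<open>i / b\<close> of its interval only
the summand \<open>i\<close> changes.\<close>

lemma tree_limit_scaling:
  assumes b: "0 < b" and S: "summable (\<lambda>n. sup_norm (increment b n x))"
    and S': "\<And>j. j < b \<Longrightarrow> summable (\<lambda>n. sup_norm (increment b n (subtree [j] x)))"
    and i: "i < b" and t: "real i \<le> real b * t" "real b * t \<le> real i + 1"
  shows "tree_limit b x t = tree_limit b x (real i / real b)
    + x [] i * tree_limit b (subtree [i] x) (real b * t - real i)"
proof -
  let ?g = "\<lambda>t j. x [] j * tree_limit b (subtree [j] x) (unit_clamp (real b * t - real j))"
  have "0 \<le> real b * t" using t by linarith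
  moreover have "real b * t \<le> real b * 1" using t i by linarith
  ultimately have t01: "t \<in> {0..1}" using b by (simp add: zero_le_mult_iff)
  have i01: "real i / real b \<in> {0..1}" using i by simp
  have "?g t j - ?g (real i / real b) j = (if j = i then x [] i * tree_limit b (subtree [i] x) (real b * t - real i) else 0)"
    if "j < b" for j
  proof -
    consider "j = i" | "j + 1 \<le> i" | "i + 1 \<le> j" by linarith
    then show ?thesis
    proof cases
      case 1
      then show ?thesis using t b by simp
    next
      case 2
      then have "real j + 1 \<le> real i" by linarith
      then show ?thesis using 2 t b by simp
    next
      case 3
      then have "real i + 1 \<le> real j" by linarith
      then show ?thesis using 3 t b by simp
    qed
  qed
  then have "(\<Sum>j<b. ?g t j - ?g (real i / real b) j)
      = (\<Sum>j<b. if j = i then x [] i * tree_limit b (subtree [i] x) (real b * t - real i) else 0)"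
    by (intro sum.cong) auto
  also have "\<dots> = x [] i * tree_limit b (subtree [i] x) (real b * t - real i)"
    using i by simp
  finally show ?thesis
    using tree_limit_branching[OF S S' t01] tree_limit_branching[OF S S' i01]
    by (simp add: sum_subtractf algebra_simps)
qed

text \<open>A single bound \<open>C\<close>, which will be an integrable random variable, controls all the increments; so
one integration gives the convergence in \<open>L\<^sup>p\<close> and finiteness of \<open>C\<close> gives the uniform one.\<close>

lemma tree_limit_error_powr_le:
  assumes p: "0 < p" and s: "0 < s" "s < 1" and C: "0 \<le> C"
    and le: "\<And>n. sup_norm (increment b n x) powr p \<le> C * s ^ n"
  shows summable_sup_norm_increment: "summable (\<lambda>n. sup_norm (increment b n x))"
    and "sup_norm (\<lambda>t. cascade_path b n x t - tree_limit b x t) powr p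
      \<le> C * s ^ n / (1 - s powr (1 / p)) powr p"
proof -
  define \<sigma> where "\<sigma> = s powr (1 / p)"
  have \<sigma>: "0 < \<sigma>" "\<sigma> < 1"
    using s p powr_less_mono2[of "1 / p" s 1] by (auto simp: \<sigma>_def)
  have \<sigma>_pow: "(s ^ n) powr (1 / p) = \<sigma> ^ n" for n
    using s by (simp add: \<sigma>_def powr_realpow[symmetric] powr_powr mult.commute)
  have nonneg: "0 \<le> sup_norm (increment b n x)" for n
    by (rule sup_norm_nonneg[OF continuous_on_increment])
  have le': "sup_norm (increment b n x) \<le> C powr (1 / p) * \<sigma> ^ n" for n
  proof -
    have "sup_norm (increment b n x) = (sup_norm (increment b n x) powr p) powr (1 / p)"
      using nonneg p by (simp add: powr_powr)
    also have "\<dots> \<le> (C * s ^ n) powr (1 / p)"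
      using le p by (intro powr_mono2) auto
    also have "\<dots> = C powr (1 / p) * \<sigma> ^ n"
      using C s by (simp add: powr_mult \<sigma>_pow)
    finally show ?thesis .
  qed
  have geo: "summable (\<lambda>k. C powr (1 / p) * \<sigma> ^ (k + n))" for n
    using \<sigma> by (auto simp: power_add intro!: summable_mult summable_mult2 summable_geometric)
  show S: "summable (\<lambda>n. sup_norm (increment b n x))"
    using geo[of 0] by (rule summable_comparison_test') (use le' nonneg in auto)
  have "(\<Sum>k. sup_norm (increment b (k + n) x)) \<le> (\<Sum>k. C powr (1 / p) * \<sigma> ^ (k + n))"
    by (intro suminf_le le' geo summable_ignore_initial_segment S)
  also have "\<dots> = C powr (1 / p) * \<sigma> ^ n * (1 / (1 - \<sigma>))"
  proof -
    have "(\<Sum>k. C powr (1 / p) * \<sigma> ^ (k + n)) = (\<Sum>k. (C powr (1 / p) * \<sigma> ^ n) * \<sigma> ^ k)"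
      by (simp add: power_add mult_ac)
    also have "\<dots> = C powr (1 / p) * \<sigma> ^ n * (\<Sum>k. \<sigma> ^ k)"
      using \<sigma> by (intro suminf_mult summable_geometric) auto
    finally show ?thesis using \<sigma> by (simp add: suminf_geometric)
  qed
  finally have tail: "(\<Sum>k. sup_norm (increment b (k + n) x)) \<le> C powr (1 / p) * \<sigma> ^ n / (1 - \<sigma>)"
    by simp
  have cont: "continuous_on {0..1} (\<lambda>t. cascade_path b n x t - tree_limit b x t)"
    by (intro continuous_intros continuous_on_cascade_path continuous_on_tree_limit)
  have "sup_norm (\<lambda>t. cascade_path b n x t - tree_limit b x t) \<le> C powr (1 / p) * \<sigma> ^ n / (1 - \<sigma>)"
    using cmod_tree_limit_diff_le[OF S, of _ n] tail
    by (intro sup_norm_le) (auto simp: norm_minus_commute intro: order_trans)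
  then have "sup_norm (\<lambda>t. cascade_path b n x t - tree_limit b x t) powr p
      \<le> (C powr (1 / p) * \<sigma> ^ n / (1 - \<sigma>)) powr p"
    using p sup_norm_nonneg[OF cont] by (intro powr_mono2) auto
  also have "\<dots> = C * s ^ n / (1 - \<sigma>) powr p"
    using C s p \<sigma> by (simp add: powr_divide powr_mult powr_powr \<sigma>_pow[symmetric])
  finally show "sup_norm (\<lambda>t. cascade_path b n x t - tree_limit b x t) powr p
      \<le> C * s ^ n / (1 - s powr (1 / p)) powr p" by (simp add: \<sigma>_def)
qed

lemma sum_in_nonneg_Reals:
  "(\<And>i. i \<in> A \<Longrightarrow> f i \<in> \<real>\<^sub>\<ge>\<^sub>0) \<Longrightarrow> sum f A \<in> \<real>\<^sub>\<ge>\<^sub>0"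
  by (induction A rule: infinite_finite_induct) auto

lemma cascade_path_diff_nonneg:
  assumes "\<And>w i. w \<in> lists {..<b} \<Longrightarrow> i < b \<Longrightarrow> x w i \<in> \<real>\<^sub>\<ge>\<^sub>0" and "s \<le> t"
  shows "cascade_path b n x t - cascade_path b n x s \<in> \<real>\<^sub>\<ge>\<^sub>0"
  using assms
proof (induction n arbitrary: x s t)
  case 0
  then show ?case by (simp flip: of_real_diff)
next
  case (Suc n)
  have "cascade_path b (Suc n) x t - cascade_path b (Suc n) x s
      = (\<Sum>j<b. x [] j * (cascade_path b n (subtree [j] x) (unit_clamp (real b * t - real j))
          - cascade_path b n (subtree [j] x) (unit_clamp (real b * s - real j))))"
    by (simp add: sum_subtractf[symmetric] algebra_simps)
  also have "\<dots> \<in> \<real>\<^sub>\<ge>\<^sub>0"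
    using Suc.prems
    by (intro sum_in_nonneg_Reals nonneg_Reals_mult_I Suc.IH unit_clamp_mono)
      (auto simp: mult_left_mono)
  finally show ?case .
qed

lemma tree_limit_diff_nonneg:
  assumes nonneg: "\<And>w i. w \<in> lists {..<b} \<Longrightarrow> i < b \<Longrightarrow> x w i \<in> \<real>\<^sub>\<ge>\<^sub>0"
    and st: "s \<le> t" "s \<in> {0..1}" "t \<in> {0..1}"
  shows "tree_limit b x t - tree_limit b x s \<in> \<real>\<^sub>\<ge>\<^sub>0"
proof (cases "summable (\<lambda>n. sup_norm (increment b n x))")
  case True
  show ?thesis
  proof (rule Lim_in_closed_set[OF closed_nonneg_Reals_complex])
    show "(\<lambda>n. cascade_path b n x t - cascade_path b n x s) \<longlonglongrightarrow> tree_limit b x t - tree_limit b x s"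
      using st by (intro tendsto_intros tendsto_tree_limit True)
  qed (use cascade_path_diff_nonneg[OF nonneg st(1)] in auto)
next
  case False
  then show ?thesis using st by (simp add: tree_limit_def)
qed

text \<open>Two points at a distance of at most \<open>b\<^sup>-\<^sup>m\<close> lie in the same or in two adjacent \<open>b\<close>-adic intervals of
level \<open>m\<close>.\<close>

lemma holder_continuous_on_of_adic:
  assumes b: "2 \<le> b" and \<gamma>: "0 < \<gamma>" and B: "0 \<le> B"
    and adic: "\<And>n k s t. k < b ^ n \<Longrightarrow> real k / real b ^ n \<le> s \<Longrightarrow> s \<le> (real k + 1) / real b ^ n \<Longrightarrow>
      real k / real b ^ n \<le> t \<Longrightarrow> t \<le> (real k + 1) / real b ^ n \<Longrightarrow>
      cmod (f s - f t) \<le> B * real b powr (- (\<gamma> * real n))"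
  shows "holder_continuous_on \<gamma> {0..1} f"
proof -
  define C where "C = 2 * B * real b powr \<gamma>"
  have C: "0 \<le> C" using B by (simp add: C_def)
  have main: "cmod (f s - f t) \<le> C * \<bar>s - t\<bar> powr \<gamma>" if st: "0 \<le> s" "s < t" "t \<le> 1" for s t
  proof -
    \<comment> \<open>The least such \<open>n\<close> is positive; for \<open>m = n - 1\<close> the distance is at most \<open>b\<^sup>-\<^sup>m\<close> and exceeds \<open>b\<^sup>-\<^sup>m\<^sup>-\<^sup>1\<close>.\<close>
    have "\<exists>n. inverse (real b) ^ n < t - s"
      using b st by (intro real_arch_pow_inv) (auto simp: inverse_less_1_iff)
    then obtain n where n: "inverse (real b) ^ n < t - s" "\<And>m. m < n \<Longrightarrow> \<not> inverse (real b) ^ m < t - s"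
      using exists_least_iff[of "\<lambda>n. inverse (real b) ^ n < t - s"] by blast
    have "n \<noteq> 0" using n(1) st by (cases n) auto
    then obtain m where m: "n = Suc m" by (cases n) auto
    have le: "t - s \<le> inverse (real b) ^ m" using n(2)[of m] m by simp
    let ?N = "real b ^ m"
    have N: "0 < ?N" using b by simp
    define k where "k = nat \<lfloor>s * ?N\<rfloor>"
    have k: "real k \<le> s * ?N" "s * ?N < real k + 1"
      using st N unfolding k_def by (simp_all add: of_nat_nat)
    have "s * ?N < 1 * ?N" using st N by (intro mult_strict_right_mono) auto
    then have "real k < ?N" using k by linarith
    then have "real k < real (b ^ m)" by (simp only: of_nat_power)
    then have kb: "k < b ^ m" by linarith
    have tN: "t * ?N \<le> s * ?N + 1"
      using le N by (simp add: field_simps)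
    let ?E = "B * real b powr (- (\<gamma> * real m))"
    have E0: "0 \<le> ?E" using B by simp
    have "cmod (f s - f t) \<le> 2 * ?E"
    proof (cases "t * ?N \<le> real k + 1")
      case True
      have "cmod (f s - f t) \<le> ?E"
      proof -
        have "s * ?N \<le> t * ?N" using st N by (intro mult_right_mono) auto
        then have "real k \<le> t * ?N" using k by linarith
        then show ?thesis
          using k True N by (intro adic[OF kb]) (auto simp: pos_le_divide_eq pos_divide_le_eq)
      qed
      then show ?thesis using E0 by simp
    next
      case False
      define u where "u = (real k + 1) / ?N"
      have uN: "u * ?N = real k + 1" using N by (simp add: u_def)
      have "real (k + 1) < real (b ^ m)"
      proof -
        have "t * ?N \<le> 1 * ?N" using st N by (intro mult_right_mono) auto
        then show ?thesis using False by simp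
      qed
      then have kb': "k + 1 < b ^ m" by linarith
      have "cmod (f s - f u) \<le> ?E"
        using k uN N by (intro adic[OF kb]) (auto simp: pos_le_divide_eq pos_divide_le_eq)
      moreover have "cmod (f u - f t) \<le> ?E"
        using k uN N False tN by (intro adic[OF kb']) (auto simp: pos_le_divide_eq pos_divide_le_eq)
      moreover have "cmod (f s - f t) \<le> cmod (f s - f u) + cmod (f u - f t)"
        using norm_triangle_ineq[of "f s - f u" "f u - f t"] by simp
      ultimately show ?thesis by simp
    qed
    also have "2 * ?E = C * (real b powr (- real n)) powr \<gamma>"
      using b by (simp add: C_def m powr_powr powr_add[symmetric] algebra_simps)
    also have "real b powr (- real n) = inverse (real b) ^ n"
      using b by (simp add: powr_minus powr_realpow power_inverse)
    also have "C * (inverse (real b) ^ n) powr \<gamma> \<le> C * \<bar>s - t\<bar> powr \<gamma>"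
      using n(1) st \<gamma> C by (intro mult_left_mono powr_mono2) auto
    finally show ?thesis .
  qed
  show ?thesis
    unfolding holder_continuous_on_def
  proof (intro exI[of _ C] ballI)
    fix s t :: real assume st: "s \<in> {0..1}" "t \<in> {0..1}"
    consider "s = t" | "s < t" | "t < s" by linarith
    then show "cmod (f s - f t) \<le> C * \<bar>s - t\<bar> powr \<gamma>"
      using main[of s t] main[of t s] st by cases (auto simp: norm_minus_commute abs_minus_commute)
  qed
qed

lemma holder_continuous_on_mono:
  assumes "holder_continuous_on \<gamma>' {0..1} f" "\<gamma> \<le> \<gamma>'"
  shows "holder_continuous_on \<gamma> {0..1} f"
proof -
  obtain C where C: "\<And>s t. s \<in> {0..1} \<Longrightarrow> t \<in> {0..1} \<Longrightarrow> cmod (f s - f t) \<le> C * \<bar>s - t\<bar> powr \<gamma>'"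
    using assms(1) unfolding holder_continuous_on_def by blast
  show ?thesis
    unfolding holder_continuous_on_def
  proof (intro exI[of _ "\<bar>C\<bar>"] ballI)
    fix s t :: real assume st: "s \<in> {0..1}" "t \<in> {0..1}"
    have "cmod (f s - f t) \<le> C * \<bar>s - t\<bar> powr \<gamma>'" by (rule C[OF st])
    also have "\<dots> \<le> \<bar>C\<bar> * \<bar>s - t\<bar> powr \<gamma>'" by (intro mult_right_mono) auto
    also have "\<dots> \<le> \<bar>C\<bar> * \<bar>s - t\<bar> powr \<gamma>"
      using st assms(2) by (intro mult_left_mono powr_mono') auto
    finally show "cmod (f s - f t) \<le> \<bar>C\<bar> * \<bar>s - t\<bar> powr \<gamma>" .
  qed
qed

section \<open>The law of the tree and its branching\<close>

lemma measurable_apply_apply: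
  assumes "w \<in> I" "j \<in> J" "\<And>v. v \<in> I \<Longrightarrow> sets (N v) = sets (\<Pi>\<^sub>M i\<in>J. borel)"
  shows "(\<lambda>x. x w j) \<in> borel_measurable (\<Pi>\<^sub>M w\<in>I. N w)"
proof -
  have "(\<lambda>x. x w) \<in> (\<Pi>\<^sub>M w\<in>I. N w) \<rightarrow>\<^sub>M N w" using assms(1) by simp
  moreover have "(\<lambda>a. a j) \<in> borel_measurable (N w)"
    unfolding measurable_cong_sets[OF assms(3)[OF assms(1)] refl] using assms(2) by simp
  ultimately show ?thesis by (rule measurable_compose)
qed

locale cascade_law = prob_space \<mu> for \<mu> :: "(nat \<Rightarrow> complex) measure" +
  fixes b :: nat
  assumes b: "2 \<le> b"
    and sets_\<mu>: "sets \<mu> = sets (complex_vectors b)"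
begin

abbreviation words :: "nat list set" where
  "words \<equiv> lists {..<b}"

definition tree_law :: "(nat list \<Rightarrow> nat \<Rightarrow> complex) measure" where
  "tree_law = (\<Pi>\<^sub>M w\<in>words. \<mu>)"

sublocale tree: prob_space tree_law
  unfolding tree_law_def by (intro prob_space_PiM prob_space_axioms)

lemma sets_tree_law: "sets tree_law = sets (\<Pi>\<^sub>M w\<in>words. complex_vectors b)"
  unfolding tree_law_def by (intro sets_PiM_cong refl sets_\<mu>)

lemma measurable_coordinate [measurable]: "j < b \<Longrightarrow> (\<lambda>a. a j) \<in> borel_measurable \<mu>"
  unfolding measurable_cong_sets[OF sets_\<mu> refl] by simp

lemma measurable_weight [measurable]:
  "w \<in> words \<Longrightarrow> j < b \<Longrightarrow> (\<lambda>x. x w j) \<in> borel_measurable tree_law"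
  unfolding tree_law_def by (rule measurable_apply_apply) (auto simp: sets_\<mu>)

lemma measurable_root: "(\<lambda>x. x []) \<in> tree_law \<rightarrow>\<^sub>M \<mu>"
  unfolding tree_law_def by simp

lemma space_tree_lawD: "x \<in> space tree_law \<Longrightarrow> w \<notin> words \<Longrightarrow> x w = undefined"
  unfolding tree_law_def space_PiM by (auto simp: PiE_def extensional_def)

lemma subtree_eq_restrict:
  assumes "w \<in> words" "x \<in> space tree_law"
  shows "subtree w x = (\<lambda>v\<in>words. x (w @ v))"
  using assms space_tree_lawD[of x] by (auto simp: fun_eq_iff)

lemma measurable_subtree [measurable]:
  assumes "w \<in> words"
  shows "subtree w \<in> tree_law \<rightarrow>\<^sub>M tree_law"
proof -
  have "(\<lambda>x. \<lambda>v\<in>words. x (w @ v)) \<in> tree_law \<rightarrow>\<^sub>M tree_law"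
    unfolding tree_law_def using assms by (intro measurable_restrict) auto
  then show ?thesis
    using subtree_eq_restrict[OF assms] by (subst measurable_cong)
qed

lemma distr_subtree:
  assumes "w \<in> words"
  shows "distr tree_law tree_law (subtree w) = tree_law"
proof -
  have "distr tree_law tree_law (subtree w) = distr tree_law tree_law (\<lambda>x. \<lambda>v\<in>words. x (w @ v))"
    using subtree_eq_restrict[OF assms] by (intro distr_cong) auto
  also have "\<dots> = tree_law"
    unfolding tree_law_def using assms
    by (intro distr_PiM_reindex[where f = "\<lambda>v. w @ v" and M = "\<lambda>_. \<mu>"] prob_space_axioms)
      (auto simp: inj_on_def)
  finally show ?thesis .
qed

lemma distr_root: "distr tree_law \<mu> (\<lambda>x. x []) = \<mu>"
  unfolding tree_law_def by (intro distr_PiM_component prob_space_axioms) simp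

definition graft :: "(nat \<Rightarrow> complex) \<Rightarrow> (nat \<Rightarrow> nat list \<Rightarrow> nat \<Rightarrow> complex) \<Rightarrow> nat list \<Rightarrow> nat \<Rightarrow> complex" where
  "graft a y = (\<lambda>w\<in>words. case w of [] \<Rightarrow> a | j # v \<Rightarrow> y j v)"

abbreviation forest_law :: "(nat \<Rightarrow> nat list \<Rightarrow> nat \<Rightarrow> complex) measure" where
  "forest_law \<equiv> (\<Pi>\<^sub>M j\<in>{..<b}. tree_law)"

lemma graft_root [simp]: "graft a y [] = a"
  by (simp add: graft_def)

lemma subtree_graft:
  assumes "y \<in> space forest_law" "j < b"
  shows "subtree [j] (graft a y) = y j"
proof
  fix v
  have "y j \<in> space tree_law" using assms by (auto simp: space_PiM)
  then show "subtree [j] (graft a y) v = y j v"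
    using assms space_tree_lawD[of "y j" v] by (auto simp: graft_def)
qed

lemma measurable_graft [measurable]: "(\<lambda>(a, y). graft a y) \<in> \<mu> \<Otimes>\<^sub>M forest_law \<rightarrow>\<^sub>M tree_law"
proof -
  have "(\<lambda>z. \<lambda>w\<in>words. case w of [] \<Rightarrow> fst z | j # v \<Rightarrow> snd z j v)
      \<in> \<mu> \<Otimes>\<^sub>M forest_law \<rightarrow>\<^sub>M (\<Pi>\<^sub>M w\<in>words. \<mu>)"
  proof (rule measurable_restrict)
    fix w assume w: "w \<in> words"
    show "(\<lambda>z. case w of [] \<Rightarrow> fst z | j # v \<Rightarrow> snd z j v) \<in> \<mu> \<Otimes>\<^sub>M forest_law \<rightarrow>\<^sub>M \<mu>"
    proof (cases w)
      case (Cons j v)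
      then have jv: "j \<in> {..<b}" "v \<in> words" using w by auto
      have "(\<lambda>z. snd z j) \<in> \<mu> \<Otimes>\<^sub>M forest_law \<rightarrow>\<^sub>M tree_law"
        using jv by (intro measurable_compose[OF measurable_snd] measurable_component_singleton)
      moreover have "(\<lambda>x. x v) \<in> tree_law \<rightarrow>\<^sub>M \<mu>"
        unfolding tree_law_def using jv by (intro measurable_component_singleton)
      ultimately have "(\<lambda>z. snd z j v) \<in> \<mu> \<Otimes>\<^sub>M forest_law \<rightarrow>\<^sub>M \<mu>"
        by (rule measurable_compose)
      then show ?thesis by (simp add: Cons)
    qed simp
  qed
  then show ?thesis
    unfolding tree_law_def graft_def by (simp add: case_prod_beta')
qed

text \<open>Both sides are determined by finite cylinders. A cylinder constrains the root vector and, separately,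
each of the \<open>b\<close> subtrees, so its preimage under grafting is a measurable rectangle and the product over the
finitely many constrained words splits accordingly.\<close>

lemma distr_graft: "distr (\<mu> \<Otimes>\<^sub>M forest_law) tree_law (\<lambda>(a, y). graft a y) = tree_law"
proof -
  interpret forest: prob_space forest_law
    by (intro prob_space_PiM tree.prob_space_axioms)
  interpret pair: pair_prob_space \<mu> forest_law ..
  let ?Q = "\<mu> \<Otimes>\<^sub>M forest_law" and ?g = "\<lambda>(a, y). graft a y"
  show ?thesis
  proof (rule measure_eqI_PiM_infinite[where I = words and M = "\<lambda>_. \<mu>"])
    fix A J assume J: "finite J" "J \<subseteq> words" and A: "\<And>w. w \<in> J \<Longrightarrow> A w \<in> sets \<mu>"
    let ?X = "prod_emb words (\<lambda>_. \<mu>) J (Pi\<^sub>E J A)"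
    define A0 where "A0 = (if [] \<in> J then A [] else space \<mu>)"
    \<comment> \<open>The constrained words of the \<open>j\<close>-th subtree.\<close>
    define K where "K j = {v. j # v \<in> J}" for j
    define B where "B j = prod_emb words (\<lambda>_. \<mu>) (K j) (\<Pi>\<^sub>E v\<in>K j. A (j # v))" for j
    have K: "finite (K j)" "K j \<subseteq> words" for j
    proof -
      have "K j = (\<lambda>v. j # v) -` J" by (auto simp: K_def)
      then show "finite (K j)" using J by (simp add: finite_vimageI)
      show "K j \<subseteq> words" using J by (auto simp: K_def)
    qed
    have AK: "v \<in> K j \<Longrightarrow> A (j # v) \<in> sets \<mu>" for j v using A by (auto simp: K_def)
    have A0: "A0 \<in> sets \<mu>" using A by (auto simp: A0_def)
    have B: "B j \<in> sets tree_law" for j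
      unfolding B_def tree_law_def using K AK by (intro sets_PiM_I) auto
    have X: "?X \<in> sets tree_law"
      unfolding tree_law_def using J A by (intro sets_PiM_I) auto
    have pre: "?g -` ?X \<inter> space ?Q = A0 \<times> (\<Pi>\<^sub>E j\<in>{..<b}. B j)"
    proof -
      have key: "graft a y \<in> ?X \<longleftrightarrow> a \<in> A0 \<and> (\<forall>j<b. y j \<in> B j)"
        if a: "a \<in> space \<mu>" and y: "y \<in> space forest_law" for a y
      proof -
        have yj: "y j \<in> space tree_law" if "j < b" for j using y that by (auto simp: space_PiM)
        have g: "graft a y \<in> space tree_law"
          using measurable_space[OF measurable_graft, of "(a, y)"] a y by (simp add: space_pair_measure)
        have mem: "x \<in> prod_emb words (\<lambda>_. \<mu>) L (Pi\<^sub>E L C) \<longleftrightarrow> (\<forall>w\<in>L. x w \<in> C w)"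
          if "x \<in> space tree_law" for x L C
          using that by (auto simp: prod_emb_iff tree_law_def space_PiM PiE_iff)
        have "graft a y \<in> ?X \<longleftrightarrow> (\<forall>w\<in>J. graft a y w \<in> A w)"
          by (rule mem[OF g])
        also have "\<dots> \<longleftrightarrow> ([] \<in> J \<longrightarrow> a \<in> A []) \<and> (\<forall>j v. j # v \<in> J \<longrightarrow> graft a y (j # v) \<in> A (j # v))"
        proof safe
          fix w assume "\<forall>j v. j # v \<in> J \<longrightarrow> graft a y (j # v) \<in> A (j # v)" "w \<in> J" "a \<in> A []"
          then show "graft a y w \<in> A w" by (cases w) auto
        next
          fix w assume "\<forall>j v. j # v \<in> J \<longrightarrow> graft a y (j # v) \<in> A (j # v)" "w \<in> J" "[] \<notin> J"
          then show "graft a y w \<in> A w" by (cases w) auto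
        qed auto
        also have "(\<forall>j v. j # v \<in> J \<longrightarrow> graft a y (j # v) \<in> A (j # v)) \<longleftrightarrow> (\<forall>j<b. y j \<in> B j)"
        proof -
          have "(\<forall>j v. j # v \<in> J \<longrightarrow> graft a y (j # v) \<in> A (j # v))
              \<longleftrightarrow> (\<forall>j<b. \<forall>v\<in>K j. y j v \<in> A (j # v))"
          proof -
            have "graft a y (j # v) = y j v" "j < b" if "j # v \<in> J" for j v
              using that J by (auto simp: graft_def)
            then show ?thesis by (auto simp: K_def)
          qed
          also have "\<dots> \<longleftrightarrow> (\<forall>j<b. y j \<in> B j)"
            unfolding B_def using mem[OF yj] by auto
          finally show ?thesis .
        qed
        finally show ?thesis using a by (auto simp: A0_def)
      qed
      have B_iff: "y \<in> (\<Pi>\<^sub>E j\<in>{..<b}. B j) \<longleftrightarrow> y \<in> space forest_law \<and> (\<forall>j<b. y j \<in> B j)" for y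
        using sets.sets_into_space[OF B] by (auto simp: space_PiM PiE_iff)
      show ?thesis
      proof (rule set_eqI)
        fix z :: "(nat \<Rightarrow> complex) \<times> (nat \<Rightarrow> nat list \<Rightarrow> nat \<Rightarrow> complex)"
        obtain a y where z: "z = (a, y)" by (cases z)
        have "z \<in> ?g -` ?X \<inter> space ?Q \<longleftrightarrow> a \<in> space \<mu> \<and> y \<in> space forest_law \<and> graft a y \<in> ?X"
          by (auto simp: z space_pair_measure)
        also have "\<dots> \<longleftrightarrow> a \<in> A0 \<and> y \<in> (\<Pi>\<^sub>E j\<in>{..<b}. B j)"
          unfolding B_iff using key sets.sets_into_space[OF A0] by blast
        finally show "z \<in> ?g -` ?X \<inter> space ?Q \<longleftrightarrow> z \<in> A0 \<times> (\<Pi>\<^sub>E j\<in>{..<b}. B j)"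
          by (simp add: z)
      qed
    qed
    have "emeasure (distr ?Q tree_law ?g) ?X = emeasure ?Q (A0 \<times> (\<Pi>\<^sub>E j\<in>{..<b}. B j))"
      using X by (subst emeasure_distr) (simp_all add: pre)
    also have "\<dots> = emeasure \<mu> A0 * emeasure forest_law (\<Pi>\<^sub>E j\<in>{..<b}. B j)"
      using A0 B by (intro forest.emeasure_pair_measure_Times sets_PiM_I_finite) auto
    also have "emeasure forest_law (\<Pi>\<^sub>E j\<in>{..<b}. B j) = (\<Prod>j<b. emeasure tree_law (B j))"
    proof -
      interpret fp: finite_product_prob_space "\<lambda>_. tree_law" "{..<b}"
        by standard simp
      show ?thesis using B by (intro fp.measure_times) auto
    qed
    also have "(\<Prod>j<b. emeasure tree_law (B j)) = (\<Prod>j<b. \<Prod>v\<in>K j. emeasure \<mu> (A (j # v)))"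
      unfolding B_def tree_law_def using K AK
      by (intro prod.cong refl emeasure_PiM_emb prob_space_axioms) auto
    also have "\<dots> = (\<Prod>(j, v)\<in>Sigma {..<b} K. emeasure \<mu> (A (j # v)))"
      using K by (intro prod.Sigma) auto
    also have "\<dots> = (\<Prod>w\<in>J - {[]}. emeasure \<mu> (A w))"
    proof (rule prod.reindex_bij_witness[where i = "\<lambda>w. (hd w, tl w)" and j = "\<lambda>(j, v). j # v"])
      fix w assume "w \<in> J - {[]}"
      then obtain j v where "w = j # v" "w \<in> J" by (cases w) auto
      then show "(hd w, tl w) \<in> Sigma {..<b} K" using J by (auto simp: K_def)
    qed (auto simp: K_def)
    also have "emeasure \<mu> A0 * \<dots> = (\<Prod>w\<in>J. emeasure \<mu> (A w))"
      using J by (cases "[] \<in> J") (auto simp: A0_def prod.remove emeasure_space_1)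
    also have "\<dots> = emeasure tree_law ?X"
      unfolding tree_law_def using J A by (intro emeasure_PiM_emb[symmetric] prob_space_axioms) auto
    finally show "emeasure (distr ?Q tree_law ?g) ?X = emeasure tree_law ?X" .
  next
    show "finite_measure (distr ?Q tree_law ?g)"
      using measurable_graft by (intro prob_space.finite_measure pair.prob_space_distr)
  qed (simp_all add: tree_law_def)
qed

lemma nn_integral_tree_law:
  assumes [measurable]: "f \<in> borel_measurable tree_law"
  shows "(\<integral>\<^sup>+x. f x \<partial>tree_law) = (\<integral>\<^sup>+a. \<integral>\<^sup>+y. f (graft a y) \<partial>forest_law \<partial>\<mu>)"
proof -
  interpret forest: prob_space forest_law
    by (intro prob_space_PiM tree.prob_space_axioms)
  have "(\<integral>\<^sup>+x. f x \<partial>tree_law) = (\<integral>\<^sup>+x. f x \<partial>distr (\<mu> \<Otimes>\<^sub>M forest_law) tree_law (\<lambda>(a, y). graft a y))"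
    by (simp add: distr_graft)
  also have "\<dots> = (\<integral>\<^sup>+z. f (case z of (a, y) \<Rightarrow> graft a y) \<partial>(\<mu> \<Otimes>\<^sub>M forest_law))"
    by (rule nn_integral_distr) simp_all
  also have "\<dots> = (\<integral>\<^sup>+a. \<integral>\<^sup>+y. f (graft a y) \<partial>forest_law \<partial>\<mu>)"
    by (subst forest.nn_integral_fst[symmetric]) simp_all
  finally show ?thesis .
qed

lemma nn_integral_forest_component:
  assumes "j < b" and [measurable]: "f \<in> borel_measurable tree_law"
  shows "(\<integral>\<^sup>+y. f (y j) \<partial>forest_law) = (\<integral>\<^sup>+x. f x \<partial>tree_law)"
proof -
  have "(\<integral>\<^sup>+x. f x \<partial>tree_law) = (\<integral>\<^sup>+x. f x \<partial>distr forest_law tree_law (\<lambda>y. y j))"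
    using assms by (subst distr_PiM_component) (auto intro: tree.prob_space_axioms)
  also have "\<dots> = (\<integral>\<^sup>+y. f (y j) \<partial>forest_law)"
    using assms by (intro nn_integral_distr) auto
  finally show ?thesis by simp
qed

lemma nn_integral_forest_pair:
  assumes ij: "i < b" "j < b" "i \<noteq> j"
    and [measurable]: "f \<in> borel_measurable tree_law" "h \<in> borel_measurable tree_law"
  shows "(\<integral>\<^sup>+y. f (y i) * h (y j) \<partial>forest_law) = (\<integral>\<^sup>+x. f x \<partial>tree_law) * (\<integral>\<^sup>+x. h x \<partial>tree_law)"
proof -
  interpret product_sigma_finite "\<lambda>_::nat. tree_law" ..
  define g where "g k = (if k = i then f else if k = j then h else (\<lambda>_. 1))" for k
  have two: "(\<Prod>k<b. G k) = G i * G j" if "\<And>k. k \<noteq> i \<Longrightarrow> k \<noteq> j \<Longrightarrow> G k = 1" for G :: "nat \<Rightarrow> ennreal"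
  proof -
    have "(\<Prod>k<b. G k) = (\<Prod>k\<in>{i, j}. G k)"
      using ij that by (intro prod.mono_neutral_right) auto
    then show ?thesis using ij by simp
  qed
  have "(\<integral>\<^sup>+y. f (y i) * h (y j) \<partial>forest_law) = (\<integral>\<^sup>+y. (\<Prod>k<b. g k (y k)) \<partial>forest_law)"
    using ij by (subst two) (auto simp: g_def)
  also have "\<dots> = (\<Prod>k<b. \<integral>\<^sup>+x. g k x \<partial>tree_law)"
    by (rule product_nn_integral_prod) (auto simp: g_def)
  also have "\<dots> = (\<integral>\<^sup>+x. f x \<partial>tree_law) * (\<integral>\<^sup>+x. h x \<partial>tree_law)"
    using ij by (subst two) (auto simp: g_def tree.emeasure_space_1)
  finally show ?thesis .
qed

text \<open>The number \<open>b powr (- \<phi>(q))\<close>, with the value \<open>\<infinity>\<close> allowed.\<close>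

definition moment :: "real \<Rightarrow> ennreal" where
  "moment q = (\<integral>\<^sup>+a. (\<Sum>j<b. ennreal (cmod (a j) powr q)) \<partial>\<mu>)"

text \<open>One generation multiplies expectations by \<open>moment q\<close>: condition on the root vector.\<close>

lemma nn_integral_branching:
  assumes [measurable]: "f \<in> borel_measurable tree_law"
  shows "(\<integral>\<^sup>+x. (\<Sum>j<b. ennreal (cmod (x [] j) powr q) * f (subtree [j] x)) \<partial>tree_law)
    = moment q * (\<integral>\<^sup>+x. f x \<partial>tree_law)"
proof -
  have [measurable]: "(\<lambda>y. f (y j)) \<in> borel_measurable forest_law" if "j < b" for j
    using that by (intro measurable_compose[OF measurable_component_singleton]) auto
  have meas [measurable]: "(\<lambda>x. \<Sum>j<b. ennreal (cmod (x [] j) powr q) * f (subtree [j] x))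
      \<in> borel_measurable tree_law"
    by (intro borel_measurable_sum borel_measurable_times_ennreal measurable_compose[OF measurable_subtree])
      (auto intro!: measurable_compose[OF measurable_weight])
  have "(\<integral>\<^sup>+x. (\<Sum>j<b. ennreal (cmod (x [] j) powr q) * f (subtree [j] x)) \<partial>tree_law)
      = (\<integral>\<^sup>+a. \<integral>\<^sup>+y. (\<Sum>j<b. ennreal (cmod (a j) powr q) * f (y j)) \<partial>forest_law \<partial>\<mu>)"
    by (subst nn_integral_tree_law[OF meas]) (intro nn_integral_cong, simp add: subtree_graft)
  also have "\<dots> = (\<integral>\<^sup>+a. (\<Sum>j<b. ennreal (cmod (a j) powr q)) * (\<integral>\<^sup>+x. f x \<partial>tree_law) \<partial>\<mu>)"
    by (intro nn_integral_cong)
      (simp add: nn_integral_sum nn_integral_cmult nn_integral_forest_component sum_distrib_right del: sum_ennreal)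
  also have "\<dots> = moment q * (\<integral>\<^sup>+x. f x \<partial>tree_law)"
    unfolding moment_def by (intro nn_integral_multc) simp
  finally show ?thesis .
qed

text \<open>The sum of \<open>\<bar>Q(w)\<bar>\<^sup>q f(x\<^sup>w)\<close> over the words \<open>w\<close> of length \<open>n\<close>, where \<open>Q(w)\<close> is the product of the weights
along \<open>w\<close> and \<open>x\<^sup>w\<close> is the subtree at \<open>w\<close>.\<close>

primrec level_sum :: "real \<Rightarrow> ((nat list \<Rightarrow> nat \<Rightarrow> complex) \<Rightarrow> ennreal) \<Rightarrow> nat
    \<Rightarrow> (nat list \<Rightarrow> nat \<Rightarrow> complex) \<Rightarrow> ennreal" where
  "level_sum q f 0 x = f x"
| "level_sum q f (Suc n) x = (\<Sum>j<b. ennreal (cmod (x [] j) powr q) * level_sum q f n (subtree [j] x))"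

lemma measurable_level_sum [measurable]:
  assumes [measurable]: "f \<in> borel_measurable tree_law"
  shows "level_sum q f n \<in> borel_measurable tree_law"
proof (induction n)
  case (Suc n)
  then have "(\<lambda>x. level_sum q f (Suc n) x) \<in> borel_measurable tree_law"
    unfolding level_sum.simps
    by (intro borel_measurable_sum borel_measurable_times_ennreal measurable_compose[OF measurable_subtree])
      (auto intro!: measurable_compose[OF measurable_weight])
  then show ?case by simp
qed simp

lemma nn_integral_level_sum:
  assumes [measurable]: "f \<in> borel_measurable tree_law"
  shows "(\<integral>\<^sup>+x. level_sum q f n x \<partial>tree_law) = moment q ^ n * (\<integral>\<^sup>+x. f x \<partial>tree_law)"
  by (induction n) (simp_all add: nn_integral_branching mult_ac)


section \<open>Decay of the total mass increments\<close>

lemma b_pos: "0 < b" using b by simp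

lemma words_single [simp]: "j < b \<Longrightarrow> [j] \<in> words" by simp

lemma measurable_cascade_path [measurable]:
  "(\<lambda>x. cascade_path b n x t) \<in> borel_measurable tree_law"
proof (induction n arbitrary: t)
  case (Suc n)
  then show ?case
    unfolding cascade_path.simps
    by (intro borel_measurable_sum borel_measurable_times measurable_weight
        measurable_compose[OF measurable_subtree]) auto
qed simp

lemma measurable_increment [measurable]:
  "(\<lambda>x. increment b n x t) \<in> borel_measurable tree_law"
  unfolding increment_def by measurable

lemma measurable_sup_norm_increment [measurable]:
  "(\<lambda>x. sup_norm (increment b n x)) \<in> borel_measurable tree_law"
  by (rule borel_measurable_sup_norm) (auto intro: continuous_on_increment measurable_increment)

text \<open>A form of the bound \<open>E \<bar>X\<bar>\<^sup>p \<le> K\<close> for centred \<open>X\<close> that is stable under sums of independent variables: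
the coefficient of \<open>\<bar>c\<bar>\<^sup>p\<close> is \<open>1\<close>, hence the constants simply add up. A bound
\<open>E \<bar>\<Sum> X\<^sub>j\<bar>\<^sup>p \<le> C \<Sum> E \<bar>X\<^sub>j\<bar>\<^sup>p\<close> would lose the factor \<open>C\<close> in each generation.\<close>

definition powr_type :: "real \<Rightarrow> ennreal \<Rightarrow> ((nat list \<Rightarrow> nat \<Rightarrow> complex) \<Rightarrow> complex) \<Rightarrow> bool" where
  "powr_type p K X \<longleftrightarrow> (\<forall>c z.
     (\<integral>\<^sup>+x. ennreal (cmod (c + z * X x) powr p) \<partial>tree_law)
       \<le> ennreal (cmod c powr p) + K * ennreal (cmod z powr p))"

text \<open>Integrate out one variable at a time; the partial sum of the others plays the role of \<open>c\<close>.\<close>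

lemma powr_type_forest:
  assumes type: "powr_type p K X" and [measurable]: "X \<in> borel_measurable tree_law"
    and J: "finite (J :: nat set)"
  shows "(\<integral>\<^sup>+y. ennreal (cmod (c + (\<Sum>j\<in>J. a j * X (y j))) powr p) \<partial>(\<Pi>\<^sub>M j\<in>J. tree_law))
    \<le> ennreal (cmod c powr p) + K * (\<Sum>j\<in>J. ennreal (cmod (a j) powr p))"
  using J
proof (induction J)
  case empty
  have "prob_space (\<Pi>\<^sub>M j\<in>({}::nat set). tree_law)"
    by (intro prob_space_PiM tree.prob_space_axioms)
  then have "emeasure (\<Pi>\<^sub>M j\<in>({}::nat set). tree_law) (space (\<Pi>\<^sub>M j\<in>({}::nat set). tree_law)) = 1"
    by (rule prob_space.emeasure_space_1)
  then show ?case by (simp only: nn_integral_const sum.empty) simp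
next
  case (insert i J)
  interpret product_sigma_finite "\<lambda>_::nat. tree_law" ..
  have [measurable]: "(\<lambda>y. X (y j)) \<in> borel_measurable (\<Pi>\<^sub>M j\<in>J'. tree_law)" if "j \<in> J'" for j J'
    using that by (intro measurable_compose[OF measurable_component_singleton]) auto
  let ?S = "\<lambda>y. c + (\<Sum>j\<in>J. a j * X (y j))"
  have meas: "(\<lambda>y. ennreal (cmod (c + (\<Sum>j\<in>insert i J. a j * X (y j))) powr p))
      \<in> borel_measurable (\<Pi>\<^sub>M j\<in>insert i J. tree_law)"
    by measurable
  have "(\<integral>\<^sup>+y. ennreal (cmod (c + (\<Sum>j\<in>insert i J. a j * X (y j))) powr p) \<partial>(\<Pi>\<^sub>M j\<in>insert i J. tree_law))
      = (\<integral>\<^sup>+y. \<integral>\<^sup>+x. ennreal (cmod (c + (\<Sum>j\<in>insert i J. a j * X ((y(i := x)) j))) powr p)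
          \<partial>tree_law \<partial>(\<Pi>\<^sub>M j\<in>J. tree_law))"
    by (rule product_nn_integral_insert[OF insert(1,2) meas])
  also have "\<dots> = (\<integral>\<^sup>+y. \<integral>\<^sup>+x. ennreal (cmod (?S y + a i * X x) powr p) \<partial>tree_law \<partial>(\<Pi>\<^sub>M j\<in>J. tree_law))"
  proof (intro nn_integral_cong)
    fix y x
    have "(\<Sum>j\<in>J. a j * X ((y(i := x)) j)) = (\<Sum>j\<in>J. a j * X (y j))"
      using insert by (intro sum.cong) auto
    then have "(\<Sum>j\<in>insert i J. a j * X ((y(i := x)) j)) = a i * X x + (\<Sum>j\<in>J. a j * X (y j))"
      using insert by simp
    then show "ennreal (cmod (c + (\<Sum>j\<in>insert i J. a j * X ((y(i := x)) j))) powr p)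
        = ennreal (cmod (?S y + a i * X x) powr p)"
      by (simp only: add_ac)
  qed
  also have "\<dots> \<le> (\<integral>\<^sup>+y. (ennreal (cmod (?S y) powr p) + K * ennreal (cmod (a i) powr p)) \<partial>(\<Pi>\<^sub>M j\<in>J. tree_law))"
    using type unfolding powr_type_def by (intro nn_integral_mono) blast
  also have "\<dots> = (\<integral>\<^sup>+y. ennreal (cmod (?S y) powr p) \<partial>(\<Pi>\<^sub>M j\<in>J. tree_law))
      + (\<integral>\<^sup>+y. K * ennreal (cmod (a i) powr p) \<partial>(\<Pi>\<^sub>M j\<in>J. tree_law))"
    by (intro nn_integral_add) measurable
  also have "(\<integral>\<^sup>+y. K * ennreal (cmod (a i) powr p) \<partial>(\<Pi>\<^sub>M j\<in>J. tree_law)) = K * ennreal (cmod (a i) powr p)"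
    using prob_space.emeasure_space_1[OF prob_space_PiM[of J "\<lambda>_. tree_law"]] tree.prob_space_axioms by simp
  also have "(\<integral>\<^sup>+y. ennreal (cmod (?S y) powr p) \<partial>(\<Pi>\<^sub>M j\<in>J. tree_law))
      \<le> ennreal (cmod c powr p) + K * (\<Sum>j\<in>J. ennreal (cmod (a j) powr p))"
    by (rule insert.IH)
  finally show ?case
    using insert by (simp add: distrib_left add_ac add_left_mono del: sum_ennreal)
qed

lemma powr_type_branching:
  assumes type: "powr_type p K X" and [measurable]: "X \<in> borel_measurable tree_law"
  shows "powr_type p (moment p * K) (\<lambda>x. \<Sum>j<b. x [] j * X (subtree [j] x))"
  unfolding powr_type_def
proof (intro allI)
  fix c z
  have [measurable]: "(\<lambda>x. x [] j * X (subtree [j] x)) \<in> borel_measurable tree_law" if "j < b" for j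
    using that by (intro borel_measurable_times measurable_weight measurable_compose[OF measurable_subtree]) auto
  have meas: "(\<lambda>x. ennreal (cmod (c + z * (\<Sum>j<b. x [] j * X (subtree [j] x))) powr p)) \<in> borel_measurable tree_law"
    by measurable
  have "(\<integral>\<^sup>+x. ennreal (cmod (c + z * (\<Sum>j<b. x [] j * X (subtree [j] x))) powr p) \<partial>tree_law)
      = (\<integral>\<^sup>+a. \<integral>\<^sup>+y. ennreal (cmod (c + (\<Sum>j<b. (z * a j) * X (y j))) powr p) \<partial>forest_law \<partial>\<mu>)"
    by (subst nn_integral_tree_law[OF meas])
      (intro nn_integral_cong, simp add: subtree_graft sum_distrib_left mult.assoc)
  also have "\<dots> \<le> (\<integral>\<^sup>+a. (ennreal (cmod c powr p) + K * (\<Sum>j<b. ennreal (cmod (z * a j) powr p))) \<partial>\<mu>)"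
    by (intro nn_integral_mono powr_type_forest type) simp_all
  also have "\<dots> = (\<integral>\<^sup>+a. (ennreal (cmod c powr p)
      + (K * ennreal (cmod z powr p)) * (\<Sum>j<b. ennreal (cmod (a j) powr p))) \<partial>\<mu>)"
    by (intro nn_integral_cong)
      (simp add: norm_mult powr_mult ennreal_mult sum_distrib_left[symmetric] mult_ac del: sum_ennreal)
  also have "\<dots> = ennreal (cmod c powr p) + (K * ennreal (cmod z powr p)) * moment p"
    unfolding moment_def
    by (simp add: nn_integral_add nn_integral_cmult emeasure_space_1 del: sum_ennreal)
  finally show "(\<integral>\<^sup>+x. ennreal (cmod (c + z * (\<Sum>j<b. x [] j * X (subtree [j] x))) powr p) \<partial>tree_law)
      \<le> ennreal (cmod c powr p) + moment p * K * ennreal (cmod z powr p)"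
    by (simp add: mult_ac)
qed

text \<open>The starting point of the induction over generations: in the first-order expansion around \<open>c\<close> the
linear term has mean \<open>0\<close>.\<close>

lemma powr_type_centered:
  assumes p: "1 < p" "p \<le> 2" and X: "integrable tree_law X" and mean: "(\<integral>x. X x \<partial>tree_law) = 0"
    and fin: "(\<integral>\<^sup>+x. ennreal (cmod (X x) powr p) \<partial>tree_law) < \<infinity>"
  shows "powr_type p (6 * (\<integral>\<^sup>+x. ennreal (cmod (X x) powr p) \<partial>tree_law)) X"
  unfolding powr_type_def
proof (intro allI)
  fix c z
  have [measurable]: "X \<in> borel_measurable tree_law" using X by simp
  have int_p: "integrable tree_law (\<lambda>x. cmod (X x) powr p)"
    using fin by (intro integrableI_bounded) auto
  define l where "l x = Re (cnj c * (z * X x))" for x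
  have int_l: "integrable tree_law l" and mean_l: "(\<integral>x. l x \<partial>tree_law) = 0"
  proof -
    have "has_bochner_integral tree_law (\<lambda>x. cnj c * (z * X x)) (cnj c * (z * 0))"
      using X mean by (intro has_bochner_integral_mult_right) (auto simp: has_bochner_integral_iff)
    then have "has_bochner_integral tree_law l (Re (cnj c * (z * 0)))"
      unfolding l_def by (rule has_bochner_integral_bounded_linear[OF bounded_linear_Re])
    then show "integrable tree_law l" "(\<integral>x. l x \<partial>tree_law) = 0"
      by (simp_all add: has_bochner_integral_iff)
  qed
  let ?R = "\<lambda>x. cmod c powr p + p * cmod c powr (p - 2) * l x + 6 * (cmod z powr p * cmod (X x) powr p)"
  have le: "cmod (c + z * X x) powr p \<le> ?R x" for x
    using cmod_add_powr_le_lin[OF p, of c "z * X x"] by (simp add: l_def norm_mult powr_mult)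
  have "(\<integral>\<^sup>+x. ennreal (cmod (c + z * X x) powr p) \<partial>tree_law) \<le> (\<integral>\<^sup>+x. ennreal (?R x) \<partial>tree_law)"
    by (intro nn_integral_mono ennreal_leI le)
  also have "\<dots> = ennreal (\<integral>x. ?R x \<partial>tree_law)"
    using order_trans[OF powr_ge_zero le] int_l int_p by (intro nn_integral_eq_integral) auto
  also have "(\<integral>x. ?R x \<partial>tree_law) = cmod c powr p + 6 * (cmod z powr p * (\<integral>x. cmod (X x) powr p \<partial>tree_law))"
    using int_l int_p mean_l by (simp add: tree.prob_space)
  also have "ennreal \<dots> = ennreal (cmod c powr p)
      + 6 * ennreal (\<integral>x. cmod (X x) powr p \<partial>tree_law) * ennreal (cmod z powr p)"
    by (simp add: ennreal_mult' mult_ac)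
  also have "ennreal (\<integral>x. cmod (X x) powr p \<partial>tree_law) = (\<integral>\<^sup>+x. ennreal (cmod (X x) powr p) \<partial>tree_law)"
    using int_p by (intro nn_integral_eq_integral[symmetric]) auto
  finally show "(\<integral>\<^sup>+x. ennreal (cmod (c + z * X x) powr p) \<partial>tree_law)
      \<le> ennreal (cmod c powr p) + 6 * (\<integral>\<^sup>+x. ennreal (cmod (X x) powr p) \<partial>tree_law) * ennreal (cmod z powr p)" .
qed

lemma nn_integral_root:
  assumes [measurable]: "f \<in> borel_measurable \<mu>"
  shows "(\<integral>\<^sup>+x. f (x []) \<partial>tree_law) = (\<integral>\<^sup>+a. f a \<partial>\<mu>)"
  using nn_integral_distr[OF measurable_root, of f] by (simp add: distr_root)

lemma nn_integral_sup_norm_increment_0: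
  assumes p: "0 < p" and m: "moment p < \<infinity>"
  shows "(\<integral>\<^sup>+x. ennreal (sup_norm (increment b 0 x) powr p) \<partial>tree_law) < \<infinity>"
proof -
  obtain \<kappa> where \<kappa>: "0 \<le> \<kappa>"
    "\<And>u v. 0 \<le> u \<Longrightarrow> 0 \<le> v \<Longrightarrow> (u + v) powr p \<le> \<kappa> * u powr p + 2 * v powr p"
    using powr_add_split[OF p, of 2] by auto
  have le: "sup_norm (increment b 0 x) powr p \<le> \<kappa> * real b powr p * (\<Sum>j<b. cmod (x [] j) powr p) + 2" for x
  proof -
    have "sup_norm (increment b 0 x) powr p \<le> ((\<Sum>j<b. cmod (x [] j)) + 1) powr p"
      using p by (intro powr_mono2 sup_norm_increment_0_le sup_norm_nonneg continuous_on_increment) auto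
    also have "\<dots> \<le> \<kappa> * (\<Sum>j<b. cmod (x [] j)) powr p + 2"
      using \<kappa>(2)[of "\<Sum>j<b. cmod (x [] j)" 1] by (simp add: sum_nonneg)
    also have "(\<Sum>j<b. cmod (x [] j)) powr p \<le> real b powr p * (\<Sum>j<b. cmod (x [] j) powr p)"
      using sum_powr_le_card_powr[of "{..<b}" "\<lambda>j. cmod (x [] j)" p] p by simp
    finally show ?thesis using \<kappa> by (simp add: mult.assoc mult_left_mono)
  qed
  have "(\<integral>\<^sup>+x. ennreal (sup_norm (increment b 0 x) powr p) \<partial>tree_law)
      \<le> (\<integral>\<^sup>+x. (ennreal (\<kappa> * real b powr p) * (\<Sum>j<b. ennreal (cmod (x [] j) powr p)) + 2) \<partial>tree_law)"
  proof (intro nn_integral_mono)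
    fix x
    have "ennreal (sup_norm (increment b 0 x) powr p)
        \<le> ennreal (\<kappa> * real b powr p * (\<Sum>j<b. cmod (x [] j) powr p) + 2)"
      by (intro ennreal_leI le)
    also have "\<dots> = ennreal (\<kappa> * real b powr p) * (\<Sum>j<b. ennreal (cmod (x [] j) powr p)) + 2"
      using \<kappa> by (simp add: ennreal_mult' sum_nonneg)
    finally show "ennreal (sup_norm (increment b 0 x) powr p)
        \<le> ennreal (\<kappa> * real b powr p) * (\<Sum>j<b. ennreal (cmod (x [] j) powr p)) + 2" .
  qed
  also have "\<dots> = (\<integral>\<^sup>+a. (ennreal (\<kappa> * real b powr p) * (\<Sum>j<b. ennreal (cmod (a j) powr p)) + 2) \<partial>\<mu>)"
    by (rule nn_integral_root) measurable
  also have "\<dots> = ennreal (\<kappa> * real b powr p) * moment p + 2"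
    unfolding moment_def
    by (simp add: nn_integral_add nn_integral_cmult emeasure_space_1 del: sum_ennreal)
  also have "\<dots> < \<infinity>"
    using m by (simp add: ennreal_mult_eq_top_iff less_top[symmetric])
  finally show ?thesis .
qed

end

locale mean_one_cascade = cascade_law +
  assumes integrable_weight: "i < b \<Longrightarrow> integrable \<mu> (\<lambda>a. a i)"
    and mean_one: "(\<integral>a. (\<Sum>i<b. a i) \<partial>\<mu>) = 1"
begin

lemma
  shows integrable_increment_0: "integrable tree_law (\<lambda>x. increment b 0 x 1)"
    and integral_increment_0: "(\<integral>x. increment b 0 x 1 \<partial>tree_law) = 0"
proof -
  have int: "integrable \<mu> (\<lambda>a. (\<Sum>j<b. a j) - 1)"
    using integrable_weight by (intro Bochner_Integration.integrable_diff integrable_sum) auto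
  have "integrable (distr tree_law \<mu> (\<lambda>x. x [])) (\<lambda>a. (\<Sum>j<b. a j) - 1)"
    using int by (simp add: distr_root)
  then show "integrable tree_law (\<lambda>x. increment b 0 x 1)"
    by (simp add: integrable_distr_eq[OF measurable_root] increment_0_at_1)
  have "(\<integral>x. increment b 0 x 1 \<partial>tree_law) = (\<integral>a. (\<Sum>j<b. a j) - 1 \<partial>distr tree_law \<mu> (\<lambda>x. x []))"
    by (subst integral_distr[OF measurable_root]) (auto simp: increment_0_at_1)
  also have "\<dots> = (\<integral>a. (\<Sum>j<b. a j) \<partial>\<mu>) - (\<integral>a. 1 \<partial>\<mu>)"
    unfolding distr_root using integrable_weight
    by (intro Bochner_Integration.integral_diff integrable_sum) auto
  finally show "(\<integral>x. increment b 0 x 1 \<partial>tree_law) = 0"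
    by (simp add: mean_one prob_space)
qed

lemma nn_integral_mass_increment_0:
  assumes p: "0 < p" and m: "moment p < \<infinity>"
  shows "(\<integral>\<^sup>+x. ennreal (cmod (increment b 0 x 1) powr p) \<partial>tree_law) < \<infinity>"
proof -
  have "(\<integral>\<^sup>+x. ennreal (cmod (increment b 0 x 1) powr p) \<partial>tree_law)
      \<le> (\<integral>\<^sup>+x. ennreal (sup_norm (increment b 0 x) powr p) \<partial>tree_law)"
    using p by (intro nn_integral_mono ennreal_leI powr_mono2 cmod_le_sup_norm continuous_on_increment) auto
  also have "\<dots> < \<infinity>" by (rule nn_integral_sup_norm_increment_0[OF p m])
  finally show ?thesis .
qed

lemma mass_increment_decay_le_2:
  assumes p: "1 < p" "p \<le> 2" and m: "moment p < \<infinity>"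
  shows "(\<integral>\<^sup>+x. ennreal (cmod (increment b n x 1) powr p) \<partial>tree_law)
    \<le> moment p ^ n * (6 * (\<integral>\<^sup>+x. ennreal (cmod (increment b 0 x 1) powr p) \<partial>tree_law))"
proof -
  let ?K = "6 * (\<integral>\<^sup>+x. ennreal (cmod (increment b 0 x 1) powr p) \<partial>tree_law)"
  have "powr_type p (moment p ^ n * ?K) (\<lambda>x. increment b n x 1)"
  proof (induction n)
    case 0
    show ?case
      using powr_type_centered[OF p integrable_increment_0 integral_increment_0
          nn_integral_mass_increment_0[OF _ m]] p by simp
  next
    case (Suc n)
    have "powr_type p (moment p * (moment p ^ n * ?K)) (\<lambda>x. \<Sum>j<b. x [] j * increment b n (subtree [j] x) 1)"
      by (rule powr_type_branching[OF Suc]) measurable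
    then show ?case by (simp add: increment_Suc_at_1 mult.assoc)
  qed
  then show ?thesis
    unfolding powr_type_def by (elim allE[of _ 0] allE[of _ 1]) simp
qed

text \<open>The two subtrees are independent of each other and of the root vector, so the expectation factorises; the
factor of the root vector is bounded by comparing both weights with the larger one.\<close>

lemma cross_term_le:
  assumes p: "1 < p" and ij: "i < b" "j < b" "i \<noteq> j"
    and [measurable]: "f \<in> borel_measurable tree_law" "h \<in> borel_measurable tree_law"
  shows "(\<integral>\<^sup>+x. ennreal (cmod (x [] i) powr (p - 1) * cmod (x [] j)) * (f (subtree [i] x) * h (subtree [j] x)) \<partial>tree_law)
    \<le> 2 * moment p * ((\<integral>\<^sup>+x. f x \<partial>tree_law) * (\<integral>\<^sup>+x. h x \<partial>tree_law))"
proof -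
  have [measurable]: "(\<lambda>x. g (subtree [k] x)) \<in> borel_measurable tree_law"
    if "k < b" "g \<in> borel_measurable tree_law" for k and g :: "_ \<Rightarrow> ennreal"
    using that by (intro measurable_compose[OF measurable_subtree]) auto
  have [measurable]: "(\<lambda>x. x [] k) \<in> borel_measurable tree_law" if "k < b" for k
    using that by (intro measurable_weight) auto
  have [measurable]: "(\<lambda>y. g (y k)) \<in> borel_measurable forest_law"
    if "k < b" "g \<in> borel_measurable tree_law" for k and g :: "_ \<Rightarrow> ennreal"
    using that by (intro measurable_compose[OF measurable_component_singleton]) auto
  let ?w = "\<lambda>a. cmod (a i) powr (p - 1) * cmod (a j)"
  let ?I = "(\<integral>\<^sup>+x. f x \<partial>tree_law) * (\<integral>\<^sup>+x. h x \<partial>tree_law)"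
  have meas: "(\<lambda>x. ennreal (?w (x [])) * (f (subtree [i] x) * h (subtree [j] x))) \<in> borel_measurable tree_law"
    using ij by measurable
  have "(\<integral>\<^sup>+x. ennreal (?w (x [])) * (f (subtree [i] x) * h (subtree [j] x)) \<partial>tree_law)
      = (\<integral>\<^sup>+a. \<integral>\<^sup>+y. ennreal (?w a) * (f (y i) * h (y j)) \<partial>forest_law \<partial>\<mu>)"
    using ij by (subst nn_integral_tree_law[OF meas]) (intro nn_integral_cong, simp add: subtree_graft)
  also have "\<dots> = (\<integral>\<^sup>+a. ennreal (?w a) * ?I \<partial>\<mu>)"
    using ij by (intro nn_integral_cong) (simp add: nn_integral_cmult nn_integral_forest_pair)
  also have "\<dots> \<le> (\<integral>\<^sup>+a. (2 * (\<Sum>k<b. ennreal (cmod (a k) powr p))) * ?I \<partial>\<mu>)"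
  proof (intro nn_integral_mono mult_right_mono)
    fix a :: "nat \<Rightarrow> complex"
    define u where "u = max (cmod (a i)) (cmod (a j))"
    have u: "0 \<le> u" "u = cmod (a i) \<or> u = cmod (a j)" by (auto simp: u_def max_def)
    have "?w a \<le> u powr (p - 1) * u"
      using p u(1) by (intro mult_mono powr_mono2) (auto simp: u_def)
    also have "\<dots> = u powr p"
      using u by (cases "u = 0") (simp_all add: powr_diff)
    also have "\<dots> \<le> (\<Sum>k<b. cmod (a k) powr p)"
      using u(2) ij member_le_sum[of i "{..<b}" "\<lambda>k. cmod (a k) powr p"]
        member_le_sum[of j "{..<b}" "\<lambda>k. cmod (a k) powr p"] by auto
    finally have "ennreal (?w a) \<le> 1 * ennreal (\<Sum>k<b. cmod (a k) powr p)"
      by (simp add: ennreal_leI)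
    also have "\<dots> \<le> 2 * ennreal (\<Sum>k<b. cmod (a k) powr p)"
      by (intro mult_right_mono) auto
    finally show "ennreal (?w a) \<le> 2 * (\<Sum>k<b. ennreal (cmod (a k) powr p))"
      by simp
  qed simp
  also have "\<dots> = 2 * moment p * ?I"
    unfolding moment_def by (simp add: nn_integral_multc nn_integral_cmult del: sum_ennreal)
  finally show ?thesis .
qed


lemma mass_increment_geometric_le_2:
  assumes p: "1 < p" "p \<le> 2" and m: "moment p < 1"
  obtains K r where "0 \<le> K" "0 < r" "r < 1"
    "\<And>n. (\<integral>\<^sup>+x. ennreal (cmod (increment b n x 1) powr p) \<partial>tree_law) \<le> ennreal (K * r ^ n)"
proof -
  have fin: "moment p < \<infinity>" using m by (rule less_trans) simp
  define C where "C = 6 * (\<integral>\<^sup>+x. ennreal (cmod (increment b 0 x 1) powr p) \<partial>tree_law)"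
  have C: "C < \<infinity>"
    unfolding C_def using nn_integral_mass_increment_0[OF _ fin] p
    by (simp add: ennreal_mult_eq_top_iff less_top[symmetric])
  define r where "r = (enn2real (moment p) + 1) / 2"
  have mp: "moment p = ennreal (enn2real (moment p))" using fin by simp
  have "enn2real (moment p) < 1"
    using m by (subst (asm) mp) (simp add: ennreal_less_one_iff)
  then have r: "0 < r" "r < 1" "enn2real (moment p) \<le> r"
    by (auto simp: r_def intro: add_nonneg_pos)
  show thesis
  proof (rule that[of "enn2real C" r])
    fix n
    have "(\<integral>\<^sup>+x. ennreal (cmod (increment b n x 1) powr p) \<partial>tree_law) \<le> moment p ^ n * C"
      unfolding C_def by (rule mass_increment_decay_le_2[OF p fin])
    also have "\<dots> \<le> ennreal (r ^ n) * ennreal (enn2real C)"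
    proof (rule mult_mono)
      have "moment p ^ n \<le> ennreal r ^ n"
        using r by (subst mp) (intro power_mono ennreal_leI, auto)
      then show "moment p ^ n \<le> ennreal (r ^ n)" using r by (simp add: ennreal_power)
    qed (use C in auto)
    finally show "(\<integral>\<^sup>+x. ennreal (cmod (increment b n x 1) powr p) \<partial>tree_law) \<le> ennreal (enn2real C * r ^ n)"
      using r by (simp add: ennreal_mult'' mult.commute)
  qed (use r in auto)
qed

text \<open>The first moment decays because the second one does.\<close>

lemma mass_increment_L1_geometric:
  assumes m: "moment 2 < 1"
  obtains K r where "0 \<le> K" "0 < r" "r < 1"
    "\<And>n. (\<integral>\<^sup>+x. ennreal (cmod (increment b n x 1)) \<partial>tree_law) \<le> ennreal (K * r ^ n)"
proof -
  obtain K r where K: "0 \<le> K" and r: "0 < r" "r < 1"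
    and le: "\<And>n. (\<integral>\<^sup>+x. ennreal (cmod (increment b n x 1) powr 2) \<partial>tree_law) \<le> ennreal (K * r ^ n)"
    using mass_increment_geometric_le_2[of 2] m by auto
  define \<rho> where "\<rho> = sqrt r"
  have \<rho>: "0 < \<rho>" "\<rho> < 1" and r_eq: "r = \<rho> * \<rho>" using r by (auto simp: \<rho>_def)
  show thesis
  proof (rule that[of "1 + K" \<rho>])
    fix n
    have pow: "0 < \<rho> ^ n" using \<rho> by simp
    \<comment> \<open>Truncation at the level \<open>\<rho>\<^sup>n\<close>, which balances both terms since \<open>r = \<rho>\<^sup>2\<close>.\<close>
    have pt: "u \<le> \<rho> ^ n + (1 / \<rho> ^ n) * u powr 2" if "0 \<le> u" for u :: real
    proof (cases "u \<le> \<rho> ^ n")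
      case False
      then have "\<rho> ^ n * u \<le> u * u" using that by (intro mult_right_mono) auto
      then have "u \<le> (1 / \<rho> ^ n) * u powr 2"
        using pow that by (simp add: field_simps power2_eq_square)
      then show ?thesis using pow by linarith
    qed (simp add: add_increasing2 pow less_imp_le)
    have "(\<integral>\<^sup>+x. ennreal (cmod (increment b n x 1)) \<partial>tree_law)
        \<le> (\<integral>\<^sup>+x. (ennreal (\<rho> ^ n) + ennreal (1 / \<rho> ^ n) * ennreal (cmod (increment b n x 1) powr 2)) \<partial>tree_law)"
    proof (intro nn_integral_mono)
      fix x
      have "ennreal (cmod (increment b n x 1)) \<le> ennreal (\<rho> ^ n + (1 / \<rho> ^ n) * cmod (increment b n x 1) powr 2)"
        by (intro ennreal_leI pt) simp
      also have "\<dots> = ennreal (\<rho> ^ n) + ennreal ((1 / \<rho> ^ n) * cmod (increment b n x 1) powr 2)"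
        using pow by (intro ennreal_plus) auto
      also have "ennreal ((1 / \<rho> ^ n) * cmod (increment b n x 1) powr 2)
          = ennreal (1 / \<rho> ^ n) * ennreal (cmod (increment b n x 1) powr 2)"
        using pow by (intro ennreal_mult) auto
      finally show "ennreal (cmod (increment b n x 1))
          \<le> ennreal (\<rho> ^ n) + ennreal (1 / \<rho> ^ n) * ennreal (cmod (increment b n x 1) powr 2)" .
    qed
    also have "\<dots> = ennreal (\<rho> ^ n)
        + ennreal (1 / \<rho> ^ n) * (\<integral>\<^sup>+x. ennreal (cmod (increment b n x 1) powr 2) \<partial>tree_law)"
      by (subst nn_integral_add) (auto simp: nn_integral_cmult tree.emeasure_space_1)
    also have "\<dots> \<le> ennreal (\<rho> ^ n) + ennreal (1 / \<rho> ^ n) * ennreal (K * r ^ n)"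
      by (intro add_left_mono mult_left_mono le) auto
    also have "ennreal (1 / \<rho> ^ n) * ennreal (K * r ^ n) = ennreal ((1 / \<rho> ^ n) * (K * r ^ n))"
      using pow K r by (intro ennreal_mult[symmetric]) auto
    also have "ennreal (\<rho> ^ n) + \<dots> = ennreal (\<rho> ^ n + (1 / \<rho> ^ n) * (K * r ^ n))"
      using pow K r by (intro ennreal_plus[symmetric]) auto
    also have "\<rho> ^ n + (1 / \<rho> ^ n) * (K * r ^ n) = (1 + K) * \<rho> ^ n"
      using pow by (simp add: r_eq power_mult_distrib field_simps)
    finally show "(\<integral>\<^sup>+x. ennreal (cmod (increment b n x 1)) \<partial>tree_law) \<le> ennreal ((1 + K) * \<rho> ^ n)" .
  qed (use K \<rho> in auto)
qed

text \<open>The diagonal terms contract by \<open>moment p\<close>. The cross terms have the factor \<open>E \<bar>D\<^sub>n(1)\<bar>\<^sup>p\<^sup>-\<^sup>1\<close>,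
at most \<open>1 + E \<bar>D\<^sub>n(1)\<bar>\<^sup>p\<close>, and the factor \<open>E \<bar>D\<^sub>n(1)\<bar>\<close>, which is small for large \<open>n\<close>.\<close>

lemma mass_increment_recursion:
  assumes p: "1 < p" and m: "moment p \<le> 1"
  shows "(\<integral>\<^sup>+x. ennreal (cmod (increment b (Suc n) x 1) powr p) \<partial>tree_law)
    \<le> moment p * (\<integral>\<^sup>+x. ennreal (cmod (increment b n x 1) powr p) \<partial>tree_law)
      + ennreal (2 * p * real b powr (p - 1) * real b ^ 2)
        * ((1 + (\<integral>\<^sup>+x. ennreal (cmod (increment b n x 1) powr p) \<partial>tree_law))
           * (\<integral>\<^sup>+x. ennreal (cmod (increment b n x 1)) \<partial>tree_law))"
proof -
  define d where "d x = increment b n x 1" for x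
  have d [measurable]: "d \<in> borel_measurable tree_law" unfolding d_def by measurable
  have [measurable]: "(\<lambda>x. d (subtree [k] x)) \<in> borel_measurable tree_law" if "k < b" for k
    using that by (intro measurable_compose[OF measurable_subtree]) auto
  have [measurable]: "(\<lambda>x. x [] k) \<in> borel_measurable tree_law" if "k < b" for k
    using that by (intro measurable_weight) auto
  define C where "C = p * real b powr (p - 1)"
  have C: "0 \<le> C" using p by (simp add: C_def)
  define A where "A = (\<integral>\<^sup>+x. ennreal (cmod (d x) powr p) \<partial>tree_law)"
  define E where "E = (\<integral>\<^sup>+x. ennreal (cmod (d x)) \<partial>tree_law)"
  define B where "B = (\<integral>\<^sup>+x. ennreal (cmod (d x) powr (p - 1)) \<partial>tree_law)"
  define T where "T i j x = ennreal (cmod (x [] i) powr (p - 1) * cmod (x [] j))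
      * (ennreal (cmod (d (subtree [i] x)) powr (p - 1)) * ennreal (cmod (d (subtree [j] x))))" for i j x
  have T [measurable]: "T i j \<in> borel_measurable tree_law" if "i < b" "j < b" for i j
    unfolding T_def using that by measurable
  have pt: "ennreal (cmod (increment b (Suc n) x 1) powr p)
      \<le> (\<Sum>j<b. ennreal (cmod (x [] j) powr p) * ennreal (cmod (d (subtree [j] x)) powr p))
        + ennreal C * (\<Sum>i<b. \<Sum>j\<in>{..<b} - {i}. T i j x)" for x
  proof -
    define u where "u j = cmod (x [] j) * cmod (d (subtree [j] x))" for j
    have u0: "0 \<le> u j" for j by (simp add: u_def)
    have "cmod (increment b (Suc n) x 1) \<le> (\<Sum>j<b. u j)"
      unfolding increment_Suc_at_1 u_def d_def by (intro sum_norm_le) (simp add: norm_mult)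
    then have "cmod (increment b (Suc n) x 1) powr p \<le> (\<Sum>j<b. u j) powr p"
      using p by (intro powr_mono2) (auto simp: u0)
    also have "\<dots> \<le> (\<Sum>j<b. u j powr p) + C * (\<Sum>i<b. \<Sum>j\<in>{..<b} - {i}. u i powr (p - 1) * u j)"
      unfolding C_def using sum_powr_le_cross_terms[of "{..<b}" u p] p u0 by simp
    finally have "ennreal (cmod (increment b (Suc n) x 1) powr p)
        \<le> ennreal ((\<Sum>j<b. u j powr p) + C * (\<Sum>i<b. \<Sum>j\<in>{..<b} - {i}. u i powr (p - 1) * u j))"
      by (rule ennreal_leI)
    also have "\<dots> = (\<Sum>j<b. ennreal (u j powr p)) + ennreal C * (\<Sum>i<b. \<Sum>j\<in>{..<b} - {i}. ennreal (u i powr (p - 1) * u j))"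
      using C u0 by (simp add: ennreal_mult'[OF C] sum_nonneg)
    also have "\<dots> = (\<Sum>j<b. ennreal (cmod (x [] j) powr p) * ennreal (cmod (d (subtree [j] x)) powr p))
        + ennreal C * (\<Sum>i<b. \<Sum>j\<in>{..<b} - {i}. T i j x)"
      unfolding T_def u_def
      by (intro arg_cong2[where f = plus] arg_cong2[where f = times] sum.cong refl)
        (simp_all add: powr_mult ennreal_mult[symmetric] mult_ac)
    finally show ?thesis .
  qed
  have "(\<integral>\<^sup>+x. ennreal (cmod (increment b (Suc n) x 1) powr p) \<partial>tree_law)
      \<le> (\<integral>\<^sup>+x. ((\<Sum>j<b. ennreal (cmod (x [] j) powr p) * ennreal (cmod (d (subtree [j] x)) powr p))
        + ennreal C * (\<Sum>i<b. \<Sum>j\<in>{..<b} - {i}. T i j x)) \<partial>tree_law)"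
    by (intro nn_integral_mono pt)
  also have "\<dots> = (\<integral>\<^sup>+x. (\<Sum>j<b. ennreal (cmod (x [] j) powr p) * ennreal (cmod (d (subtree [j] x)) powr p)) \<partial>tree_law)
        + (\<integral>\<^sup>+x. ennreal C * (\<Sum>i<b. \<Sum>j\<in>{..<b} - {i}. T i j x) \<partial>tree_law)"
    by (rule nn_integral_add) measurable
  also have "(\<integral>\<^sup>+x. (\<Sum>j<b. ennreal (cmod (x [] j) powr p) * ennreal (cmod (d (subtree [j] x)) powr p)) \<partial>tree_law)
      = moment p * A"
    unfolding A_def by (rule nn_integral_branching[where f = "\<lambda>x. ennreal (cmod (d x) powr p)"]) measurable
  also have "(\<integral>\<^sup>+x. ennreal C * (\<Sum>i<b. \<Sum>j\<in>{..<b} - {i}. T i j x) \<partial>tree_law)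
      = ennreal C * (\<Sum>i<b. \<Sum>j\<in>{..<b} - {i}. \<integral>\<^sup>+x. T i j x \<partial>tree_law)"
  proof -
    have "(\<integral>\<^sup>+x. ennreal C * (\<Sum>i<b. \<Sum>j\<in>{..<b} - {i}. T i j x) \<partial>tree_law)
        = ennreal C * (\<integral>\<^sup>+x. (\<Sum>i<b. \<Sum>j\<in>{..<b} - {i}. T i j x) \<partial>tree_law)"
      by (rule nn_integral_cmult) measurable
    also have "(\<integral>\<^sup>+x. (\<Sum>i<b. \<Sum>j\<in>{..<b} - {i}. T i j x) \<partial>tree_law)
        = (\<Sum>i<b. \<integral>\<^sup>+x. (\<Sum>j\<in>{..<b} - {i}. T i j x) \<partial>tree_law)"
      by (rule nn_integral_sum) measurable
    also have "\<dots> = (\<Sum>i<b. \<Sum>j\<in>{..<b} - {i}. \<integral>\<^sup>+x. T i j x \<partial>tree_law)"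
      by (intro sum.cong refl nn_integral_sum) auto
    finally show ?thesis .
  qed
  also have "\<dots> \<le> ennreal C * (\<Sum>i<b. \<Sum>j<b. 2 * (B * E))"
  proof (intro mult_left_mono sum_mono)
    fix i assume i: "i \<in> {..<b}"
    have "(\<integral>\<^sup>+x. T i j x \<partial>tree_law) \<le> 2 * (B * E)" if "j \<in> {..<b} - {i}" for j
    proof -
      have "(\<integral>\<^sup>+x. T i j x \<partial>tree_law) \<le> 2 * moment p * (B * E)"
        unfolding T_def B_def E_def using i that
        by (intro cross_term_le[OF p, where f = "\<lambda>x. ennreal (cmod (d x) powr (p - 1))" and h = "\<lambda>x. ennreal (cmod (d x))"]) auto
      also have "\<dots> \<le> 2 * 1 * (B * E)" by (intro mult_right_mono mult_left_mono m) auto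
      finally show ?thesis by simp
    qed
    then have "(\<Sum>j\<in>{..<b} - {i}. \<integral>\<^sup>+x. T i j x \<partial>tree_law) \<le> (\<Sum>j\<in>{..<b} - {i}. 2 * (B * E))"
      by (rule sum_mono)
    also have "\<dots> \<le> (\<Sum>j<b. 2 * (B * E))" by (intro sum_mono2) auto
    finally show "(\<Sum>j\<in>{..<b} - {i}. \<integral>\<^sup>+x. T i j x \<partial>tree_law) \<le> (\<Sum>j<b. 2 * (B * E))" .
  qed simp
  also have "\<dots> = ennreal (2 * p * real b powr (p - 1) * real b ^ 2) * (B * E)"
  proof -
    have "ennreal (2 * p * real b powr (p - 1) * real b ^ 2) = ennreal (C * (real b * (real b * 2)))"
      by (simp add: C_def power2_eq_square mult_ac)
    also have "\<dots> = ennreal C * (of_nat b * (of_nat b * 2))"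
      using C by (simp add: ennreal_mult'' ennreal_of_nat_eq_real_of_nat[symmetric])
    finally show ?thesis by (simp add: mult_ac)
  qed
  also have "\<dots> \<le> ennreal (2 * p * real b powr (p - 1) * real b ^ 2) * ((1 + A) * E)"
  proof (intro mult_left_mono mult_right_mono)
    have "u powr (p - 1) \<le> 1 + u powr p" if "0 \<le> u" for u :: real
    proof (cases "u \<le> 1")
      case True
      then have "u powr (p - 1) \<le> 1" using p that by (intro powr_le1) auto
      then show ?thesis using powr_ge_zero[of u p] by linarith
    next
      case False
      then have "u powr (p - 1) \<le> u powr p" by (intro powr_mono) auto
      then show ?thesis by linarith
    qed
    then have "B \<le> (\<integral>\<^sup>+x. ennreal (1 + cmod (d x) powr p) \<partial>tree_law)"
      unfolding B_def by (intro nn_integral_mono ennreal_leI) auto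
    also have "\<dots> = 1 + A"
      unfolding A_def by (simp add: nn_integral_add tree.emeasure_space_1)
    finally show "B \<le> 1 + A" .
  qed auto
  finally show ?thesis
    by (simp add: A_def E_def d_def add_left_mono)
qed

lemma mass_increment_geometric:
  assumes p: "1 < p" and m: "moment p < 1" and p2: "p \<le> 2 \<or> moment 2 < 1"
  obtains K r where "0 \<le> K" "0 < r" "r < 1"
    "\<And>n. (\<integral>\<^sup>+x. ennreal (cmod (increment b n x 1) powr p) \<partial>tree_law) \<le> ennreal (K * r ^ n)"
proof (cases "p \<le> 2")
  case True
  then show thesis using mass_increment_geometric_le_2[OF p _ m] that by blast
next
  case False
  then have m2: "moment 2 < 1" using p2 by simp
  obtain K s where K: "0 \<le> K" and s: "0 < s" "s < 1"
    and L1: "\<And>n. (\<integral>\<^sup>+x. ennreal (cmod (increment b n x 1)) \<partial>tree_law) \<le> ennreal (K * s ^ n)"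
    using mass_increment_L1_geometric[OF m2] by blast
  have fin: "moment p < \<infinity>" using m by (rule less_trans) simp
  define M where "M = enn2real (moment p)"
  have M: "moment p = ennreal M" "0 \<le> M" using fin by (auto simp: M_def)
  have M1: "M < 1" using m M by (simp add: ennreal_less_one_iff)
  define D where "D = 2 * p * real b powr (p - 1) * real b ^ 2"
  define c where "c = D * K"
  have D: "0 \<le> D" and c: "0 \<le> c" using p K by (auto simp: D_def c_def)
  let ?A = "\<lambda>n. \<integral>\<^sup>+x. ennreal (cmod (increment b n x 1) powr p) \<partial>tree_law"
  have step: "?A (Suc n) \<le> ennreal (M + c * s ^ n) * ?A n + ennreal (c * s ^ n)" for n
  proof -
    have "?A (Suc n) \<le> moment p * ?A n + ennreal D * ((1 + ?A n) * (\<integral>\<^sup>+x. ennreal (cmod (increment b n x 1)) \<partial>tree_law))"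
      unfolding D_def using m by (intro mass_increment_recursion p) simp
    also have "\<dots> \<le> ennreal M * ?A n + ennreal D * ((1 + ?A n) * ennreal (K * s ^ n))"
      unfolding M(1) by (intro add_left_mono mult_left_mono L1) auto
    also have "\<dots> = ennreal M * ?A n + ennreal (c * s ^ n) * (1 + ?A n)"
      using D K s by (simp add: c_def ennreal_mult mult_ac)
    also have "\<dots> = ennreal (M + c * s ^ n) * ?A n + ennreal (c * s ^ n)"
      using M c s by (simp add: ennreal_plus distrib_left distrib_right add_ac)
    finally show ?thesis .
  qed
  have A0: "?A 0 < \<infinity>" using nn_integral_mass_increment_0[OF _ fin] p by simp
  show thesis
    using perturbed_contraction_geometric[OF M(2) M1 _ s(2) c A0 step] s that by auto
qed

section \<open>Convergence of the cascade\<close>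

lemma sup_norm_increment_geometric:
  assumes p: "1 < p" and m: "moment p < 1" and p2: "p \<le> 2 \<or> moment 2 < 1"
  obtains K r where "0 \<le> K" "0 < r" "r < 1"
    "\<And>n. (\<integral>\<^sup>+x. ennreal (sup_norm (increment b n x) powr p) \<partial>tree_law) \<le> ennreal (K * r ^ n)"
proof -
  obtain K s where K: "0 \<le> K" and s: "0 < s" "s < 1"
    and mass: "\<And>n. (\<integral>\<^sup>+x. ennreal (cmod (increment b n x 1) powr p) \<partial>tree_law) \<le> ennreal (K * s ^ n)"
    using mass_increment_geometric[OF assms] by blast
  have fin: "moment p < \<infinity>" using m by (rule less_trans) simp
  define M where "M = enn2real (moment p)"
  have M: "moment p = ennreal M" "0 \<le> M" using fin by (auto simp: M_def)
  have M1: "M < 1" using m M by (simp add: ennreal_less_one_iff)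
  \<comment> \<open>Any \<open>\<theta> > 1\<close> with \<open>\<theta> * M < 1\<close> would do.\<close>
  define \<theta> where "\<theta> = 2 / (1 + M)"
  have \<theta>: "1 < \<theta>" "\<theta> * M < 1" using M M1 by (auto simp: \<theta>_def field_simps)
  obtain \<kappa> where \<kappa>: "0 \<le> \<kappa>"
    "\<And>u v. 0 \<le> u \<Longrightarrow> 0 \<le> v \<Longrightarrow> (u + v) powr p \<le> \<kappa> * u powr p + \<theta> * v powr p"
    using powr_add_split[of p \<theta>] p \<theta> by auto
  define c where "c = \<kappa> * real b powr p * (M * K)"
  have c: "0 \<le> c" using \<kappa> M K by (simp add: c_def)
  let ?V = "\<lambda>n. \<integral>\<^sup>+x. ennreal (sup_norm (increment b n x) powr p) \<partial>tree_law"
  have step: "?V (Suc n) \<le> ennreal (\<theta> * M + c * s ^ n) * ?V n + ennreal (c * s ^ n)" for n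
  proof -
    define d where "d x = ennreal (cmod (increment b n x 1) powr p)" for x
    define v where "v x = ennreal (sup_norm (increment b n x) powr p)" for x
    have [measurable]: "d \<in> borel_measurable tree_law" "v \<in> borel_measurable tree_law"
      unfolding d_def v_def by measurable
    have [measurable]: "(\<lambda>x. d (subtree [k] x)) \<in> borel_measurable tree_law"
      "(\<lambda>x. v (subtree [k] x)) \<in> borel_measurable tree_law"
      "(\<lambda>x. x [] k) \<in> borel_measurable tree_law" if "k < b" for k
      using that by (auto intro!: measurable_compose[OF measurable_subtree] measurable_weight)
    let ?L = "\<lambda>f x. \<Sum>j<b. ennreal (cmod (x [] j) powr p) * f (subtree [j] x)"
    have pt: "ennreal (sup_norm (increment b (Suc n) x) powr p)
        \<le> ennreal (\<kappa> * real b powr p) * ?L d x + ennreal \<theta> * ?L v x" for x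
    proof -
      let ?D = "\<Sum>j<b. cmod (x [] j) powr p * cmod (increment b n (subtree [j] x) 1) powr p"
      let ?S = "\<Sum>j<b. cmod (x [] j) powr p * sup_norm (increment b n (subtree [j] x)) powr p"
      have "ennreal (sup_norm (increment b (Suc n) x) powr p) \<le> ennreal (\<kappa> * real b powr p * ?D + \<theta> * ?S)"
        using p by (intro ennreal_leI sup_norm_increment_Suc_le b_pos \<kappa>) auto
      also have "\<dots> = ennreal (\<kappa> * real b powr p) * ennreal ?D + ennreal \<theta> * ennreal ?S"
        using \<kappa> \<theta> by (subst ennreal_plus) (auto simp: ennreal_mult sum_nonneg)
      also have "ennreal ?D = ?L d x"
        unfolding d_def by (subst sum_ennreal[symmetric]) (auto simp: ennreal_mult)
      also have "ennreal ?S = ?L v x"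
        unfolding v_def by (subst sum_ennreal[symmetric]) (auto simp: ennreal_mult)
      finally show ?thesis .
    qed
    have "?V (Suc n) \<le> (\<integral>\<^sup>+x. (ennreal (\<kappa> * real b powr p) * ?L d x + ennreal \<theta> * ?L v x) \<partial>tree_law)"
      by (intro nn_integral_mono pt)
    also have "\<dots> = ennreal (\<kappa> * real b powr p) * (\<integral>\<^sup>+x. ?L d x \<partial>tree_law)
        + ennreal \<theta> * (\<integral>\<^sup>+x. ?L v x \<partial>tree_law)"
      by (subst nn_integral_add) (auto simp: nn_integral_cmult)
    also have "(\<integral>\<^sup>+x. ?L d x \<partial>tree_law) = moment p * (\<integral>\<^sup>+x. d x \<partial>tree_law)"
      by (rule nn_integral_branching) measurable
    also have "(\<integral>\<^sup>+x. ?L v x \<partial>tree_law) = moment p * ?V n"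
      unfolding v_def[symmetric] by (rule nn_integral_branching) measurable
    also have "ennreal (\<kappa> * real b powr p) * (moment p * (\<integral>\<^sup>+x. d x \<partial>tree_law))
        \<le> ennreal (\<kappa> * real b powr p) * (ennreal M * ennreal (K * s ^ n))"
      unfolding M(1) d_def by (intro mult_left_mono mass) auto
    also have "\<dots> = ennreal (c * s ^ n)"
      using \<kappa> M K s by (simp add: c_def ennreal_mult mult_ac)
    also have "ennreal \<theta> * (moment p * ?V n) = ennreal (\<theta> * M) * ?V n"
      using \<theta> M by (simp add: ennreal_mult mult_ac)
    also have "\<dots> \<le> ennreal (\<theta> * M + c * s ^ n) * ?V n"
      using c s by (intro mult_right_mono ennreal_leI) auto
    finally show ?thesis by (simp add: add.commute add_left_mono)
  qed
  have V0: "?V 0 < \<infinity>" using nn_integral_sup_norm_increment_0[OF _ fin] p by simp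
  have \<theta>M: "0 \<le> \<theta> * M" using \<theta> M by simp
  show thesis
    using perturbed_contraction_geometric[OF \<theta>M \<theta>(2) _ s(2) c V0 step] s that by auto
qed

text \<open>The variable \<open>S\<close> is the sum over \<open>n\<close> of \<open>s\<^sup>-\<^sup>n \<parallel>D\<^sub>n\<parallel>\<^sup>p\<close>; it is integrable when \<open>s\<close> exceeds the rate of decay
of \<open>E \<parallel>D\<^sub>n\<parallel>\<^sup>p\<close>.\<close>

lemma increment_dominating_variable:
  assumes p: "1 < p" and m: "moment p < 1" and p2: "p \<le> 2 \<or> moment 2 < 1"
  obtains S s where "0 < s" "s < 1" "S \<in> borel_measurable tree_law"
    "(\<integral>\<^sup>+x. S x \<partial>tree_law) < \<infinity>"
    "\<And>x n. ennreal (sup_norm (increment b n x) powr p) \<le> S x * ennreal (s ^ n)"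
proof -
  obtain K r where K: "0 \<le> K" and r: "0 < r" "r < 1"
    and le: "\<And>n. (\<integral>\<^sup>+x. ennreal (sup_norm (increment b n x) powr p) \<partial>tree_law) \<le> ennreal (K * r ^ n)"
    using sup_norm_increment_geometric[OF assms] by blast
  \<comment> \<open>With this choice \<open>r\<^sup>n / s\<^sup>n = s\<^sup>n\<close>.\<close>
  define s where "s = sqrt r"
  have s: "0 < s" "s < 1" and r_eq: "r = s * s" using r by (auto simp: s_def)
  define S where "S x = (\<Sum>n. ennreal (1 / s ^ n) * ennreal (sup_norm (increment b n x) powr p))" for x
  show thesis
  proof (rule that[OF s])
    show "S \<in> borel_measurable tree_law" unfolding S_def by measurable
    have "(\<integral>\<^sup>+x. S x \<partial>tree_law)
        = (\<Sum>n. ennreal (1 / s ^ n) * (\<integral>\<^sup>+x. ennreal (sup_norm (increment b n x) powr p) \<partial>tree_law))"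
      unfolding S_def by (subst nn_integral_suminf) (auto simp: nn_integral_cmult)
    also have "\<dots> \<le> (\<Sum>n. ennreal (K * s ^ n))"
    proof (intro suminf_le summableI)
      fix n
      have "ennreal (1 / s ^ n) * (\<integral>\<^sup>+x. ennreal (sup_norm (increment b n x) powr p) \<partial>tree_law)
          \<le> ennreal (1 / s ^ n) * ennreal (K * r ^ n)"
        by (intro mult_left_mono le) auto
      also have "\<dots> = ennreal ((1 / s ^ n) * (K * r ^ n))"
        using s K r by (intro ennreal_mult[symmetric]) auto
      also have "(1 / s ^ n) * (K * r ^ n) = K * s ^ n"
        using s by (simp add: r_eq power_mult_distrib)
      finally show "ennreal (1 / s ^ n) * (\<integral>\<^sup>+x. ennreal (sup_norm (increment b n x) powr p) \<partial>tree_law)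
          \<le> ennreal (K * s ^ n)" .
    qed
    also have "\<dots> = ennreal (\<Sum>n. K * s ^ n)"
      using s K by (intro suminf_ennreal2 summable_mult summable_geometric) auto
    also have "\<dots> < \<infinity>" by simp
    finally show "(\<integral>\<^sup>+x. S x \<partial>tree_law) < \<infinity>" .
  next
    fix x n
    have "ennreal (sup_norm (increment b n x) powr p)
        = ennreal (s ^ n) * (ennreal (1 / s ^ n) * ennreal (sup_norm (increment b n x) powr p))"
      using s by (simp add: ennreal_mult[symmetric] mult.assoc[symmetric])
    also have "\<dots> \<le> ennreal (s ^ n) * S x"
      unfolding S_def by (intro mult_left_mono sum_le_suminf[where I = "{n}", simplified] summableI) auto
    finally show "ennreal (sup_norm (increment b n x) powr p) \<le> S x * ennreal (s ^ n)"
      by (simp add: mult.commute)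
  qed
qed

lemma measurable_tree_limit_at [measurable]:
  "(\<lambda>x. tree_limit b x t) \<in> borel_measurable tree_law"
proof (cases "t \<in> {0..1}")
  case True
  have "(\<lambda>x. if summable (\<lambda>n. sup_norm (increment b n x)) then lim (\<lambda>n. cascade_path b n x t) else 0)
      \<in> borel_measurable tree_law"
  proof (rule measurable_If)
    show "(\<lambda>x. lim (\<lambda>n. cascade_path b n x t)) \<in> borel_measurable tree_law"
      by (rule borel_measurable_lim_metric[OF measurable_cascade_path])
    have "(\<lambda>x. \<Sum>k<n. sup_norm (increment b k x)) \<in> borel_measurable tree_law" for n
      by (intro borel_measurable_sum measurable_sup_norm_increment)
    from sets_Collect_Cauchy[OF this]
    show "{x \<in> space tree_law. summable (\<lambda>n. sup_norm (increment b n x))} \<in> sets tree_law"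
      by (simp add: summable_iff_convergent Cauchy_convergent_iff)
  qed simp
  then show ?thesis using True by (simp add: tree_limit_def)
next
  case False
  then have "tree_limit b x t = undefined" for x
    unfolding tree_limit_def by (metis restrict_apply)
  then show ?thesis by simp
qed

lemma measurable_tree_limit [measurable]: "tree_limit b \<in> tree_law \<rightarrow>\<^sub>M continuous_paths"
  unfolding continuous_paths_def
proof (rule measurable_restrict_space2)
  show "tree_limit b \<in> tree_law \<rightarrow>\<^sub>M (\<Pi>\<^sub>M t\<in>{0..1}. borel)"
  proof (rule measurable_PiM_single'[where f = "\<lambda>t x. tree_limit b x t"])
    show "(\<lambda>x. tree_limit b x t) \<in> borel_measurable tree_law" for t
      by (rule measurable_tree_limit_at)
    show "(\<lambda>x t. tree_limit b x t) \<in> space tree_law \<rightarrow> (\<Pi>\<^sub>E t\<in>{0..1}. space borel)"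
      by (auto simp: tree_limit_def)
  qed
  show "tree_limit b \<in> space tree_law \<rightarrow> {f. continuous_on {0..1} f}"
    using continuous_on_tree_limit by auto
qed

lemma measurable_sup_norm_tree_limit [measurable]:
  "(\<lambda>x. sup_norm (tree_limit b x)) \<in> borel_measurable tree_law"
  by (rule borel_measurable_sup_norm) (auto intro: continuous_on_tree_limit)

lemma measurable_sup_norm_error [measurable]:
  "(\<lambda>x. sup_norm (\<lambda>t. cascade_path b n x t - tree_limit b x t)) \<in> borel_measurable tree_law"
  by (rule borel_measurable_sup_norm)
    (auto intro!: continuous_intros continuous_on_tree_limit continuous_on_cascade_path)

text \<open>Both statements come from the same dominating variable: it is finite almost everywhere, and it is
integrable.\<close>

lemma tree_limit_convergence:
  assumes p: "1 < p" and m: "moment p < 1" and p2: "p \<le> 2 \<or> moment 2 < 1"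
  shows AE_summable_increment: "AE x in tree_law. summable (\<lambda>n. sup_norm (increment b n x))"
    and Lp_error_geometric: "\<exists>C s. 0 \<le> C \<and> 0 < s \<and> s < 1 \<and> (\<forall>n.
      (\<integral>\<^sup>+x. ennreal (sup_norm (\<lambda>t. cascade_path b n x t - tree_limit b x t) powr p) \<partial>tree_law)
        \<le> ennreal (C * s ^ n))"
proof -
  obtain S s where s: "0 < s" "s < 1" and [measurable]: "S \<in> borel_measurable tree_law"
    and S: "(\<integral>\<^sup>+x. S x \<partial>tree_law) < \<infinity>"
    and le: "\<And>x n. ennreal (sup_norm (increment b n x) powr p) \<le> S x * ennreal (s ^ n)"
    by (rule increment_dominating_variable[OF assms]) (rule that; assumption)
  have AE_S: "AE x in tree_law. S x \<noteq> \<infinity>"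
    using S by (intro nn_integral_PInf_AE) auto
  have real_le: "sup_norm (increment b n x) powr p \<le> enn2real (S x) * s ^ n" if "S x \<noteq> \<infinity>" for x n
  proof -
    have "ennreal (sup_norm (increment b n x) powr p) \<le> ennreal (enn2real (S x) * s ^ n)"
      using le[of n x] that s by (simp add: ennreal_mult'' top.not_eq_extremum)
    then show ?thesis using s by (subst (asm) ennreal_le_iff) auto
  qed
  show "AE x in tree_law. summable (\<lambda>n. sup_norm (increment b n x))"
    using AE_S
  proof eventually_elim
    case (elim x)
    show ?case
      using p by (intro summable_sup_norm_increment[OF _ s enn2real_nonneg real_le[OF elim]]) simp
  qed
  define c where "c = (1 - s powr (1 / p)) powr p"
  define C where "C = enn2real (\<integral>\<^sup>+x. S x \<partial>tree_law) / c"
  have "(\<integral>\<^sup>+x. ennreal (sup_norm (\<lambda>t. cascade_path b n x t - tree_limit b x t) powr p) \<partial>tree_law)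
      \<le> ennreal (C * s ^ n)" for n
  proof -
    have "(\<integral>\<^sup>+x. ennreal (sup_norm (\<lambda>t. cascade_path b n x t - tree_limit b x t) powr p) \<partial>tree_law)
        \<le> (\<integral>\<^sup>+x. S x * ennreal (s ^ n / c) \<partial>tree_law)"
    proof (rule nn_integral_mono_AE)
      show "AE x in tree_law. ennreal (sup_norm (\<lambda>t. cascade_path b n x t - tree_limit b x t) powr p)
          \<le> S x * ennreal (s ^ n / c)"
        using AE_S
      proof eventually_elim
        case (elim x)
        have "ennreal (sup_norm (\<lambda>t. cascade_path b n x t - tree_limit b x t) powr p)
            \<le> ennreal (enn2real (S x) * s ^ n / c)"
          unfolding c_def using p
          by (intro ennreal_leI tree_limit_error_powr_le(2) s real_le elim) auto
        also have "\<dots> = ennreal (enn2real (S x)) * ennreal (s ^ n / c)"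
          using s by (simp add: ennreal_mult'[symmetric] c_def)
        also have "ennreal (enn2real (S x)) = S x"
          using elim by (simp add: top.not_eq_extremum)
        finally show ?case .
      qed
    qed
    also have "\<dots> = (\<integral>\<^sup>+x. S x \<partial>tree_law) * ennreal (s ^ n / c)"
      by (rule nn_integral_multc) measurable
    also have "(\<integral>\<^sup>+x. S x \<partial>tree_law) = ennreal (enn2real (\<integral>\<^sup>+x. S x \<partial>tree_law))"
      using S by simp
    also have "\<dots> * ennreal (s ^ n / c) = ennreal (C * s ^ n)"
      using s by (simp add: ennreal_mult'[symmetric] C_def)
    finally show ?thesis .
  qed
  moreover have "0 \<le> C" by (simp add: C_def c_def)
  ultimately show "\<exists>C s. 0 \<le> C \<and> 0 < s \<and> s < 1 \<and> (\<forall>n.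
      (\<integral>\<^sup>+x. ennreal (sup_norm (\<lambda>t. cascade_path b n x t - tree_limit b x t) powr p) \<partial>tree_law)
        \<le> ennreal (C * s ^ n))"
    using s by blast
qed

end

section \<open>Regularity of the limit\<close>

context cascade_law
begin

lemma AE_all_subtrees:
  assumes "AE x in tree_law. Q x"
  shows "AE x in tree_law. \<forall>w\<in>words. Q (subtree w x)"
proof (subst AE_ball_countable)
  show "countable words" by (rule countable_subset[OF subset_UNIV]) simp
  show "\<forall>w\<in>words. AE x in tree_law. Q (subtree w x)"
  proof
    fix w assume w: "w \<in> words"
    have "AE x in distr tree_law tree_law (subtree w). Q x"
      unfolding distr_subtree[OF w] by (rule assms)
    then show "AE x in tree_law. Q (subtree w x)" by (rule AE_distrD[OF measurable_subtree[OF w]])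
  qed
qed

text \<open>Iterating the scaling identity along the word that labels the interval, the increment of the path is the
weight of the interval times an increment of the limit path of a subtree. The sum over the whole level is a crude
bound for the maximum over its intervals.\<close>

lemma tree_limit_oscillation_le:
  assumes q: "0 < q"
    and S: "\<And>w. w \<in> words \<Longrightarrow> summable (\<lambda>n. sup_norm (increment b n (subtree w x)))"
    and k: "k < b ^ n"
    and s: "real k / real b ^ n \<le> s" "s \<le> (real k + 1) / real b ^ n"
    and t: "real k / real b ^ n \<le> t" "t \<le> (real k + 1) / real b ^ n"
  shows "ennreal (cmod (tree_limit b x s - tree_limit b x t) powr q)
    \<le> ennreal (2 powr q) * level_sum q (\<lambda>x. ennreal (sup_norm (tree_limit b x) powr q)) n x"
  using S k s t
proof (induction n arbitrary: x k s t)
  case 0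
  then have st: "s \<in> {0..1}" "t \<in> {0..1}" by auto
  have "cmod (tree_limit b x s - tree_limit b x t) \<le> cmod (tree_limit b x s) + cmod (tree_limit b x t)"
    by (rule norm_triangle_ineq4)
  also have "\<dots> \<le> 2 * sup_norm (tree_limit b x)"
    using cmod_le_sup_norm[OF continuous_on_tree_limit st(1), of b x]
      cmod_le_sup_norm[OF continuous_on_tree_limit st(2), of b x] by simp
  finally have "cmod (tree_limit b x s - tree_limit b x t) powr q \<le> (2 * sup_norm (tree_limit b x)) powr q"
    using q by (intro powr_mono2) auto
  also have "\<dots> = 2 powr q * sup_norm (tree_limit b x) powr q"
    using sup_norm_nonneg[OF continuous_on_tree_limit] by (simp add: powr_mult)
  finally show ?case by (simp add: ennreal_mult[symmetric] ennreal_leI)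
next
  case (Suc n)
  let ?N = "real b ^ n"
  have N: "0 < ?N" using b_pos by simp
  \<comment> \<open>The first digit of the interval, and its position within the \<open>i\<close>-th first-level interval.\<close>
  define i where "i = k div b ^ n"
  define l where "l = k mod b ^ n"
  have i: "i < b" using Suc.prems(2) b_pos by (simp add: i_def less_mult_imp_div_less mult.commute)
  have l: "l < b ^ n" using b_pos by (simp add: l_def)
  have "k = i * b ^ n + l" by (simp only: i_def l_def div_mult_mod_eq)
  then have k_eq: "real k = real i * ?N + real l" by simp
  have l1: "real l + 1 \<le> ?N"
  proof -
    have "real (l + 1) \<le> real (b ^ n)" using l by (intro of_nat_mono) simp
    then show ?thesis by simp
  qed
  have zoom: "real l / ?N \<le> real b * u - real i" "real b * u - real i \<le> (real l + 1) / ?N"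
    "real i \<le> real b * u" "real b * u \<le> real i + 1"
    if u: "real k / real b ^ Suc n \<le> u" "u \<le> (real k + 1) / real b ^ Suc n" for u
  proof -
    have "real k \<le> u * (real b * ?N)" "u * (real b * ?N) \<le> real k + 1"
      using u N b_pos by (simp_all add: pos_divide_le_eq pos_le_divide_eq)
    then have *: "real l \<le> (real b * u - real i) * ?N" "(real b * u - real i) * ?N \<le> real l + 1"
      unfolding k_eq by (simp_all add: algebra_simps)
    then show "real l / ?N \<le> real b * u - real i" "real b * u - real i \<le> (real l + 1) / ?N"
      using N by (simp_all add: pos_divide_le_eq pos_le_divide_eq)
    have "0 * ?N \<le> (real b * u - real i) * ?N" "(real b * u - real i) * ?N \<le> 1 * ?N"
      using * l1 by simp_all
    then show "real i \<le> real b * u" "real b * u \<le> real i + 1"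
      using N by (simp_all only: mult_le_cancel_right_pos)
  qed
  have S0: "summable (\<lambda>n. sup_norm (increment b n x))" using Suc.prems(1)[of "[]"] by simp
  have S1: "summable (\<lambda>n. sup_norm (increment b n (subtree [j] x)))" if "j < b" for j
    using that by (intro Suc.prems(1)) auto
  have scal: "tree_limit b x u = tree_limit b x (real i / real b)
      + x [] i * tree_limit b (subtree [i] x) (real b * u - real i)"
    if "real k / real b ^ Suc n \<le> u" "u \<le> (real k + 1) / real b ^ Suc n" for u
    using zoom(3,4)[OF that] by (intro tree_limit_scaling b_pos S0 S1 i)
  let ?y = "subtree [i] x" and ?f = "\<lambda>x. ennreal (sup_norm (tree_limit b x) powr q)"
  have "tree_limit b x s - tree_limit b x t
      = x [] i * (tree_limit b ?y (real b * s - real i) - tree_limit b ?y (real b * t - real i))"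
    using scal[OF Suc.prems(3,4)] scal[OF Suc.prems(5,6)] by (simp add: algebra_simps)
  then have "ennreal (cmod (tree_limit b x s - tree_limit b x t) powr q)
      = ennreal (cmod (x [] i) powr q)
        * ennreal (cmod (tree_limit b ?y (real b * s - real i) - tree_limit b ?y (real b * t - real i)) powr q)"
    by (simp add: norm_mult powr_mult ennreal_mult)
  also have "\<dots> \<le> ennreal (cmod (x [] i) powr q) * (ennreal (2 powr q) * level_sum q ?f n ?y)"
  proof (rule mult_left_mono[OF Suc.IH[OF _ l]])
    show "summable (\<lambda>n. sup_norm (increment b n (subtree w ?y)))" if "w \<in> words" for w
    proof -
      have "i # w \<in> words" using that i by simp
      from Suc.prems(1)[OF this] show ?thesis by (simp only: subtree_subtree append_Cons append_Nil)
    qed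
  qed (use zoom[OF Suc.prems(3,4)] zoom[OF Suc.prems(5,6)] in auto)
  also have "\<dots> = ennreal (2 powr q) * (ennreal (cmod (x [] i) powr q) * level_sum q ?f n ?y)"
    by (simp add: mult_ac)
  also have "\<dots> \<le> ennreal (2 powr q) * level_sum q ?f (Suc n) x"
    using i unfolding level_sum.simps
    by (intro mult_left_mono member_le_sum[where f = "\<lambda>i. ennreal (cmod (x [] i) powr q) * level_sum q ?f n (subtree [i] x)"]) auto
  finally show ?case .
qed

end

context mean_one_cascade
begin

text \<open>The level sums have expectation \<open>moment q ^ n\<close> times a constant, so after multiplication by
\<open>b powr (n \<gamma> q)\<close> they are summable in expectation, hence almost surely bounded. Taking \<open>q\<close>-th roots, the
oscillation on level \<open>n\<close> is of order \<open>b powr (- n \<gamma>)\<close>.\<close>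

lemma AE_holder_continuous_tree_limit:
  assumes AE_S: "AE x in tree_law. summable (\<lambda>n. sup_norm (increment b n x))"
    and q: "0 < q" and \<gamma>: "0 < \<gamma>"
    and fin: "(\<integral>\<^sup>+x. ennreal (sup_norm (tree_limit b x) powr q) \<partial>tree_law) < \<infinity>"
    and contr: "moment q * ennreal (real b powr (\<gamma> * q)) < 1"
  shows "AE x in tree_law. holder_continuous_on \<gamma> {0..1} (tree_limit b x)"
proof -
  define f where "f x = ennreal (sup_norm (tree_limit b x) powr q)" for x
  have [measurable]: "f \<in> borel_measurable tree_law" unfolding f_def by measurable
  define \<beta> where "\<beta> = real b powr (\<gamma> * q)"
  have \<beta>: "0 < \<beta>" using b_pos by (simp add: \<beta>_def)
  define T where "T x = (\<Sum>n. ennreal (\<beta> ^ n) * level_sum q f n x)" for x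
  have [measurable]: "T \<in> borel_measurable tree_law" unfolding T_def by measurable
  define \<rho> where "\<rho> = enn2real (moment q * ennreal \<beta>)"
  have "moment q * ennreal \<beta> < \<infinity>" using contr unfolding \<beta>_def by (rule less_trans) simp
  then have \<rho>: "moment q * ennreal \<beta> = ennreal \<rho>" "0 \<le> \<rho>" by (auto simp: \<rho>_def)
  have \<rho>1: "\<rho> < 1" using contr \<rho> unfolding \<beta>_def[symmetric] by (simp add: ennreal_less_one_iff)
  have "(\<integral>\<^sup>+x. T x \<partial>tree_law) = (\<Sum>n. ennreal (\<beta> ^ n) * (\<integral>\<^sup>+x. level_sum q f n x \<partial>tree_law))"
    unfolding T_def by (subst nn_integral_suminf) (auto simp: nn_integral_cmult)
  also have "\<dots> = (\<Sum>n. ennreal (\<rho> ^ n) * (\<integral>\<^sup>+x. f x \<partial>tree_law))"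
    using \<beta> \<rho>(2)
    by (intro suminf_cong)
      (simp add: nn_integral_level_sum ennreal_power[symmetric] \<rho>(1)[symmetric] power_mult_distrib mult_ac)
  also have "\<dots> = ennreal (\<Sum>n. \<rho> ^ n) * (\<integral>\<^sup>+x. f x \<partial>tree_law)"
    using \<rho> \<rho>1 by (subst ennreal_suminf_multc) (simp add: suminf_ennreal2 summable_geometric)
  also have "\<dots> < \<infinity>"
    using fin by (simp add: f_def ennreal_mult_eq_top_iff less_top[symmetric])
  finally have "AE x in tree_law. T x \<noteq> \<infinity>"
    by (intro nn_integral_PInf_AE) auto
  with AE_all_subtrees[OF AE_S] show ?thesis
  proof eventually_elim
    case (elim x)
    define \<tau> where "\<tau> = enn2real (T x)"
    have T: "T x = ennreal \<tau>" "0 \<le> \<tau>" using elim(2) by (auto simp: \<tau>_def top.not_eq_extremum)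
    show ?case
    proof (rule holder_continuous_on_of_adic[OF b \<gamma>, where B = "2 * \<tau> powr (1 / q)"])
      fix n k s t
      assume k: "k < b ^ n" and st: "real k / real b ^ n \<le> s" "s \<le> (real k + 1) / real b ^ n"
        "real k / real b ^ n \<le> t" "t \<le> (real k + 1) / real b ^ n"
      let ?d = "cmod (tree_limit b x s - tree_limit b x t)"
      have "ennreal (\<beta> ^ n * ?d powr q) = ennreal (\<beta> ^ n) * ennreal (?d powr q)"
        using \<beta> by (intro ennreal_mult) auto
      also have "\<dots> \<le> ennreal (\<beta> ^ n) * (ennreal (2 powr q) * level_sum q f n x)"
        unfolding f_def using elim(1) by (intro mult_left_mono tree_limit_oscillation_le[OF q _ k st]) auto
      also have "\<dots> = ennreal (2 powr q) * (ennreal (\<beta> ^ n) * level_sum q f n x)"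
        by (simp add: mult_ac)
      also have "\<dots> \<le> ennreal (2 powr q) * T x"
        unfolding T_def by (intro mult_left_mono sum_le_suminf[where I = "{n}", simplified] summableI) auto
      also have "\<dots> = ennreal (2 powr q * \<tau>)"
        using T by (simp add: ennreal_mult)
      finally have "\<beta> ^ n * ?d powr q \<le> 2 powr q * \<tau>"
        using T by (subst (asm) ennreal_le_iff) auto
      then have "?d powr q \<le> 2 powr q * \<tau> / \<beta> ^ n"
        using \<beta> by (simp add: pos_le_divide_eq mult.commute)
      then have "(?d powr q) powr (1 / q) \<le> (2 powr q * \<tau> / \<beta> ^ n) powr (1 / q)"
        using q by (intro powr_mono2) auto
      also have "\<dots> = 2 * \<tau> powr (1 / q) / (\<beta> ^ n) powr (1 / q)"
        using q T \<beta> by (simp add: powr_divide powr_mult powr_powr)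
      also have "(\<beta> ^ n) powr (1 / q) = real b powr (\<gamma> * real n)"
        using q b_pos \<beta> by (simp add: \<beta>_def powr_powr powr_realpow[symmetric] mult_ac)
      finally show "?d \<le> 2 * \<tau> powr (1 / q) * real b powr (- (\<gamma> * real n))"
        using q by (simp add: powr_powr powr_minus divide_inverse)
    qed (use T in auto)
  qed
qed

text \<open>The path of generation \<open>0\<close> is the identity, of norm \<open>1\<close>; the error at generation \<open>0\<close> has a finite
\<open>p\<close>-th moment.\<close>

lemma nn_integral_sup_norm_tree_limit:
  assumes p: "1 < p" and m: "moment p < 1" and p2: "p \<le> 2 \<or> moment 2 < 1" and q: "1 \<le> q" "q \<le> p"
  shows "(\<integral>\<^sup>+x. ennreal (sup_norm (tree_limit b x) powr q) \<partial>tree_law) < \<infinity>"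
proof -
  let ?e = "\<lambda>x. sup_norm (\<lambda>t. cascade_path b 0 x t - tree_limit b x t)"
  obtain C s where "(\<integral>\<^sup>+x. ennreal (?e x powr p) \<partial>tree_law) \<le> ennreal (C * s ^ 0)"
    using Lp_error_geometric[OF p m p2] by blast
  then have fin: "(\<integral>\<^sup>+x. ennreal (?e x powr p) \<partial>tree_law) < \<infinity>"
    by (rule le_less_trans) simp
  have cont: "continuous_on {0..1} (\<lambda>t. cascade_path b 0 x t - tree_limit b x t)" for x
    by (intro continuous_intros continuous_on_cascade_path continuous_on_tree_limit)
  have le: "sup_norm (tree_limit b x) powr q \<le> 1 + 2 powr p * (?e x powr p + 1)" for x
  proof -
    have e0: "0 \<le> ?e x" by (rule sup_norm_nonneg[OF cont])
    have l0: "0 \<le> sup_norm (tree_limit b x)" by (rule sup_norm_nonneg[OF continuous_on_tree_limit])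
    have "sup_norm (tree_limit b x) \<le> ?e x + 1"
    proof (rule sup_norm_le)
      fix t :: real assume t: "t \<in> {0..1}"
      have "cmod (tree_limit b x t) \<le> cmod (cascade_path b 0 x t - tree_limit b x t) + cmod (cascade_path b 0 x t)"
        using norm_triangle_ineq4[of "cascade_path b 0 x t" "cascade_path b 0 x t - tree_limit b x t"] by simp
      also have "cmod (cascade_path b 0 x t) \<le> 1" using t by simp
      also have "cmod (cascade_path b 0 x t - tree_limit b x t) \<le> ?e x"
        by (rule cmod_le_sup_norm[OF cont t])
      finally show "cmod (tree_limit b x t) \<le> ?e x + 1" by simp
    qed
    moreover have "?e x + 1 \<le> 2 * max (?e x) 1" by simp
    ultimately have "sup_norm (tree_limit b x) powr p \<le> (2 * max (?e x) 1) powr p"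
      using p l0 by (intro powr_mono2) auto
    also have "\<dots> = 2 powr p * max (?e x) 1 powr p"
      by (simp add: powr_mult)
    also have "max (?e x) 1 powr p \<le> ?e x powr p + 1"
      by (auto simp: max_def)
    finally have "sup_norm (tree_limit b x) powr p \<le> 2 powr p * (?e x powr p + 1)"
      by simp
    moreover have "u powr q \<le> 1 + u powr p" if "0 \<le> u" for u :: real
    proof (cases "u \<le> 1")
      case True
      then have "u powr q \<le> 1" using q that by (intro powr_le1) auto
      then show ?thesis using powr_ge_zero[of u p] by linarith
    next
      case False
      then have "u powr q \<le> u powr p" using q by (intro powr_mono) auto
      then show ?thesis by linarith
    qed
    ultimately show ?thesis using l0 by fastforce
  qed
  have "(\<integral>\<^sup>+x. ennreal (sup_norm (tree_limit b x) powr q) \<partial>tree_law)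
      \<le> (\<integral>\<^sup>+x. (1 + ennreal (2 powr p) * (ennreal (?e x powr p) + 1)) \<partial>tree_law)"
  proof (intro nn_integral_mono)
    fix x
    have "ennreal (sup_norm (tree_limit b x) powr q) \<le> ennreal (1 + 2 powr p * (?e x powr p + 1))"
      by (intro ennreal_leI le)
    also have "\<dots> = 1 + ennreal (2 powr p) * (ennreal (?e x powr p) + 1)"
      by (simp add: ennreal_mult)
    finally show "ennreal (sup_norm (tree_limit b x) powr q) \<le> 1 + ennreal (2 powr p) * (ennreal (?e x powr p) + 1)" .
  qed
  also have "\<dots> = 1 + ennreal (2 powr p) * ((\<integral>\<^sup>+x. ennreal (?e x powr p) \<partial>tree_law) + 1)"
    by (simp add: nn_integral_add nn_integral_cmult tree.emeasure_space_1 del: cascade_path.simps)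
  also have "\<dots> < \<infinity>"
    using fin by (simp add: ennreal_mult_eq_top_iff less_top[symmetric])
  finally show ?thesis .
qed

definition real_moment :: "real \<Rightarrow> real" where
  "real_moment r = (\<integral>a. (\<Sum>j<b. cmod (a j) powr r) \<partial>\<mu>)"

text \<open>Continuity is dominated convergence, the dominating function being the sum of the \<open>1 + \<bar>a\<^sub>j\<bar>\<^sup>p\<close>. A
vanishing moment would make all weights vanish almost surely and contradict the mean \<open>1\<close>, which also
gives the bound at the exponent \<open>1\<close> by the triangle inequality.\<close>

lemma real_moment_properties:
  assumes p: "1 < p" and m: "moment p < \<infinity>"
  shows moment_eq_real_moment: "r \<in> {1..p} \<Longrightarrow> moment r = ennreal (real_moment r)"
    and real_moment_pos: "r \<in> {1..p} \<Longrightarrow> 0 < real_moment r"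
    and real_moment_1: "1 \<le> real_moment 1"
    and continuous_on_real_moment: "continuous_on {1..p} real_moment"
proof -
  let ?h = "\<lambda>r a. \<Sum>j<b. cmod (a j) powr r"
  let ?g = "\<lambda>a. \<Sum>j<b. 1 + cmod (a j) powr p"
  have "integrable \<mu> (?h p)"
  proof (rule integrableI_nonneg)
    show "(\<integral>\<^sup>+a. ennreal (?h p a) \<partial>\<mu>) < \<infinity>" using m by (simp add: moment_def)
  qed (auto intro!: sum_nonneg)
  then have int_g: "integrable \<mu> ?g" by (simp add: sum.distrib)
  have dom: "cmod (a j) powr r \<le> 1 + cmod (a j) powr p" if r: "r \<in> {1..p}" for a :: "nat \<Rightarrow> complex" and j r
  proof (cases "cmod (a j) \<le> 1")
    case True
    then have "cmod (a j) powr r \<le> 1" using r by (intro powr_le1) auto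
    then show ?thesis using powr_ge_zero[of "cmod (a j)" p] by linarith
  next
    case False
    then have "cmod (a j) powr r \<le> cmod (a j) powr p" using r by (intro powr_mono) auto
    then show ?thesis by linarith
  qed
  have h_nonneg: "0 \<le> ?h r a" for r a by (intro sum_nonneg) auto
  have int_h: "integrable \<mu> (?h r)" if r: "r \<in> {1..p}" for r
    using int_g
  proof (rule Bochner_Integration.integrable_bound)
    show "AE a in \<mu>. norm (?h r a) \<le> norm (?g a)"
    proof (rule AE_I2)
      fix a
      have "?h r a \<le> ?g a" by (intro sum_mono dom r)
      then show "norm (?h r a) \<le> norm (?g a)" using h_nonneg[of a r] by simp
    qed
  qed measurable
  show eq: "moment r = ennreal (real_moment r)" if "r \<in> {1..p}" for r
    unfolding moment_def real_moment_def
    using int_h[OF that] h_nonneg by (simp add: nn_integral_eq_integral)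
  have int_sum: "integrable \<mu> (\<lambda>a. \<Sum>j<b. a j)" using integrable_weight by (intro Bochner_Integration.integrable_sum) auto
  show "1 \<le> real_moment 1"
  proof -
    have "1 = cmod (\<integral>a. (\<Sum>j<b. a j) \<partial>\<mu>)" using mean_one by simp
    also have "\<dots> \<le> (\<integral>a. cmod (\<Sum>j<b. a j) \<partial>\<mu>)" by (rule integral_norm_bound)
    also have "\<dots> \<le> real_moment 1"
      unfolding real_moment_def using int_sum int_h[of 1] p
      by (intro integral_mono integrable_norm) (auto intro!: sum_norm_le)
    finally show ?thesis .
  qed
  show "0 < real_moment r" if r: "r \<in> {1..p}" for r
  proof (rule ccontr)
    assume "\<not> 0 < real_moment r"
    then have "real_moment r = 0"
      using h_nonneg unfolding real_moment_def by (intro antisym integral_nonneg_AE) auto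
    then have "AE a in \<mu>. ?h r a = 0"
      unfolding real_moment_def using integral_nonneg_eq_0_iff_AE[OF int_h[OF r]] h_nonneg by simp
    then have "AE a in \<mu>. (\<Sum>j<b. a j) = 0"
    proof eventually_elim
      case (elim a)
      then have "\<forall>j\<in>{..<b}. cmod (a j) powr r = 0" by (subst (asm) sum_nonneg_eq_0_iff) auto
      then show ?case by (intro sum.neutral) auto
    qed
    then have "(\<integral>a. (\<Sum>j<b. a j) \<partial>\<mu>) = 0"
      using integral_cong_AE[of "\<lambda>a. \<Sum>j<b. a j" \<mu> "\<lambda>_. 0"] int_sum by simp
    then show False using mean_one by simp
  qed
  show "continuous_on {1..p} real_moment"
  proof (rule continuous_on_sequentiallyI)
    fix u r assume u: "\<forall>n. u n \<in> {1..p}" and r: "r \<in> {1..p}" and lim: "u \<longlonglongrightarrow> r"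
    show "(\<lambda>n. real_moment (u n)) \<longlonglongrightarrow> real_moment r"
      unfolding real_moment_def
    proof (rule integral_dominated_convergence[where w = ?g])
      show "AE a in \<mu>. (\<lambda>n. ?h (u n) a) \<longlonglongrightarrow> ?h r a"
      proof (intro AE_I2 tendsto_sum)
        fix a :: "nat \<Rightarrow> complex" and j
        show "(\<lambda>n. cmod (a j) powr u n) \<longlonglongrightarrow> cmod (a j) powr r"
          by (cases "a j = 0") (auto intro!: tendsto_intros lim)
      qed
      show "AE a in \<mu>. norm (?h (u n) a) \<le> ?g a" for n
      proof (rule AE_I2)
        fix a
        have "?h (u n) a \<le> ?g a" using u by (intro sum_mono dom) auto
        then show "norm (?h (u n) a) \<le> ?g a" using h_nonneg[of a "u n"] by simp
      qed
    qed (use int_g in \<open>auto intro!: borel_measurable_sum\<close>)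
  qed
qed

text \<open>The quotient \<open>\<phi>(r)/r\<close> attains its maximum on the compact interval \<open>[1,p]\<close>, and not at \<open>1\<close>, where it is at
most \<open>0\<close> while at \<open>p\<close> it is positive.\<close>

lemma exists_optimal_exponent:
  assumes p: "1 < p" and m: "moment p < 1"
  obtains q where "q \<in> {1<..p}" "- log (real b) (real_moment q) / q > 0"
    "\<And>r. r \<in> {1<..p} \<Longrightarrow> - log (real b) (real_moment r) / r \<le> - log (real b) (real_moment q) / q"
proof -
  have fin: "moment p < \<infinity>" using m by (rule less_trans) simp
  note props = real_moment_properties[OF p fin]
  let ?h = "\<lambda>r. - log (real b) (real_moment r) / r"
  have "continuous_on {1..p} ?h"
    using props(2) props(4) b by (intro continuous_intros) (auto simp: less_imp_neq[symmetric])
  then obtain q where q: "q \<in> {1..p}" "\<And>r. r \<in> {1..p} \<Longrightarrow> ?h r \<le> ?h q"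
    using continuous_attains_sup[of "{1..p}" ?h] p by auto
  have pp: "p \<in> {1..p}" using p by simp
  have "real_moment p < 1"
    using m props(1)[OF pp] props(2)[OF pp] by (simp add: ennreal_less_one_iff)
  then have "log (real b) (real_moment p) < 0"
    using props(2)[OF pp] b by simp
  then have hp: "0 < ?h p" using p by (simp add: divide_neg_pos)
  have "0 \<le> log (real b) (real_moment 1)" using props(3) b by simp
  then have "?h 1 \<le> 0" by simp
  moreover have "0 < ?h q" using hp q(2)[OF pp] by linarith
  ultimately have "q \<noteq> 1" by auto
  show thesis
  proof (rule that[of q])
    show "q \<in> {1<..p}" using q(1) \<open>q \<noteq> 1\<close> by auto
    show "0 < ?h q" by fact
    show "?h r \<le> ?h q" if "r \<in> {1<..p}" for r using that by (intro q(2)) auto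
  qed
qed

end

section \<open>The limit theorem\<close>

lemma inv_similarity: "0 < b \<Longrightarrow> inv (similarity b i) t = real b * t - real i"
  by (rule inv_f_eq) (auto simp: inj_on_def similarity_def)

lemma vimage_algebra_factor_subset:
  assumes Y: "Y \<in> M \<rightarrow>\<^sub>M N" and h: "h \<in> N \<rightarrow>\<^sub>M N'" and Z: "\<And>\<omega>. \<omega> \<in> space M \<Longrightarrow> Z \<omega> = h (Y \<omega>)"
  shows "sets (vimage_algebra (space M) Z N') \<subseteq> {Y -` A \<inter> space M |A. A \<in> sets N}"
proof -
  have "Z \<in> space M \<rightarrow> space N'"
    using measurable_space[OF Y] measurable_space[OF h] Z by auto
  then have "sets (vimage_algebra (space M) Z N') = {Z -` A \<inter> space M |A. A \<in> sets N'}"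
    by (rule sets_vimage_algebra2)
  also have "\<dots> \<subseteq> {Y -` A \<inter> space M |A. A \<in> sets N}"
  proof safe
    fix A assume "A \<in> sets N'"
    then have "h -` A \<inter> space N \<in> sets N" using h by (rule measurable_sets[rotated])
    moreover have "Z -` A \<inter> space M = Y -` (h -` A \<inter> space N) \<inter> space M"
      using measurable_space[OF Y] Z by auto
    ultimately show "\<exists>B. Z -` A \<inter> space M = Y -` B \<inter> space M \<and> B \<in> sets N" by blast
  qed
  finally show ?thesis .
qed

lemma phi_eq_moment:
  assumes V: "V \<in> M \<rightarrow>\<^sub>M complex_vectors b" and \<mu>: "\<mu> = distr M (complex_vectors b) V"
    and law: "cascade_law \<mu> b"
  shows "phi M b V r = (if cascade_law.moment \<mu> b r = \<infinity> then - \<infinity>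
    else if cascade_law.moment \<mu> b r = 0 then \<infinity>
    else ereal (- log (real b) (enn2real (cascade_law.moment \<mu> b r))))"
proof -
  interpret cascade_law \<mu> b by (rule law)
  have "moment r = (\<integral>\<^sup>+a. ennreal (\<Sum>j<b. cmod (a j) powr r) \<partial>distr M (complex_vectors b) V)"
    unfolding \<mu>[symmetric] by (simp add: moment_def)
  also have "\<dots> = (\<integral>\<^sup>+\<omega>. ennreal (\<Sum>j<b. cmod (V \<omega> j) powr r) \<partial>M)"
  proof (rule nn_integral_distr[OF V])
    show "(\<lambda>a. ennreal (\<Sum>j<b. cmod (a j) powr r)) \<in> borel_measurable (distr M (complex_vectors b) V)"
      unfolding \<mu>[symmetric] by measurable
  qed
  finally show ?thesis by (simp add: phi_def Let_def)
qed

text \<open>All statements are transported from \<open>tree_law\<close> along the random tree \<open>X\<close> of the weights. The function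
\<open>G i\<close> is the limit path of the \<open>i\<close>-th subtree; the independence in the second part holds because \<open>W []\<close>
and the subtrees are read off from disjoint blocks of the family of weights.\<close>

theorem theorem2p1:
  fixes M :: "'a measure"
    and b :: nat
    and W :: "nat list \<Rightarrow> 'a \<Rightarrow> nat \<Rightarrow> complex"
    and p :: real
  assumes b: "2 \<le> b"
    and M: "prob_space M"
    and W_indep: "prob_space.indep_vars M (\<lambda>_. complex_vectors b) W (lists {..<b})"
    and W_copies: "\<forall>w\<in>lists {..<b}. distr M (complex_vectors b) (W w) = distr M (complex_vectors b) (W [])"
    and W_integrable: "\<forall>i<b. integrable M (\<lambda>\<omega>. W [] \<omega> i)"
    and W_mean: "prob_space.expectation M (\<lambda>\<omega>. \<Sum>i<b. W [] \<omega> i) = 1"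
    and W_nontrivial: "measure M {\<omega>\<in>space M. (\<Sum>i<b. W [] \<omega> i) \<noteq> 1} > 0"
    and p: "1 < p" "phi M b (W []) p > 0"
    and p2: "p \<le> 2 \<or> phi M b (W []) 2 > 0"
  shows "\<exists>F :: 'a \<Rightarrow> real \<Rightarrow> complex.
    F \<in> measurable M continuous_paths \<and>
    \<comment> \<open>(1)\<close>
    (AE \<omega> in M. uniform_limit {0..1} (\<lambda>n. cascade b W n \<omega>) (F \<omega>) sequentially) \<and>
    (\<forall>n\<ge>1. integrable M (\<lambda>\<omega>. sup_norm (\<lambda>t. cascade b W n \<omega> t - F \<omega> t) powr p)) \<and>
    (\<lambda>n. prob_space.expectation M (\<lambda>\<omega>. sup_norm (\<lambda>t. cascade b W n \<omega> t - F \<omega> t) powr p))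
      \<longlonglongrightarrow> 0 \<and>
    ((AE \<omega> in M. \<forall>i<b. W [] \<omega> i \<in> \<real>\<^sub>\<ge>\<^sub>0) \<longrightarrow>
      (AE \<omega> in M. (\<forall>t\<in>{0..1}. F \<omega> t \<in> \<real>) \<and> mono_on {0..1} (\<lambda>t. Re (F \<omega> t)))) \<and>
    (\<exists>q\<in>{1<..p}.
      (\<forall>r\<in>{1<..p}. phi M b (W []) r / ereal r \<le> phi M b (W []) q / ereal q) \<and>
      (AE \<omega> in M. \<forall>\<gamma>. 0 < \<gamma> \<and> ereal \<gamma> < phi M b (W []) q / ereal q \<longrightarrow>
        holder_continuous_on \<gamma> {0..1} (F \<omega>))) \<and>
    \<comment> \<open>(2)\<close>
    (\<exists>G :: nat \<Rightarrow> 'a \<Rightarrow> real \<Rightarrow> complex.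
      (\<forall>i<b. G i \<in> measurable M continuous_paths \<and>
        distr M continuous_paths (G i) = distr M continuous_paths F) \<and>
      prob_space.indep_sets M
        (\<lambda>j. case j of
            None \<Rightarrow> sets (vimage_algebra (space M) (W []) (complex_vectors b))
          | Some i \<Rightarrow> sets (vimage_algebra (space M) (G i) continuous_paths))
        (insert None (Some ` {..<b})) \<and>
      (AE \<omega> in M. \<forall>i<b. \<forall>t\<in>{real i / real b..(real i + 1) / real b}.
        F \<omega> t = F \<omega> (real i / real b) + W [] \<omega> i * G i \<omega> (inv (similarity b i) t)))"
proof -
  interpret M: prob_space M by (rule M)
  let ?words = "lists {..<b}"
  have b0: "0 < b" using b by simp
  have W_meas: "W w \<in> M \<rightarrow>\<^sub>M complex_vectors b" if "w \<in> ?words" for w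
    using W_indep that unfolding M.indep_vars_def by auto
  have W0: "W [] \<in> M \<rightarrow>\<^sub>M complex_vectors b" by (rule W_meas) simp
  define \<mu> where "\<mu> = distr M (complex_vectors b) (W [])"
  interpret \<mu>: prob_space \<mu> unfolding \<mu>_def by (rule M.prob_space_distr[OF W0])
  have coord: "(\<lambda>a. a i) \<in> borel_measurable (complex_vectors b)" if "i < b" for i
    using that by simp
  interpret cascade_law \<mu> b
    by unfold_locales (auto simp: b \<mu>_def)
  interpret mean_one_cascade \<mu> b
  proof unfold_locales
    show "integrable \<mu> (\<lambda>a. a i)" if "i < b" for i
      unfolding \<mu>_def using W_integrable that by (subst integrable_distr_eq[OF W0 coord]) auto
    have "(\<integral>a. (\<Sum>i<b. a i) \<partial>\<mu>) = (\<integral>\<omega>. (\<Sum>i<b. W [] \<omega> i) \<partial>M)"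
      unfolding \<mu>_def by (intro integral_distr[OF W0] borel_measurable_sum coord) simp
    then show "(\<integral>a. (\<Sum>i<b. a i) \<partial>\<mu>) = 1" using W_mean by simp
  qed

  note phi_moment = phi_eq_moment[OF W0 \<mu>_def cascade_law_axioms]
  have moment_less_1: "moment r < 1" if "phi M b (W []) r > 0" for r
  proof -
    have "moment r = 0 \<or> (moment r \<noteq> \<infinity> \<and> 0 < - log (real b) (enn2real (moment r)))"
      using that unfolding phi_moment by (auto split: if_splits)
    then show ?thesis
    proof
      assume *: "moment r \<noteq> \<infinity> \<and> 0 < - log (real b) (enn2real (moment r))"
      have "enn2real (moment r) < 1"
      proof (rule ccontr)
        assume "\<not> enn2real (moment r) < 1"
        then have "0 \<le> log (real b) (enn2real (moment r))" using b by simp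
        then show False using * by simp
      qed
      moreover have "moment r = ennreal (enn2real (moment r))" using * by (simp add: top.not_eq_extremum)
      ultimately show ?thesis by (metis ennreal_less_one_iff)
    qed simp
  qed
  have mp: "moment p < 1" by (rule moment_less_1[OF p(2)])
  have m2: "p \<le> 2 \<or> moment 2 < 1" using p2 moment_less_1 by blast
  have mp_fin: "moment p < \<infinity>" using mp by (rule less_trans) simp

  define X where "X \<omega> = (\<lambda>w\<in>?words. W w \<omega>)" for \<omega>
  have X_meas: "X \<in> M \<rightarrow>\<^sub>M tree_law"
    unfolding X_def[abs_def] measurable_cong_sets[OF refl sets_tree_law]
    by (rule measurable_restrict) (rule W_meas)
  have distr_X: "distr M tree_law X = tree_law"
  proof -
    have "distr M tree_law X = distr M (\<Pi>\<^sub>M w\<in>?words. complex_vectors b) (\<lambda>\<omega>. \<lambda>w\<in>?words. W w \<omega>)"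
      by (intro distr_cong) (auto simp: X_def sets_tree_law)
    also have "\<dots> = (\<Pi>\<^sub>M w\<in>?words. distr M (complex_vectors b) (W w))"
    proof (rule M.indep_vars_iff_distr_eq_PiM'[THEN iffD1, OF _ _ W_indep])
      have "[] \<in> ?words" by simp
      then show "?words \<noteq> {}" by blast
    qed (rule W_meas)
    also have "\<dots> = (\<Pi>\<^sub>M w\<in>?words. \<mu>)"
      unfolding \<mu>_def by (intro PiM_cong refl) (rule bspec[OF W_copies])
    also have "\<dots> = tree_law" by (simp add: tree_law_def)
    finally show ?thesis .
  qed
  have AE_X: "AE \<omega> in M. Q (X \<omega>)" if "AE x in tree_law. Q x" for Q
  proof (rule AE_distrD[OF X_meas])
    show "AE x in distr M tree_law X. Q x" unfolding distr_X by (rule that)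
  qed
  have cascade_X: "cascade b W n \<omega> t = cascade_path b n (X \<omega>) t" if "t \<in> {0..1}" for n \<omega> t
    unfolding X_def by (rule cascade_eq_cascade_path[OF b0 that])

  define F where "F \<omega> = tree_limit b (X \<omega>)" for \<omega>
  define G where "G i \<omega> = tree_limit b (subtree [i] (X \<omega>))" for i \<omega>
  have F_meas: "F \<in> M \<rightarrow>\<^sub>M continuous_paths"
    unfolding F_def[abs_def] by (rule measurable_compose[OF X_meas measurable_tree_limit])
  note AE_S = AE_summable_increment[OF p(1) mp m2]

  have uniform: "AE \<omega> in M. uniform_limit {0..1} (\<lambda>n. cascade b W n \<omega>) (F \<omega>) sequentially"
    using AE_X[OF AE_S]
  proof eventually_elim
    case (elim \<omega>)
    show ?case
      using uniform_limit_tree_limit[OF elim]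
      by (subst uniform_limit_cong'[where g = "\<lambda>n. cascade_path b n (X \<omega>)" and i = "tree_limit b (X \<omega>)"])
        (auto simp: cascade_X F_def)
  qed

  let ?err = "\<lambda>n x. sup_norm (\<lambda>t. cascade_path b n x t - tree_limit b x t)"
  have err: "sup_norm (\<lambda>t. cascade b W n \<omega> t - F \<omega> t) powr p = ?err n (X \<omega>) powr p" for n \<omega>
    by (intro arg_cong[where f = "\<lambda>u. u powr p"] sup_norm_cong) (simp add: cascade_X F_def)
  have err_meas: "(\<lambda>\<omega>. ?err n (X \<omega>) powr p) \<in> borel_measurable M" for n
    by (rule measurable_compose[OF X_meas]) measurable
  obtain C s where C: "0 \<le> C" and s: "0 < s" "s < 1"
    and err_le: "\<And>n. (\<integral>\<^sup>+x. ennreal (?err n x powr p) \<partial>tree_law) \<le> ennreal (C * s ^ n)"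
    using Lp_error_geometric[OF p(1) mp m2] by blast
  have err_le_M: "(\<integral>\<^sup>+\<omega>. ennreal (?err n (X \<omega>) powr p) \<partial>M) \<le> ennreal (C * s ^ n)" for n
  proof -
    have "(\<integral>\<^sup>+\<omega>. ennreal (?err n (X \<omega>) powr p) \<partial>M) = (\<integral>\<^sup>+x. ennreal (?err n x powr p) \<partial>distr M tree_law X)"
      by (rule nn_integral_distr[OF X_meas, symmetric]) measurable
    then show ?thesis using err_le[of n] by (simp add: distr_X)
  qed
  have err_int: "integrable M (\<lambda>\<omega>. ?err n (X \<omega>) powr p)" for n
    by (rule integrableI_nonneg[OF err_meas]) (auto intro: le_less_trans[OF err_le_M])
  have err_lim: "(\<lambda>n. M.expectation (\<lambda>\<omega>. ?err n (X \<omega>) powr p)) \<longlonglongrightarrow> 0"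
  proof (rule tendsto_sandwich[OF _ _ tendsto_const])
    show "\<forall>\<^sub>F n in sequentially. 0 \<le> M.expectation (\<lambda>\<omega>. ?err n (X \<omega>) powr p)"
      by (intro always_eventually allI integral_nonneg_AE) auto
    show "\<forall>\<^sub>F n in sequentially. M.expectation (\<lambda>\<omega>. ?err n (X \<omega>) powr p) \<le> C * s ^ n"
    proof (intro always_eventually allI)
      fix n
      have "ennreal (M.expectation (\<lambda>\<omega>. ?err n (X \<omega>) powr p)) \<le> ennreal (C * s ^ n)"
        using err_le_M[of n] by (subst nn_integral_eq_integral[symmetric, OF err_int]) auto
      then show "M.expectation (\<lambda>\<omega>. ?err n (X \<omega>) powr p) \<le> C * s ^ n"
        using C s by (subst (asm) ennreal_le_iff) auto
    qed
    show "(\<lambda>n. C * s ^ n) \<longlonglongrightarrow> 0"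
      using s by (auto intro!: tendsto_mult_right_zero LIMSEQ_realpow_zero)
  qed

  have monotone: "AE \<omega> in M. (\<forall>t\<in>{0..1}. F \<omega> t \<in> \<real>) \<and> mono_on {0..1} (\<lambda>t. Re (F \<omega> t))"
    if nonneg: "AE \<omega> in M. \<forall>i<b. W [] \<omega> i \<in> \<real>\<^sub>\<ge>\<^sub>0"
  proof -
    let ?P = "\<lambda>a :: nat \<Rightarrow> complex. \<forall>i<b. a i \<in> \<real>\<^sub>\<ge>\<^sub>0"
    have P_sets: "{a \<in> space (complex_vectors b). ?P a} \<in> sets (complex_vectors b)"
    proof -
      have "{a \<in> space (complex_vectors b). \<forall>i\<in>{..<b}. a i \<in> \<real>\<^sub>\<ge>\<^sub>0} \<in> sets (complex_vectors b)"
      proof (rule sets.sets_Collect_countable_All')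
        fix i assume "i \<in> {..<b}"
        then have "(\<lambda>a. a i) -` \<real>\<^sub>\<ge>\<^sub>0 \<inter> space (complex_vectors b) \<in> sets (complex_vectors b)"
          by (intro measurable_sets[OF coord] borel_closed closed_nonneg_Reals_complex) simp
        then show "{a \<in> space (complex_vectors b). a i \<in> \<real>\<^sub>\<ge>\<^sub>0} \<in> sets (complex_vectors b)"
          by (simp add: vimage_def Int_def conj_commute)
      qed simp
      then show ?thesis by (simp add: lessThan_iff[symmetric] Ball_def del: lessThan_iff)
    qed
    have "AE a in distr M (complex_vectors b) (W []). ?P a"
      using nonneg by (subst AE_distr_iff[OF W0 P_sets])
    then have "AE \<omega> in M. ?P (W w \<omega>)" if "w \<in> ?words" for w
      unfolding bspec[OF W_copies that, symmetric] by (rule AE_distrD[OF W_meas[OF that]])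
    then have "AE \<omega> in M. \<forall>w\<in>?words. ?P (W w \<omega>)"
      by (subst AE_ball_countable) (auto intro: countable_subset[OF subset_UNIV])
    then show ?thesis
    proof eventually_elim
      case (elim \<omega>)
      have diff: "F \<omega> t - F \<omega> s \<in> \<real>\<^sub>\<ge>\<^sub>0" if "s \<le> t" "s \<in> {0..1}" "t \<in> {0..1}" for s t
        unfolding F_def using elim by (intro tree_limit_diff_nonneg that) (simp add: X_def)
      show ?case
      proof (intro conjI ballI)
        fix t :: real assume "t \<in> {0..1}"
        then have "F \<omega> t - F \<omega> 0 \<in> \<real>\<^sub>\<ge>\<^sub>0" by (intro diff) auto
        then show "F \<omega> t \<in> \<real>" by (auto simp: F_def)
      next
        show "mono_on {0..1} (\<lambda>t. Re (F \<omega> t))"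
        proof (rule mono_onI)
          fix s t :: real assume "s \<in> {0..1}" "t \<in> {0..1}" "s \<le> t"
          then show "Re (F \<omega> s) \<le> Re (F \<omega> t)"
            using diff[of s t] by (auto simp: complex_nonneg_Reals_iff)
        qed
      qed
    qed
  qed

  have holder: "\<exists>q\<in>{1<..p}.
      (\<forall>r\<in>{1<..p}. phi M b (W []) r / ereal r \<le> phi M b (W []) q / ereal q) \<and>
      (AE \<omega> in M. \<forall>\<gamma>. 0 < \<gamma> \<and> ereal \<gamma> < phi M b (W []) q / ereal q \<longrightarrow>
        holder_continuous_on \<gamma> {0..1} (F \<omega>))"
  proof -
    let ?h = "\<lambda>r. - log (real b) (real_moment r) / r"
    obtain q where q: "q \<in> {1<..p}" "?h q > 0" "\<And>r. r \<in> {1<..p} \<Longrightarrow> ?h r \<le> ?h q"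
      using exists_optimal_exponent[OF p(1) mp] by blast
    have ratio: "phi M b (W []) r / ereal r = ereal (?h r)" if "r \<in> {1<..p}" for r
    proof -
      have r: "r \<in> {1..p}" using that by auto
      have "moment r = ennreal (real_moment r)" "0 < real_moment r"
        using moment_eq_real_moment[OF p(1) mp_fin r] real_moment_pos[OF p(1) mp_fin r] by auto
      then have "phi M b (W []) r = ereal (- log (real b) (real_moment r))"
        unfolding phi_moment by simp
      then show ?thesis using that by simp
    qed
    have AE_\<gamma>: "AE \<omega> in M. holder_continuous_on \<gamma> {0..1} (F \<omega>)" if \<gamma>: "0 < \<gamma>" "\<gamma> < ?h q" for \<gamma>
      unfolding F_def
    proof (rule AE_X, rule AE_holder_continuous_tree_limit[OF AE_S, where q = q])
      have q1: "q \<in> {1..p}" using q(1) by auto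
      have pos: "0 < real_moment q" by (rule real_moment_pos[OF p(1) mp_fin q1])
      have "\<gamma> * q < - log (real b) (real_moment q)"
        using mult_strict_right_mono[OF \<gamma>(2), of q] q(1) by simp
      then have "real b powr (\<gamma> * q) < real b powr (- log (real b) (real_moment q))"
        using b by (intro powr_less_mono) auto
      also have "\<dots> = 1 / real_moment q"
        using b pos by (simp add: powr_minus divide_inverse)
      finally have "real_moment q * real b powr (\<gamma> * q) < 1"
        using pos by (simp add: pos_less_divide_eq mult.commute)
      then show "moment q * ennreal (real b powr (\<gamma> * q)) < 1"
        unfolding moment_eq_real_moment[OF p(1) mp_fin q1]
        using pos by (simp add: ennreal_mult[symmetric] ennreal_less_one_iff)
      show "(\<integral>\<^sup>+x. ennreal (sup_norm (tree_limit b x) powr q) \<partial>tree_law) < \<infinity>"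
        using q1 by (intro nn_integral_sup_norm_tree_limit[OF p(1) mp m2]) auto
    qed (use q(1) \<gamma> in auto)
    \<comment> \<open>Rational exponents suffice for a common null set: Hoelder continuity passes to smaller exponents.\<close>
    have "AE \<omega> in M. \<forall>\<gamma>\<in>\<rat> \<inter> {0<..<?h q}. holder_continuous_on \<gamma> {0..1} (F \<omega>)"
    proof (subst AE_ball_countable)
      show "countable (\<rat> \<inter> {0<..<?h q})" using countable_rat by (rule countable_subset[rotated]) auto
      show "\<forall>\<gamma>\<in>\<rat> \<inter> {0<..<?h q}. AE \<omega> in M. holder_continuous_on \<gamma> {0..1} (F \<omega>)"
        using AE_\<gamma> by auto
    qed
    then have main: "AE \<omega> in M. \<forall>\<gamma>. 0 < \<gamma> \<and> ereal \<gamma> < ereal (?h q) \<longrightarrow>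
        holder_continuous_on \<gamma> {0..1} (F \<omega>)"
    proof eventually_elim
      case (elim \<omega>)
      show ?case
      proof (intro allI impI)
        fix \<gamma> assume \<gamma>: "0 < \<gamma> \<and> ereal \<gamma> < ereal (?h q)"
        then have "\<gamma> < ?h q" by simp
        then obtain \<gamma>' where \<gamma>': "\<gamma>' \<in> \<rat>" "\<gamma> < \<gamma>'" "\<gamma>' < ?h q"
          using Rats_dense_in_real by blast
        have "0 < \<gamma>'" by (rule less_trans[OF conjunct1[OF \<gamma>] \<gamma>'(2)])
        then have "\<gamma>' \<in> \<rat> \<inter> {0<..<?h q}"
          using \<gamma>'(1,3) by (intro IntI greaterThanLessThan_iff[THEN iffD2] conjI)
        then have "holder_continuous_on \<gamma>' {0..1} (F \<omega>)" by (rule bspec[OF elim])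
        then show "holder_continuous_on \<gamma> {0..1} (F \<omega>)"
          by (rule holder_continuous_on_mono[OF _ less_imp_le[OF \<gamma>'(2)]])
      qed
    qed
    show ?thesis
    proof (intro bexI[of _ q] conjI ballI)
      fix r assume r: "r \<in> {1<..p}"
      show "phi M b (W []) r / ereal r \<le> phi M b (W []) q / ereal q"
        unfolding ratio[OF r] ratio[OF q(1)] using q(3)[OF r] by simp
    next
      show "AE \<omega> in M. \<forall>\<gamma>. 0 < \<gamma> \<and> ereal \<gamma> < phi M b (W []) q / ereal q \<longrightarrow>
          holder_continuous_on \<gamma> {0..1} (F \<omega>)"
        unfolding ratio[OF q(1)] by (rule main)
    qed (rule q(1))
  qed

  have sub_meas: "(\<lambda>\<omega>. subtree [i] (X \<omega>)) \<in> M \<rightarrow>\<^sub>M tree_law" if "i < b" for i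
    using that by (intro measurable_compose[OF X_meas measurable_subtree]) simp
  have G_meas: "G i \<in> M \<rightarrow>\<^sub>M continuous_paths" if "i < b" for i
    unfolding G_def[abs_def] by (rule measurable_compose[OF sub_meas[OF that] measurable_tree_limit])
  have G_distr: "distr M continuous_paths (G i) = distr M continuous_paths F" if i: "i < b" for i
  proof -
    have "distr M continuous_paths (G i) = distr (distr M tree_law (\<lambda>\<omega>. subtree [i] (X \<omega>))) continuous_paths (tree_limit b)"
      by (subst distr_distr[OF measurable_tree_limit sub_meas[OF i]]) (simp add: comp_def G_def[abs_def])
    also have "distr M tree_law (\<lambda>\<omega>. subtree [i] (X \<omega>)) = distr (distr M tree_law X) tree_law (subtree [i])"
      using i by (subst distr_distr[OF measurable_subtree X_meas]) (simp_all add: comp_def)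
    also have "\<dots> = distr M tree_law X"
      using i unfolding distr_X by (intro distr_subtree) simp
    also have "distr \<dots> continuous_paths (tree_limit b) = distr M continuous_paths F"
      by (subst distr_distr[OF measurable_tree_limit X_meas]) (simp add: comp_def F_def[abs_def])
    finally show ?thesis .
  qed

  \<comment> \<open>The root, and for each letter \<open>i\<close> the words that start with \<open>i\<close>.\<close>
  define block where "block j = (case j of None \<Rightarrow> {[]} | Some i \<Rightarrow> (#) i ` ?words)" for j :: "nat option"
  let ?L = "insert None (Some ` {..<b})"
  let ?Y = "\<lambda>j \<omega>. restrict (\<lambda>w. W w \<omega>) (block j)"
  have blocks: "M.indep_vars (\<lambda>j. \<Pi>\<^sub>M w\<in>block j. complex_vectors b) ?Y ?L"
  proof (rule M.indep_vars_restrict[OF W_indep])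
    show "block j \<subseteq> ?words" if "j \<in> ?L" for j
      using that by (auto simp: block_def)
    show "disjoint_family_on block ?L"
      by (auto simp: disjoint_family_on_def block_def)
  qed
  have Y_meas: "?Y j \<in> M \<rightarrow>\<^sub>M (\<Pi>\<^sub>M w\<in>block j. complex_vectors b)" if "j \<in> ?L" for j
    using blocks that unfolding M.indep_vars_def by blast
  have indep: "M.indep_sets
      (\<lambda>j. case j of
          None \<Rightarrow> sets (vimage_algebra (space M) (W []) (complex_vectors b))
        | Some i \<Rightarrow> sets (vimage_algebra (space M) (G i) continuous_paths)) ?L"
  proof (rule M.indep_sets_mono_sets)
    show "M.indep_sets (\<lambda>j. {?Y j -` A \<inter> space M |A. A \<in> sets (\<Pi>\<^sub>M w\<in>block j. complex_vectors b)}) ?L"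
      using blocks unfolding M.indep_vars_def2 by blast
  next
    fix j assume j: "j \<in> ?L"
    show "(case j of
          None \<Rightarrow> sets (vimage_algebra (space M) (W []) (complex_vectors b))
        | Some i \<Rightarrow> sets (vimage_algebra (space M) (G i) continuous_paths))
      \<subseteq> {?Y j -` A \<inter> space M |A. A \<in> sets (\<Pi>\<^sub>M w\<in>block j. complex_vectors b)}"
    proof (cases j)
      case None
      have "sets (vimage_algebra (space M) (W []) (complex_vectors b))
          \<subseteq> {?Y j -` A \<inter> space M |A. A \<in> sets (\<Pi>\<^sub>M w\<in>block j. complex_vectors b)}"
      proof (rule vimage_algebra_factor_subset[OF Y_meas[OF j], where h = "\<lambda>x. x []"])
        show "(\<lambda>x. x []) \<in> (\<Pi>\<^sub>M w\<in>block j. complex_vectors b) \<rightarrow>\<^sub>M complex_vectors b"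
          by (rule measurable_component_singleton) (simp add: None block_def)
      qed (simp add: None block_def)
      then show ?thesis by (simp add: None)
    next
      case (Some i)
      then have i: "i < b" using j by auto
      have "sets (vimage_algebra (space M) (G i) continuous_paths)
          \<subseteq> {?Y j -` A \<inter> space M |A. A \<in> sets (\<Pi>\<^sub>M w\<in>block j. complex_vectors b)}"
      proof (rule vimage_algebra_factor_subset[OF Y_meas[OF j],
            where h = "\<lambda>x. tree_limit b (\<lambda>v\<in>?words. x (i # v))"])
        have "(\<lambda>x. \<lambda>v\<in>?words. x (i # v)) \<in> (\<Pi>\<^sub>M w\<in>block j. complex_vectors b) \<rightarrow>\<^sub>M tree_law"
          unfolding measurable_cong_sets[OF refl sets_tree_law]
          by (intro measurable_restrict measurable_component_singleton) (simp add: Some block_def)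
        then show "(\<lambda>x. tree_limit b (\<lambda>v\<in>?words. x (i # v)))
            \<in> (\<Pi>\<^sub>M w\<in>block j. complex_vectors b) \<rightarrow>\<^sub>M continuous_paths"
          by (rule measurable_compose[OF _ measurable_tree_limit])
      next
        fix \<omega>
        have "subtree [i] (X \<omega>) = (\<lambda>v\<in>?words. ?Y j \<omega> (i # v))"
          using i by (auto simp: fun_eq_iff X_def Some block_def)
        then show "G i \<omega> = tree_limit b (\<lambda>v\<in>?words. ?Y j \<omega> (i # v))"
          by (simp only: G_def)
      qed
      then show ?thesis by (simp add: Some)
    qed
  qed

  have scaling: "AE \<omega> in M. \<forall>i<b. \<forall>t\<in>{real i / real b..(real i + 1) / real b}.
      F \<omega> t = F \<omega> (real i / real b) + W [] \<omega> i * G i \<omega> (inv (similarity b i) t)"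
    using AE_X[OF AE_all_subtrees[OF AE_S]]
  proof eventually_elim
    case (elim \<omega>)
    show ?case
    proof (intro allI impI ballI)
      fix i t assume i: "i < b" and t: "t \<in> {real i / real b..(real i + 1) / real b}"
      have "real i \<le> real b * t" "real b * t \<le> real i + 1"
        using t b0 by (auto simp: pos_divide_le_eq pos_le_divide_eq mult.commute)
      then have "tree_limit b (X \<omega>) t = tree_limit b (X \<omega>) (real i / real b)
          + X \<omega> [] i * tree_limit b (subtree [i] (X \<omega>)) (real b * t - real i)"
      proof (intro tree_limit_scaling[OF b0 _ _ i])
        show "summable (\<lambda>n. sup_norm (increment b n (X \<omega>)))"
          using bspec[OF elim, of "[]"] by simp
        show "summable (\<lambda>n. sup_norm (increment b n (subtree [j] (X \<omega>))))" if "j < b" for j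
          using that by (intro bspec[OF elim]) simp
      qed
      then show "F \<omega> t = F \<omega> (real i / real b) + W [] \<omega> i * G i \<omega> (inv (similarity b i) t)"
        by (simp add: F_def G_def X_def inv_similarity[OF b0])
    qed
  qed

  show ?thesis
  proof (intro exI[of _ F] conjI)
    show "\<forall>n\<ge>1. integrable M (\<lambda>\<omega>. sup_norm (\<lambda>t. cascade b W n \<omega> t - F \<omega> t) powr p)"
      unfolding err using err_int by blast
    show "(\<lambda>n. M.expectation (\<lambda>\<omega>. sup_norm (\<lambda>t. cascade b W n \<omega> t - F \<omega> t) powr p)) \<longlonglongrightarrow> 0"
      unfolding err by (rule err_lim)
    show "(AE \<omega> in M. \<forall>i<b. W [] \<omega> i \<in> \<real>\<^sub>\<ge>\<^sub>0) \<longrightarrow>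
        (AE \<omega> in M. (\<forall>t\<in>{0..1}. F \<omega> t \<in> \<real>) \<and> mono_on {0..1} (\<lambda>t. Re (F \<omega> t)))"
      using monotone by (rule impI)
    show "\<exists>G :: nat \<Rightarrow> 'a \<Rightarrow> real \<Rightarrow> complex.
      (\<forall>i<b. G i \<in> measurable M continuous_paths \<and>
        distr M continuous_paths (G i) = distr M continuous_paths F) \<and>
      M.indep_sets
        (\<lambda>j. case j of
            None \<Rightarrow> sets (vimage_algebra (space M) (W []) (complex_vectors b))
          | Some i \<Rightarrow> sets (vimage_algebra (space M) (G i) continuous_paths)) ?L \<and>
      (AE \<omega> in M. \<forall>i<b. \<forall>t\<in>{real i / real b..(real i + 1) / real b}.
        F \<omega> t = F \<omega> (real i / real b) + W [] \<omega> i * G i \<omega> (inv (similarity b i) t))"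
      using G_meas G_distr indep scaling by (intro exI[of _ G] conjI allI impI)
  qed (rule F_meas uniform holder)+
qed

end
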